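(* The following two statements are equivalent: (a) The Jacobian conjecture holds for all $n\ge 1$; that is, for every $n\ge 1$, every polynomial map $F:\mathbb{C}^n\to\mathbb{C}^n$ whose Jacobian determinant is identically $1$ is an automorphism of $\mathbb{C}^n$ (i.e. has a polynomial inverse). (b) For every $n\ge 1$ and every homogeneous polynomial $P(z)\in\mathbb{C}[z]=\mathbb{C}[z_1,\dots,z_n]$ of degree $4$, the image conjecture holds for $f(\xi,z)=\big(\sum_{i=1}^n\xi_i^2\big)P(z)$ and $g(z)=P(z)$; that is, if $f^m\in\operatorname{Im}\Theta$ for each $m\ge 1$, then $f^m g\in\operatorname{Im}\Theta$ for all sufficiently large $m$.
   Context: Here $z=(z_1,\dots,z_n)$ and $\xi=(\xi_1,\dots,\xi_n)$ are commuting free variables, $\mathbb{C}[\xi,z]$ is the polynomial algebra, $\partial_i:=\partial/\partial z_i$, $\Theta_i:=\xi_i-\partial_i$ ($1\le i\le n$) is regarded as a differential operator of $\mathbb{C}[\xi,z]$, $\Theta:=\{\Theta_1,\dots,\Theta_n\}$, and $\operatorname{Im}\Theta:=\sum_{i=1}^n\Theta_i(\mathbb{C}[\xi,z])$. *)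

theory Defs
  imports
    Complex_Main
    "HOL-Library.Poly_Mapping"
    "Jordan_Normal_Form.Determinant"
begin

text \<open>A monomial is its finitely supported exponent function, and a polynomial is the finitely
  supported function assigning to each monomial its coefficient. The ring structure is the
  convolution product of \<^theory>\<open>HOL-Library.Poly_Mapping\<close>.\<close>

type_synonym 'v cpoly = "('v \<Rightarrow>\<^sub>0 nat) \<Rightarrow>\<^sub>0 complex"

definition cconst :: "complex \<Rightarrow> 'v cpoly" where
  "cconst c = Poly_Mapping.single 0 c"

definition cvar :: "'v \<Rightarrow> 'v cpoly" where
  "cvar v = Poly_Mapping.single (Poly_Mapping.single v 1) 1"

text \<open>The polynomial algebra on the set \<open>V\<close> of variables, inside the one on all variables.\<close>

definition cpolys :: "'v set \<Rightarrow> 'v cpoly set" where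
  "cpolys V = {p. \<forall>m \<in> Poly_Mapping.keys p. Poly_Mapping.keys m \<subseteq> V}"

definition homogeneous :: "nat \<Rightarrow> 'v cpoly \<Rightarrow> bool" where
  "homogeneous d p \<longleftrightarrow> (\<forall>m \<in> Poly_Mapping.keys p.
     (\<Sum>v \<in> Poly_Mapping.keys m. Poly_Mapping.lookup m v) = d)"

text \<open>If \<open>v\<close> does not occur in \<open>m\<close>, the truncated exponent is harmless: the factor
  \<open>lookup m v\<close> is then \<open>0\<close>.\<close>

definition pdiff :: "'v \<Rightarrow> 'v cpoly \<Rightarrow> 'v cpoly" where
  "pdiff v p = (\<Sum>m \<in> Poly_Mapping.keys p.
     Poly_Mapping.single (m - Poly_Mapping.single v 1)
       (of_nat (Poly_Mapping.lookup m v) * Poly_Mapping.lookup p m))"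

definition csubst :: "('v \<Rightarrow> 'w cpoly) \<Rightarrow> 'v cpoly \<Rightarrow> 'w cpoly" where
  "csubst s p = (\<Sum>m \<in> Poly_Mapping.keys p.
     cconst (Poly_Mapping.lookup p m) * (\<Prod>v \<in> Poly_Mapping.keys m. s v ^ Poly_Mapping.lookup m v))"


text \<open>Variables are indexed by \<open>0, \<dots>, n - 1\<close> instead of \<open>1, \<dots>, n\<close>. A polynomial map of
  \<open>\<complex>\<^sup>n\<close> is given by its component polynomials \<open>F 0, \<dots>, F (n - 1)\<close>; the values
  \<open>F i\<close> for \<open>i \<ge> n\<close> are irrelevant throughout.\<close>

definition polynomial_map :: "nat \<Rightarrow> (nat \<Rightarrow> nat cpoly) \<Rightarrow> bool" where
  "polynomial_map n F \<longleftrightarrow> (\<forall>i<n. F i \<in> cpolys {..<n})"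

definition jacobian_matrix :: "nat \<Rightarrow> (nat \<Rightarrow> nat cpoly) \<Rightarrow> nat cpoly mat" where
  "jacobian_matrix n F = mat n n (\<lambda>(i, j). pdiff j (F i))"

definition polynomial_automorphism :: "nat \<Rightarrow> (nat \<Rightarrow> nat cpoly) \<Rightarrow> bool" where
  "polynomial_automorphism n F \<longleftrightarrow> polynomial_map n F \<and>
     (\<exists>G. polynomial_map n G \<and>
       (\<forall>i<n. csubst G (F i) = cvar i) \<and> (\<forall>i<n. csubst F (G i) = cvar i))"

definition jacobian_conjecture :: "nat \<Rightarrow> bool" where
  "jacobian_conjecture n \<longleftrightarrow>
     (\<forall>F. polynomial_map n F \<and> det (jacobian_matrix n F) = 1 \<longrightarrow> polynomial_automorphism n F)"


datatype xz = Xi nat | Z nat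

definition Cz :: "nat \<Rightarrow> xz cpoly set" where
  "Cz n = cpolys (Z ` {..<n})"

definition Cxz :: "nat \<Rightarrow> xz cpoly set" where
  "Cxz n = cpolys (Xi ` {..<n} \<union> Z ` {..<n})"

definition Theta :: "nat \<Rightarrow> xz cpoly \<Rightarrow> xz cpoly" where
  "Theta i h = cvar (Xi i) * h - pdiff (Z i) h"

definition Im_Theta :: "nat \<Rightarrow> xz cpoly set" where
  "Im_Theta n = {\<Sum>i<n. Theta i (h i) | h. \<forall>i<n. h i \<in> Cxz n}"

definition image_conjecture_for :: "nat \<Rightarrow> xz cpoly \<Rightarrow> xz cpoly \<Rightarrow> bool" where
  "image_conjecture_for n f g \<longleftrightarrow>
     ((\<forall>m\<ge>1. f ^ m \<in> Im_Theta n) \<longrightarrow> (\<exists>N. \<forall>m\<ge>N. f ^ m * g \<in> Im_Theta n))"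

end

theory Submission
  imports Defs "HOL-Computational_Algebra.Formal_Power_Series"
begin

text \<open>Both statements are brought to a statement about the power series that inverts a cubic
  perturbation of the identity.

  \<^bold>\<open>From images to Laplacians.\<close> Modulo \<open>Im \<Theta>\<close>, multiplication by \<open>\<xi>\<^sub>i\<close> is the derivation
  \<open>\<partial>\<^sub>i\<close>, so \<open>(\<Sum> \<xi>\<^sub>i\<^sup>2)\<^sup>m p\<close> is congruent to \<open>\<Delta>\<^sup>m p\<close> for \<open>p\<close> in \<open>\<complex>[z]\<close>; and \<open>Im \<Theta>\<close>
  meets \<open>\<complex>[z]\<close> only in \<open>0\<close> (\<open>Im_Theta_inter_Cz\<close>). Hence the image conjecture for
  \<open>f = (\<Sum> \<xi>\<^sub>i\<^sup>2) P\<close> and \<open>g = P\<close> is the vanishing property of Zhao: if \<open>\<Delta>\<^sup>m P\<^sup>m = 0\<close> for all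
  \<open>m \<ge> 1\<close>, then \<open>\<Delta>\<^sup>m P\<^sup>m\<^sup>+\<^sup>1 = 0\<close> for all large \<open>m\<close> (\<open>image_conjecture_iff_vanishing\<close>).

  \<^bold>\<open>From Laplacians to inverse maps.\<close> Let \<open>P\<close> be a quartic form, \<open>H = \<nabla>P\<close>, and let the power
  series \<open>Q = P + t Q\<^sub>1 + t\<^sup>2 Q\<^sub>2 + \<dots>\<close> solve the Hamilton-Jacobi equation
  \<open>2 \<partial>\<^sub>t Q = \<parallel>\<nabla>Q\<parallel>\<^sup>2\<close>. As long as \<open>\<Delta>Q\<close> vanishes, \<open>\<Delta> Q\<^sup>m\<^sup>+\<^sup>1 = 2 (m + 1) \<partial>\<^sub>t Q\<^sup>m\<close>, so \<open>Q\<^sub>k\<close> is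
  a nonzero multiple of \<open>\<Delta>\<^sup>k P\<^sup>k\<^sup>+\<^sup>1\<close>; it follows that \<open>\<Delta>Q = 0\<close> if and only if
  \<open>\<Delta>\<^sup>m P\<^sup>m = 0\<close> for all \<open>m \<ge> 1\<close> (\<open>laplacian_0_iff\<close>, \<open>coeff_eq_0_iff\<close>). The gradient \<open>V = \<nabla>Q\<close>
  solves the Burgers equation \<open>\<partial>\<^sub>t V = (V \<sqdot> \<nabla>) V\<close> with initial value \<open>H\<close>. Its Jacobian matrix
  \<open>M\<close> satisfies \<open>\<delta>M = M\<^sup>2\<close> for the derivation \<open>\<delta> = \<partial>\<^sub>t - V \<sqdot> \<nabla>\<close>, and therefore \<open>tr M = \<Delta>Q\<close>
  vanishes if and only if all powers of the Jacobian matrix of \<open>H\<close> have trace zero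
  (\<open>divergence_0_iff_traces_0\<close>). By Jacobi's formula and homogeneity this means that the
  Jacobian determinant of \<open>F = id - H\<close> is \<open>1\<close> (\<open>det_one_minus_homogeneous_iff\<close>).
  Finally the value of \<open>id + V\<close> at \<open>t = 1\<close> is the formal inverse of \<open>F\<close> (\<open>csubst_F_S\<close>), so that
  \<open>F\<close> has a polynomial inverse if and only if almost all coefficients of \<open>V\<close> vanish
  (\<open>finite_if_left_inverse\<close>, \<open>left_inverse_if_finite\<close>).

  \<^bold>\<open>The equivalence.\<close> The Jacobian conjecture for \<open>id - \<nabla>P\<close> gives the vanishing property of
  \<open>P\<close>. For the converse, adding variables reduces an arbitrary map of Jacobian determinant
  \<open>1\<close> first to degree three and then to the form \<open>id - H\<close> with a cubic form \<open>H\<close>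
  (\<open>degree_reduction\<close>, \<open>normalisation\<close>, \<open>homogenisation\<close>). Such an \<open>H\<close> need not be a
  gradient, but in twice as many variables \<open>z\<^sub>j, z'\<^sub>j\<close> the quartic form
  \<open>P = 1/2 \<Sum> (z\<^sub>j - \<i> z'\<^sub>j) H\<^sub>j (z + \<i> z')\<close> carries the same information: applying the same
  formula to the Burgers solution of \<open>H\<close> gives the Hamilton-Jacobi solution of \<open>P\<close>.

  A left inverse of a polynomial map of Jacobian determinant \<open>1\<close> is automatically an inverse
  (\<open>keller_left_inverse_imp_automorphism\<close>). Each reduction therefore only has to transport left
  inverses, which takes a single substitution (\<open>left_inverse_transfer\<close>).\<close>

section \<open>Monomials\<close>

abbreviation lkp :: "('a \<Rightarrow>\<^sub>0 'b::zero) \<Rightarrow> 'a \<Rightarrow> 'b" where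
  "lkp \<equiv> Poly_Mapping.lookup"

abbreviation mvar :: "'v \<Rightarrow> ('v \<Rightarrow>\<^sub>0 nat)" where
  "mvar v \<equiv> Poly_Mapping.single v (Suc 0)"

definition mdeg :: "('v \<Rightarrow>\<^sub>0 nat) \<Rightarrow> nat" where
  "mdeg m = (\<Sum>v \<in> Poly_Mapping.keys m. lkp m v)"

definition msubst :: "('v \<Rightarrow> 'a::comm_semiring_1) \<Rightarrow> ('v \<Rightarrow>\<^sub>0 nat) \<Rightarrow> 'a" where
  "msubst s m = (\<Prod>v \<in> Poly_Mapping.keys m. s v ^ lkp m v)"

definition order_ge :: "nat \<Rightarrow> 'v cpoly \<Rightarrow> bool" where
  "order_ge d p \<longleftrightarrow> (\<forall>m \<in> Poly_Mapping.keys p. d \<le> mdeg m)"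

lemmas pdiff_altdef = pdiff_def[unfolded One_nat_def]
  and cvar_altdef = cvar_def[unfolded One_nat_def]

lemma homogeneous_mdeg: "homogeneous d p \<longleftrightarrow> (\<forall>m \<in> Poly_Mapping.keys p. mdeg m = d)"
  by (simp add: homogeneous_def mdeg_def)

lemma keys_add_nat: "Poly_Mapping.keys (m + m' :: 'v \<Rightarrow>\<^sub>0 nat) = Poly_Mapping.keys m \<union> Poly_Mapping.keys m'"
  by (auto simp: in_keys_iff lookup_add)

lemma mdeg_superset:
  "finite S \<Longrightarrow> Poly_Mapping.keys m \<subseteq> S \<Longrightarrow> mdeg m = (\<Sum>v\<in>S. lkp m v)"
  unfolding mdeg_def by (rule sum.mono_neutral_left) (auto simp: in_keys_iff)

lemma msubst_superset:
  "finite S \<Longrightarrow> Poly_Mapping.keys m \<subseteq> S \<Longrightarrow> msubst s m = (\<Prod>v\<in>S. s v ^ lkp m v)"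
  unfolding msubst_def by (rule prod.mono_neutral_left) (auto simp: in_keys_iff)

lemma mdeg_add: "mdeg (m + m') = mdeg m + mdeg m'"
proof -
  let ?S = "Poly_Mapping.keys m \<union> Poly_Mapping.keys m'"
  have "mdeg (m + m') = (\<Sum>v\<in>?S. lkp (m + m') v)"
    by (rule mdeg_superset) (auto simp: keys_add_nat)
  moreover have "mdeg m = (\<Sum>v\<in>?S. lkp m v)" "mdeg m' = (\<Sum>v\<in>?S. lkp m' v)"
    by (rule mdeg_superset; auto)+
  ultimately show ?thesis by (simp add: lookup_add sum.distrib)
qed

lemma msubst_add: "msubst s (m + m') = msubst s m * msubst s m'"
proof -
  let ?S = "Poly_Mapping.keys m \<union> Poly_Mapping.keys m'"
  have "msubst s (m + m') = (\<Prod>v\<in>?S. s v ^ lkp (m + m') v)"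
    by (rule msubst_superset) (auto simp: keys_add_nat)
  moreover have "msubst s m = (\<Prod>v\<in>?S. s v ^ lkp m v)" "msubst s m' = (\<Prod>v\<in>?S. s v ^ lkp m' v)"
    by (rule msubst_superset; auto)+
  ultimately show ?thesis by (simp add: lookup_add power_add prod.distrib)
qed

lemma mdeg_0 [simp]: "mdeg 0 = 0"
  by (simp add: mdeg_def)

lemma mdeg_mvar [simp]: "mdeg (mvar v) = 1"
  by (simp add: mdeg_def)

lemma msubst_0 [simp]: "msubst s 0 = 1"
  by (simp add: msubst_def)

lemma msubst_mvar [simp]: "msubst s (mvar v) = s v"
  by (simp add: msubst_def)

lemma mdeg_eq_0_iff: "mdeg m = 0 \<longleftrightarrow> m = 0"
  by (auto simp: mdeg_def in_keys_iff intro!: poly_mapping_eqI)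

lemma minus_mvar_add:
  "lkp m v \<noteq> 0 \<Longrightarrow> m - mvar v + mvar v = m"
  by (rule poly_mapping_eqI) (auto simp: lookup_add lookup_minus lookup_single when_def)

lemma add_mvar_minus: "m + mvar v - mvar v = m"
  by (rule poly_mapping_eqI) (auto simp: lookup_add lookup_minus lookup_single when_def)

lemma mdeg_1_imp_mvar:
  assumes "mdeg m = 1"
  shows "\<exists>v. m = mvar v"
proof -
  have "m \<noteq> 0" using assms by auto
  then obtain v where v: "lkp m v \<noteq> 0" by (metis lookup_zero poly_mapping_eqI)
  have "mdeg (m - mvar v) = 0"
    using minus_mvar_add[OF v] mdeg_add[of "m - mvar v" "mvar v"] assms by simp
  then show ?thesis using minus_mvar_add[OF v] by (auto simp: mdeg_eq_0_iff)
qed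

section \<open>Polynomials\<close>

lemma single_sum_keys: "(\<Sum>m\<in>Poly_Mapping.keys p. Poly_Mapping.single m (lkp p m)) = p"
  by (rule poly_mapping_eqI)
    (auto simp: lookup_sum lookup_single when_def in_keys_iff)

lemma cconst_add: "cconst (a + b) = cconst a + cconst b"
  by (simp add: cconst_def single_add)
lemma cconst_mult: "cconst (a * b) = cconst a * cconst b"
  by (simp add: cconst_def mult_single)
lemma cconst_0 [simp]: "cconst 0 = 0"
  by (simp add: cconst_def)
lemma cconst_1 [simp]: "cconst 1 = 1"
  by (simp add: cconst_def)
lemma cconst_uminus: "cconst (- a) = - cconst a"
  by (simp add: cconst_def single_uminus)
lemma cconst_of_nat [simp]: "cconst (of_nat k) = of_nat k"
  by (simp add: cconst_def)
lemma cconst_numeral [simp]: "cconst (numeral k) = numeral k"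
  by (simp add: cconst_def)

lemma lookup_cconst: "lkp (cconst c) m = (c when m = 0)"
  by (simp add: cconst_def lookup_single when_def)

lemma cconst_times_single: "cconst c * Poly_Mapping.single m d = Poly_Mapping.single m (c * d)"
  by (simp add: cconst_def mult_single)

lemma cvar_times_single: "cvar v * Poly_Mapping.single m d = Poly_Mapping.single (mvar v + m) d"
  by (simp add: cvar_altdef mult_single)

lemma lookup_cconst_mult: "lkp (cconst c * p) m = c * lkp p m"
proof -
  have "cconst c * p = (\<Sum>m\<in>Poly_Mapping.keys p. Poly_Mapping.single m (c * lkp p m))"
    by (subst (1) single_sum_keys[of p, symmetric]) (simp add: sum_distrib_left cconst_times_single)
  then show ?thesis
    by (auto simp: lookup_sum lookup_single when_def in_keys_iff)
qed

lemma cpoly_induct [case_names single add]: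
  assumes "\<And>m c. P (Poly_Mapping.single m c)" and "\<And>p q. P p \<Longrightarrow> P q \<Longrightarrow> P (p + q)"
  shows "P (p :: 'v cpoly)"
proof -
  have "P (\<Sum>m\<in>S. Poly_Mapping.single m (lkp p m))" if "finite S" for S
    using that
  proof induction
    case empty
    then show ?case using assms(1)[of 0 0] by simp
  qed (auto intro: assms)
  then show ?thesis using single_sum_keys[of p] finite_keys by metis
qed

text \<open>Substitution, differentiation and the functionals below are sums over the keys of a polynomial.
  Cancellation makes the keys of \<open>p + q\<close> differ from the union of the keys, so additivity
  needs an argument, given once here.\<close>

lemma sum_keys_add:
  fixes g :: "('v \<Rightarrow>\<^sub>0 nat) \<Rightarrow> complex \<Rightarrow> 'b::comm_monoid_add"
  assumes "\<And>m. g m 0 = 0" "\<And>m a b. g m (a + b) = g m a + g m b"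
  shows "(\<Sum>m\<in>Poly_Mapping.keys (p + q). g m (lkp (p + q) m)) =
    (\<Sum>m\<in>Poly_Mapping.keys p. g m (lkp p m)) + (\<Sum>m\<in>Poly_Mapping.keys q. g m (lkp q m))"
  by (rule setsum_keys_plus_distrib) (auto simp: assms)

lemma pdiff_add: "pdiff v (p + q) = pdiff v p + pdiff v q"
  unfolding pdiff_altdef
  by (rule sum_keys_add[where g = "\<lambda>m c. Poly_Mapping.single (m - mvar v) (of_nat (lkp m v) * c)"])
    (auto simp: single_add distrib_left)

lemma csubst_add: "csubst s (p + q) = csubst s p + csubst s q"
  unfolding csubst_def
  by (rule sum_keys_add[where g = "\<lambda>m c. cconst c * (\<Prod>v\<in>Poly_Mapping.keys m. s v ^ lkp m v)"])
    (auto simp: cconst_add distrib_right)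

lemma pdiff_single:
  "pdiff v (Poly_Mapping.single m c) = Poly_Mapping.single (m - mvar v) (of_nat (lkp m v) * c)"
  by (simp add: pdiff_altdef)

lemma csubst_single: "csubst s (Poly_Mapping.single m c) = cconst c * msubst s m"
  by (simp add: csubst_def msubst_def)

lemma pdiff_0 [simp]: "pdiff v 0 = 0"
  by (simp add: pdiff_altdef)
lemma csubst_0 [simp]: "csubst s 0 = 0"
  by (simp add: csubst_def)
lemma pdiff_cconst [simp]: "pdiff v (cconst c) = 0"
  by (simp add: cconst_def pdiff_single)
lemma csubst_cconst [simp]: "csubst s (cconst c) = cconst c"
  by (metis cconst_def csubst_single msubst_0 mult.right_neutral)
lemma csubst_1 [simp]: "csubst s 1 = 1"
  using csubst_cconst[of s 1] by simp
lemma csubst_numeral [simp]: "csubst s (numeral k) = numeral k"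
  using csubst_cconst[of s "numeral k"] by simp
lemma pdiff_cvar: "pdiff v (cvar w) = (if v = w then 1 else 0)"
  by (auto simp: cvar_altdef pdiff_single lookup_single when_def)
lemma csubst_cvar [simp]: "csubst s (cvar v) = s v"
  by (simp add: cvar_altdef csubst_single)

lemma lookup_pdiff: "lkp (pdiff v p) m = of_nat (Suc (lkp m v)) * lkp p (m + mvar v)"
proof (induction p rule: cpoly_induct)
  case (single k c)
  show ?case
  proof (cases "lkp k v = 0")
    case True
    then have "k \<noteq> m + mvar v" by (auto simp: lookup_add)
    with True show ?thesis by (simp add: pdiff_single lookup_single when_def)
  next
    case False
    then have "k - mvar v = m \<longleftrightarrow> k = m + mvar v"
      using minus_mvar_add add_mvar_minus by metis
    then show ?thesis
      by (auto simp: pdiff_single lookup_single when_def lookup_add)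
  qed
next
  case (add p q)
  then show ?case by (simp add: pdiff_add lookup_add algebra_simps)
qed

lemma keys_pdiff: "m \<in> Poly_Mapping.keys (pdiff v p) \<Longrightarrow> m + mvar v \<in> Poly_Mapping.keys p"
  by (auto simp: in_keys_iff lookup_pdiff)

lemma csubst_mult: "csubst s (p * q) = csubst s p * csubst s q"
proof (induction p rule: cpoly_induct)
  case (single m c)
  show ?case
    by (induction q rule: cpoly_induct)
      (auto simp: mult_single csubst_single msubst_add cconst_mult distrib_left csubst_add)
qed (auto simp: distrib_right csubst_add)

lemma pdiff_single_mult:
  "pdiff v (Poly_Mapping.single m c * Poly_Mapping.single k d) =
   pdiff v (Poly_Mapping.single m c) * Poly_Mapping.single k d +
   Poly_Mapping.single m c * pdiff v (Poly_Mapping.single k d)"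
proof -
  have 1: "Poly_Mapping.single (m + k - mvar v) (of_nat (lkp m v) * (c * d)) =
      Poly_Mapping.single (m - mvar v + k) (of_nat (lkp m v) * c * d)" for m k :: "'a \<Rightarrow>\<^sub>0 nat" and c d :: complex
  proof (cases "lkp m v = 0")
    case False
    have "m + k - mvar v = m - mvar v + mvar v + k - mvar v"
      using minus_mvar_add[OF False] by simp
    also have "\<dots> = m - mvar v + k"
      using add_mvar_minus[of "m - mvar v + k" v] by (simp add: ac_simps)
    finally show ?thesis by (simp add: mult.assoc)
  qed simp
  show ?thesis
    using 1[of m k c d] 1[of k m d c]
    by (simp add: pdiff_single mult_single lookup_add distrib_left distrib_right single_add ac_simps)
qed

lemma pdiff_mult: "pdiff v (p * q) = pdiff v p * q + p * pdiff v q"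
proof (induction p rule: cpoly_induct)
  case (single m c)
  show ?case
    by (induction q rule: cpoly_induct)
      (auto simp: pdiff_single_mult distrib_left pdiff_add algebra_simps)
qed (auto simp: algebra_simps pdiff_add)

lemma csubst_uminus: "csubst s (- p) = - csubst s p"
  using csubst_add[of s p "- p"] by (simp add: eq_neg_iff_add_eq_0 add.commute)
lemma csubst_diff: "csubst s (p - q) = csubst s p - csubst s q"
  using csubst_add[of s p "- q"] by (simp add: csubst_uminus)
lemma csubst_sum: "csubst s (sum f S) = (\<Sum>x\<in>S. csubst s (f x))"
  by (induction S rule: infinite_finite_induct) (auto simp: csubst_add)
lemma csubst_power: "csubst s (p ^ k) = csubst s p ^ k"
  by (induction k) (auto simp: csubst_mult)

lemma comm_ring_hom_csubst: "comm_ring_hom (csubst s)"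
  by unfold_locales (auto simp: csubst_add csubst_mult)

lemma csubst_csubst: "csubst s (csubst r p) = csubst (\<lambda>v. csubst s (r v)) p"
proof (induction p rule: cpoly_induct)
  case (single m c)
  have "csubst s (\<Prod>v\<in>S. r v ^ lkp m v) = (\<Prod>v\<in>S. csubst s (r v) ^ lkp m v)" for S
    by (induction S rule: infinite_finite_induct) (auto simp: csubst_mult csubst_power)
  then show ?case by (simp add: csubst_single csubst_mult msubst_def)
qed (auto simp: csubst_add)

section \<open>Polynomials in a subset of the variables\<close>

lemma cpolys_cconst [simp, intro]: "cconst c \<in> cpolys V"
  by (auto simp: cpolys_def cconst_def)
lemma cpolys_0 [simp, intro]: "0 \<in> cpolys V"
  by (auto simp: cpolys_def)
lemma cpolys_1 [simp, intro]: "1 \<in> cpolys V"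
  by (auto simp: cpolys_def)
lemma cpolys_cvar [simp]: "cvar v \<in> cpolys V \<longleftrightarrow> v \<in> V"
  by (auto simp: cpolys_def cvar_altdef)
lemma cpolys_add [intro]: "p \<in> cpolys V \<Longrightarrow> q \<in> cpolys V \<Longrightarrow> p + q \<in> cpolys V"
  using keys_add[of p q] by (auto simp: cpolys_def)
lemma cpolys_uminus [intro]: "p \<in> cpolys V \<Longrightarrow> - p \<in> cpolys V"
  by (auto simp: cpolys_def in_keys_iff)
lemma cpolys_diff [intro]: "p \<in> cpolys V \<Longrightarrow> q \<in> cpolys V \<Longrightarrow> p - q \<in> cpolys V"
  using cpolys_add[of p V "- q"] cpolys_uminus by auto
lemma cpolys_mult [intro]: "p \<in> cpolys V \<Longrightarrow> q \<in> cpolys V \<Longrightarrow> p * q \<in> cpolys V"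
  using keys_mult[of p q] by (fastforce simp: cpolys_def keys_add_nat)
lemma cpolys_power [intro]: "p \<in> cpolys V \<Longrightarrow> p ^ k \<in> cpolys V"
  by (induction k) auto
lemma cpolys_sum [intro]: "(\<And>x. x \<in> S \<Longrightarrow> f x \<in> cpolys V) \<Longrightarrow> sum f S \<in> cpolys V"
  by (induction S rule: infinite_finite_induct) auto
lemma cpolys_prod [intro]: "(\<And>x. x \<in> S \<Longrightarrow> f x \<in> cpolys V) \<Longrightarrow> prod f S \<in> cpolys V"
  by (induction S rule: infinite_finite_induct) auto
lemma cpolys_pdiff [intro]: "p \<in> cpolys V \<Longrightarrow> pdiff v p \<in> cpolys V"
  unfolding cpolys_def using keys_pdiff[of _ v p] by (fastforce simp: keys_add_nat)
lemma cpolys_mono: "p \<in> cpolys V \<Longrightarrow> V \<subseteq> W \<Longrightarrow> p \<in> cpolys W"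
  by (auto simp: cpolys_def)
lemma cpolys_UNIV [simp]: "p \<in> cpolys UNIV"
  by (auto simp: cpolys_def)

lemma cpolys_csubst [intro]:
  assumes "p \<in> cpolys V" "\<And>v. v \<in> V \<Longrightarrow> s v \<in> cpolys W"
  shows "csubst s p \<in> cpolys W"
  unfolding csubst_def
proof (intro cpolys_sum cpolys_mult cpolys_prod cpolys_power cpolys_cconst)
  fix m v assume "m \<in> Poly_Mapping.keys p" "v \<in> Poly_Mapping.keys m"
  then have "v \<in> V" using assms(1) by (auto simp: cpolys_def)
  then show "s v \<in> cpolys W" by (rule assms(2))
qed

lemma csubst_cong:
  assumes "p \<in> cpolys V" "\<And>v. v \<in> V \<Longrightarrow> s v = r v"
  shows "csubst s p = csubst r p"
  unfolding csubst_def using assms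
  by (intro sum.cong refl arg_cong2[where f = "(*)"] prod.cong arg_cong2[where f = "(^)"])
    (auto simp: cpolys_def)

lemma monomial_induct [consumes 1, case_names zero add]:
  assumes "Poly_Mapping.keys m \<subseteq> V" "P 0"
    "\<And>m v. Poly_Mapping.keys m \<subseteq> V \<Longrightarrow> v \<in> V \<Longrightarrow> P m \<Longrightarrow> P (mvar v + m)"
  shows "P (m :: 'v \<Rightarrow>\<^sub>0 nat)"
  using assms(1)
proof (induction "mdeg m" arbitrary: m)
  case 0
  then show ?case using assms(2) by (simp add: mdeg_eq_0_iff)
next
  case (Suc d)
  then have "m \<noteq> 0" by auto
  then obtain v where v: "lkp m v \<noteq> 0" by (metis lookup_zero poly_mapping_eqI)
  let ?k = "m - mvar v"
  have m: "m = mvar v + ?k" using minus_mvar_add[OF v] by (simp add: add.commute)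
  have "mdeg ?k = d" using Suc(2) mdeg_add[of "mvar v" ?k] m by simp
  moreover have "Poly_Mapping.keys ?k \<subseteq> V" using Suc(3) m keys_add_nat[of "mvar v" ?k] by auto
  moreover have "v \<in> V" using v Suc(3) by (auto simp: in_keys_iff)
  ultimately show ?case using Suc(1) assms(3) m by metis
qed

text \<open>Building polynomials from constants, multiplication by a variable and sums makes
  statements about substitutions, such as the chain rule, inductions that never touch
  exponents.\<close>

lemma cpolys_induct [consumes 1, case_names const var add]:
  assumes "p \<in> cpolys V"
    and const: "\<And>c. P (cconst c)"
    and var: "\<And>v p. v \<in> V \<Longrightarrow> p \<in> cpolys V \<Longrightarrow> P p \<Longrightarrow> P (cvar v * p)"
    and add: "\<And>p q. p \<in> cpolys V \<Longrightarrow> q \<in> cpolys V \<Longrightarrow> P p \<Longrightarrow> P q \<Longrightarrow> P (p + q)"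
  shows "P p"
proof -
  have mon: "P (Poly_Mapping.single m c)" if "Poly_Mapping.keys m \<subseteq> V" for m c
    using that
  proof (induction m rule: monomial_induct)
    case zero
    then show ?case using const by (simp add: cconst_def)
  next
    case (add m v)
    then have "Poly_Mapping.single m c \<in> cpolys V" by (auto simp: cpolys_def)
    then show ?case using var[of v "Poly_Mapping.single m c"] add by (simp add: cvar_times_single)
  qed
  have "P (\<Sum>m\<in>S. Poly_Mapping.single m (lkp p m))" if "finite S" "S \<subseteq> Poly_Mapping.keys p" for S
    using that
  proof induction
    case empty
    then show ?case using const[of 0] by simp
  next
    case (insert m S)
    have "Poly_Mapping.single k (lkp p k) \<in> cpolys V" if "k \<in> Poly_Mapping.keys p" for k
      using assms(1) that by (auto simp: cpolys_def)
    then show ?case using insert assms(1)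
      by (auto intro!: add mon cpolys_sum simp: cpolys_def)
  qed
  then show ?thesis using single_sum_keys[of p] finite_keys by (metis subset_refl)
qed

lemma csubst_cvar_id: "csubst cvar p = p"
proof -
  have "p \<in> cpolys UNIV" by simp
  then show ?thesis
    by (induction p rule: cpolys_induct) (auto simp: csubst_mult csubst_add)
qed

section \<open>Derivations\<close>

definition derivation :: "('a::comm_ring_1 \<Rightarrow> 'a) \<Rightarrow> bool" where
  "derivation d \<longleftrightarrow> (\<forall>x y. d (x + y) = d x + d y) \<and> (\<forall>x y. d (x * y) = d x * y + x * d y)"

lemma derivation_add: "derivation d \<Longrightarrow> d (x + y) = d x + d y"
  and derivation_mult: "derivation d \<Longrightarrow> d (x * y) = d x * y + x * d y"
  by (auto simp: derivation_def)

lemma derivation_0: "derivation d \<Longrightarrow> d 0 = 0"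
  using derivation_add[of d 0 0] by simp

lemma derivation_1: "derivation d \<Longrightarrow> d 1 = 0"
  using derivation_mult[of d 1 1] by simp

lemma derivation_uminus: "derivation d \<Longrightarrow> d (- x) = - d x"
  using derivation_add[of d x "- x"] derivation_0[of d] by (simp add: eq_neg_iff_add_eq_0 add.commute)

lemma derivation_diff: "derivation d \<Longrightarrow> d (x - y) = d x - d y"
  using derivation_add[of d x "- y"] derivation_uminus[of d y] by simp

lemma derivation_sum: "derivation d \<Longrightarrow> d (sum f S) = (\<Sum>x\<in>S. d (f x))"
  by (induction S rule: infinite_finite_induct) (auto simp: derivation_0 derivation_add)

lemma derivation_power: "derivation d \<Longrightarrow> d (x ^ k) = of_nat k * x ^ (k - 1) * d x"
proof (induction k)
  case (Suc k)
  then show ?case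
    by (cases k) (auto simp: derivation_mult algebra_simps)
qed (simp add: derivation_1)

lemma derivation_pdiff: "derivation (pdiff v)"
  by (auto simp: derivation_def pdiff_add pdiff_mult)

lemmas pdiff_uminus = derivation_uminus[OF derivation_pdiff]
  and pdiff_diff = derivation_diff[OF derivation_pdiff]
  and pdiff_sum = derivation_sum[OF derivation_pdiff]
  and pdiff_power = derivation_power[OF derivation_pdiff]
  and pdiff_1 [simp] = derivation_1[OF derivation_pdiff]

lemma pdiff_cconst_mult: "pdiff v (cconst c * p) = cconst c * pdiff v p"
  by (simp add: pdiff_mult)

lemma pdiff_commute: "pdiff v (pdiff w p) = pdiff w (pdiff v p)"
proof (rule poly_mapping_eqI)
  fix m
  show "lkp (pdiff v (pdiff w p)) m = lkp (pdiff w (pdiff v p)) m"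
    by (cases "v = w") (auto simp: lookup_pdiff lookup_add lookup_single when_def ac_simps)
qed

text \<open>Stated for an arbitrary derivation that kills constants, because it is applied both to the
  partial derivatives and to the Euler operator.\<close>

lemma chain_rule:
  assumes d: "derivation d" "\<And>c. d (cconst c) = 0" and "finite V" and "p \<in> cpolys V"
  shows "d (csubst s p) = (\<Sum>v\<in>V. csubst s (pdiff v p) * d (s v))"
  using assms(4)
proof (induction p rule: cpolys_induct)
  case (const c)
  then show ?case by (simp add: d)
next
  case (var w p)
  have "(\<Sum>v\<in>V. csubst s (pdiff v (cvar w * p)) * d (s v)) =
      (\<Sum>v\<in>V. (if v = w then csubst s p * d (s w) else 0) + s w * (csubst s (pdiff v p) * d (s v)))"
    by (intro sum.cong) (auto simp: pdiff_mult pdiff_cvar csubst_add csubst_mult algebra_simps)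
  also have "\<dots> = csubst s p * d (s w) + s w * d (csubst s p)"
    using var \<open>finite V\<close> by (simp add: sum.distrib sum_distrib_left)
  finally show ?case by (simp add: csubst_mult derivation_mult[OF d(1)] algebra_simps)
next
  case (add p q)
  then show ?case
    by (simp add: csubst_add pdiff_add derivation_add[OF d(1)] sum.distrib distrib_right)
qed

lemmas pdiff_csubst = chain_rule[OF derivation_pdiff pdiff_cconst]

lemma pdiff_eq_0_notin:
  assumes "p \<in> cpolys V" "v \<notin> V"
  shows "pdiff v p = 0"
  using assms(1)
  by (induction p rule: cpolys_induct) (use assms(2) in \<open>auto simp: pdiff_mult pdiff_cvar pdiff_add\<close>)

text \<open>This is where characteristic zero enters: the exponent by which differentiation multiplies
  a coefficient is invertible.\<close>

lemma gradient_0_imp_const: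
  assumes "p \<in> cpolys V" and "\<And>v. v \<in> V \<Longrightarrow> pdiff v p = 0"
  shows "p = cconst (lkp p 0)"
proof (rule poly_mapping_eqI)
  fix m
  show "lkp p m = lkp (cconst (lkp p 0)) m"
  proof (cases "m = 0")
    case False
    then obtain v where v: "lkp m v \<noteq> 0" by (metis lookup_zero poly_mapping_eqI)
    have "lkp p m = 0"
    proof (cases "v \<in> V")
      case True
      then have "lkp (pdiff v p) (m - mvar v) = 0" using assms(2) by simp
      then show ?thesis using minus_mvar_add[OF v] unfolding lookup_pdiff
        by (simp only: mult_eq_0_iff of_nat_eq_0_iff) auto
    next
      case False
      then have "m \<notin> Poly_Mapping.keys p" using assms(1) v
        unfolding cpolys_def in_keys_iff[symmetric] by blast
      then show ?thesis by (simp add: in_keys_iff)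
    qed
    then show ?thesis using False by (simp add: lookup_cconst)
  qed (simp add: lookup_cconst)
qed

lemma of_nat_mult_cpoly_eq_0: "of_nat k * (p :: 'v cpoly) = 0 \<Longrightarrow> k \<noteq> 0 \<Longrightarrow> p = 0"
proof -
  assume k: "k \<noteq> 0" and *: "of_nat k * p = 0"
  have "cconst (inverse (of_nat k)) * (of_nat k * p) = cconst (inverse (of_nat k) * of_nat k) * p"
    by (simp only: cconst_mult cconst_of_nat mult.assoc)
  also have "\<dots> = p" using k by simp
  finally show "p = 0" using * by simp
qed

section \<open>Degree and order\<close>

lemma order_ge_0 [simp]: "order_ge 0 p"
  by (simp add: order_ge_def)
lemma order_ge_zero [simp]: "order_ge d 0"
  by (simp add: order_ge_def)
lemma order_ge_add [intro]: "order_ge d p \<Longrightarrow> order_ge d q \<Longrightarrow> order_ge d (p + q)"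
  using keys_add[of p q] by (auto simp: order_ge_def)
lemma order_ge_uminus [intro]: "order_ge d p \<Longrightarrow> order_ge d (- p)"
  by (auto simp: order_ge_def in_keys_iff)
lemma order_ge_diff [intro]: "order_ge d p \<Longrightarrow> order_ge d q \<Longrightarrow> order_ge d (p - q)"
  using order_ge_add[of d p "- q"] order_ge_uminus[of d q] by simp
lemma order_ge_sum [intro]: "(\<And>x. x \<in> S \<Longrightarrow> order_ge d (f x)) \<Longrightarrow> order_ge d (sum f S)"
  by (induction S rule: infinite_finite_induct) auto
lemma order_ge_mult: "order_ge d p \<Longrightarrow> order_ge e q \<Longrightarrow> order_ge (d + e) (p * q)"
  using keys_mult[of p q] by (fastforce simp: order_ge_def mdeg_add intro: add_mono)
lemma order_ge_mono: "order_ge d p \<Longrightarrow> e \<le> d \<Longrightarrow> order_ge e p"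
  by (auto simp: order_ge_def)
lemma order_ge_pdiff: "order_ge (Suc d) p \<Longrightarrow> order_ge d (pdiff v p)"
  unfolding order_ge_def using keys_pdiff[of _ v p] by (fastforce simp: mdeg_add)
lemma order_ge_cvar [simp]: "order_ge (Suc 0) (cvar v)"
  by (simp add: order_ge_def cvar_altdef)
lemma order_ge_cconst_mult: "order_ge d p \<Longrightarrow> order_ge d (cconst c * p)"
  using order_ge_mult[of 0 _ d p] by simp
lemma order_ge_all_imp_0: "(\<And>d. order_ge d p) \<Longrightarrow> p = 0"
  unfolding order_ge_def
  by (metis keys_eq_empty not_less_eq_eq equals0I order_refl)

lemma homogeneous_0 [simp]: "homogeneous d 0"
  by (simp add: homogeneous_def)
lemma homogeneous_cconst [simp]: "homogeneous 0 (cconst c)"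
  by (simp add: homogeneous_mdeg cconst_def)
lemma homogeneous_cvar [simp]: "homogeneous (Suc 0) (cvar v)"
  by (simp add: homogeneous_mdeg cvar_altdef)
lemma homogeneous_add [intro]: "homogeneous d p \<Longrightarrow> homogeneous d q \<Longrightarrow> homogeneous d (p + q)"
  using keys_add[of p q] by (auto simp: homogeneous_mdeg)
lemma homogeneous_uminus [intro]: "homogeneous d p \<Longrightarrow> homogeneous d (- p)"
  by (auto simp: homogeneous_mdeg in_keys_iff)
lemma homogeneous_diff [intro]: "homogeneous d p \<Longrightarrow> homogeneous d q \<Longrightarrow> homogeneous d (p - q)"
  using homogeneous_add[of d p "- q"] homogeneous_uminus[of d q] by simp
lemma homogeneous_sum [intro]: "(\<And>x. x \<in> S \<Longrightarrow> homogeneous d (f x)) \<Longrightarrow> homogeneous d (sum f S)"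
  by (induction S rule: infinite_finite_induct) auto
lemma homogeneous_mult: "homogeneous d p \<Longrightarrow> homogeneous e q \<Longrightarrow> homogeneous (d + e) (p * q)"
  using keys_mult[of p q] by (fastforce simp: homogeneous_mdeg mdeg_add)
lemma homogeneous_pdiff: "homogeneous (Suc d) p \<Longrightarrow> homogeneous d (pdiff v p)"
  unfolding homogeneous_mdeg using keys_pdiff[of _ v p] by (fastforce simp: mdeg_add)
lemma homogeneous_cconst_mult: "homogeneous d p \<Longrightarrow> homogeneous d (cconst c * p)"
  using homogeneous_mult[of 0 _ d p] by simp
lemma homogeneous_imp_order_ge: "homogeneous d p \<Longrightarrow> order_ge d p"
  by (simp add: homogeneous_mdeg order_ge_def)

lemma homogeneous_csubst:
  assumes "homogeneous d p" and s: "\<And>v. homogeneous 1 (s v)"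
  shows "homogeneous d (csubst s p)"
proof -
  have pow: "homogeneous k (s v ^ k)" for v k
    using homogeneous_mult[OF s[of v]] by (induction k) (auto simp: homogeneous_cconst[of 1, simplified])
  have prod: "homogeneous (\<Sum>v\<in>S. lkp m v) (\<Prod>v\<in>S. s v ^ lkp m v)" if "finite S" for S m
    using that by induction (auto intro: homogeneous_mult pow simp: homogeneous_cconst[of 1, simplified])
  have "homogeneous (mdeg m) (\<Prod>v\<in>Poly_Mapping.keys m. s v ^ lkp m v)" for m
    unfolding mdeg_def by (rule prod) simp
  then show ?thesis
    using assms(1) unfolding csubst_def homogeneous_mdeg[of d p]
    by (intro homogeneous_sum homogeneous_cconst_mult) metis
qed

lemma order_ge_csubst:
  assumes "order_ge d p" and s: "\<And>m v. m \<in> Poly_Mapping.keys p \<Longrightarrow> v \<in> Poly_Mapping.keys m \<Longrightarrow> order_ge 1 (s v)"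
  shows "order_ge d (csubst s p)"
proof -
  have pow: "order_ge k (s v ^ k)" if "order_ge 1 (s v)" for v k
    using order_ge_mult[OF that] by (induction k) auto
  have prod: "order_ge (\<Sum>v\<in>S. lkp m v) (\<Prod>v\<in>S. s v ^ lkp m v)"
    if "finite S" "\<And>v. v \<in> S \<Longrightarrow> order_ge 1 (s v)" for S m
    using that
  proof induction
    case (insert w S)
    then have "order_ge (lkp m w) (s w ^ lkp m w)" by (intro pow) simp
    then show ?case using insert by (auto intro!: order_ge_mult)
  qed simp
  have "order_ge (mdeg m) (\<Prod>v\<in>Poly_Mapping.keys m. s v ^ lkp m v)" if "m \<in> Poly_Mapping.keys p" for m
    unfolding mdeg_def by (rule prod) (use s that in auto)
  then show ?thesis
    using assms(1) unfolding csubst_def order_ge_def[of d p]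
    by (intro order_ge_sum order_ge_cconst_mult) (meson order_ge_mono)
qed

section \<open>The image of \<open>\<Theta>\<close> and the Laplacian\<close>

definition laplacian :: "nat \<Rightarrow> (nat \<Rightarrow> 'v) \<Rightarrow> 'v cpoly \<Rightarrow> 'v cpoly" where
  "laplacian n z p = (\<Sum>i<n. pdiff (z i) (pdiff (z i) p))"

lemma laplacian_cconst_mult: "laplacian n z (cconst c * p) = cconst c * laplacian n z p"
  by (simp add: laplacian_def pdiff_cconst_mult sum_distrib_left)

lemma laplacian_cpolys: "p \<in> cpolys V \<Longrightarrow> laplacian n z p \<in> cpolys V"
  unfolding laplacian_def by auto

lemma laplacian_pow_cpolys: "p \<in> cpolys V \<Longrightarrow> (laplacian n z ^^ k) p \<in> cpolys V"
  by (induction k) (auto intro: laplacian_cpolys)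

lemma Theta_0 [simp]: "Theta i 0 = 0"
  by (simp add: Theta_def)
lemma Theta_add: "Theta i (p + q) = Theta i p + Theta i q"
  by (simp add: Theta_def pdiff_add algebra_simps)
lemma Theta_uminus: "Theta i (- p) = - Theta i p"
  by (simp add: Theta_def pdiff_uminus algebra_simps)
lemma Theta_Xi_mult: "Theta i (cvar (Xi j) * p) = cvar (Xi j) * Theta i p"
  by (simp add: Theta_def pdiff_mult pdiff_cvar algebra_simps)

lemma Cxz_cvar: "i < n \<Longrightarrow> cvar (Xi i) \<in> Cxz n" "i < n \<Longrightarrow> cvar (Z i) \<in> Cxz n"
  by (auto simp: Cxz_def)

lemma Cz_subset_Cxz: "p \<in> Cz n \<Longrightarrow> p \<in> Cxz n"
  unfolding Cz_def Cxz_def by (rule cpolys_mono) auto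

lemma Im_Theta_add:
  assumes "p \<in> Im_Theta n" "q \<in> Im_Theta n"
  shows "p + q \<in> Im_Theta n"
proof -
  obtain h k where "p = (\<Sum>i<n. Theta i (h i))" "\<forall>i<n. h i \<in> Cxz n"
      "q = (\<Sum>i<n. Theta i (k i))" "\<forall>i<n. k i \<in> Cxz n"
    using assms by (auto simp: Im_Theta_def)
  then show ?thesis unfolding Im_Theta_def
    by (auto simp: Theta_add sum.distrib Cxz_def intro!: exI[of _ "\<lambda>i. h i + k i"])
qed

lemma Im_Theta_uminus:
  assumes "p \<in> Im_Theta n"
  shows "- p \<in> Im_Theta n"
proof -
  obtain h where "p = (\<Sum>i<n. Theta i (h i))" "\<forall>i<n. h i \<in> Cxz n"
    using assms by (auto simp: Im_Theta_def)
  then show ?thesis unfolding Im_Theta_def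
    by (auto simp: Theta_uminus sum_negf Cxz_def intro!: exI[of _ "\<lambda>i. - h i"])
qed

lemma Im_Theta_0: "0 \<in> Im_Theta n"
  unfolding Im_Theta_def by (auto intro!: exI[of _ "\<lambda>i. 0"] simp: Cxz_def)

lemma Im_Theta_sum: "(\<And>x. x \<in> S \<Longrightarrow> f x \<in> Im_Theta n) \<Longrightarrow> sum f S \<in> Im_Theta n"
  by (induction S rule: infinite_finite_induct) (auto intro: Im_Theta_add Im_Theta_0)

lemma Theta_in_Im_Theta:
  assumes "i < n" "p \<in> Cxz n"
  shows "Theta i p \<in> Im_Theta n"
proof -
  have "Theta i p = (\<Sum>j<n. Theta j (if j = i then p else 0))"
    using assms(1) by (simp add: if_distrib[of "Theta _"] cong: if_cong)
  then show ?thesis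
    using assms(2) unfolding Im_Theta_def by (auto simp: Cxz_def intro!: exI[of _ "\<lambda>j. if j = i then p else 0"])
qed

lemma Im_Theta_Xi_mult:
  assumes "p \<in> Im_Theta n" "j < n"
  shows "cvar (Xi j) * p \<in> Im_Theta n"
proof -
  obtain h where h: "p = (\<Sum>i<n. Theta i (h i))" "\<forall>i<n. h i \<in> Cxz n"
    using assms(1) by (auto simp: Im_Theta_def)
  have "cvar (Xi j) * p = (\<Sum>i<n. Theta i (cvar (Xi j) * h i))"
    by (simp add: h(1) sum_distrib_left Theta_Xi_mult)
  then show ?thesis
    using h(2) Cxz_cvar(1)[OF assms(2)] unfolding Im_Theta_def Cxz_def
    by (auto intro!: exI[of _ "\<lambda>i. cvar (Xi j) * h i"])
qed

abbreviation xi_square :: "nat \<Rightarrow> xz cpoly" where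
  "xi_square n \<equiv> \<Sum>i<n. cvar (Xi i) ^ 2"

text \<open>Since \<open>\<xi>\<^sub>i h - \<partial>\<^sub>i h\<close> lies in the image, \<open>\<xi>\<^sub>i\<close> may be traded for \<open>\<partial>\<^sub>i\<close>, twice.\<close>

lemma xi_square_mult_cong_laplacian:
  assumes "p \<in> Cxz n"
  shows "xi_square n * p - laplacian n Z p \<in> Im_Theta n"
proof -
  have "cvar (Xi i) ^ 2 * p - pdiff (Z i) (pdiff (Z i) p) \<in> Im_Theta n" if "i < n" for i
  proof -
    have "cvar (Xi i) ^ 2 * p - pdiff (Z i) (pdiff (Z i) p) =
        Theta i (cvar (Xi i) * p) + Theta i (pdiff (Z i) p)"
      by (simp add: Theta_def pdiff_mult pdiff_cvar power2_eq_square algebra_simps)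
    moreover have "cvar (Xi i) * p \<in> Cxz n" "pdiff (Z i) p \<in> Cxz n"
      using assms Cxz_cvar(1)[OF that] unfolding Cxz_def by auto
    ultimately show ?thesis
      by (metis Im_Theta_add Theta_in_Im_Theta[OF that])
  qed
  then have "(\<Sum>i<n. cvar (Xi i) ^ 2 * p - pdiff (Z i) (pdiff (Z i) p)) \<in> Im_Theta n"
    by (intro Im_Theta_sum) auto
  then show ?thesis by (simp add: laplacian_def sum_subtractf sum_distrib_right)
qed

lemma laplacian_xi_mult: "laplacian n Z (xi_square n ^ k * p) = xi_square n ^ k * laplacian n Z p"
proof -
  have "pdiff (Z i) (xi_square n ^ k) = 0" for i
    by (simp add: pdiff_power pdiff_sum pdiff_cvar)
  then show ?thesis by (simp add: laplacian_def pdiff_mult sum_distrib_left)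
qed

lemma xi_square_power_cong_laplacian:
  assumes "p \<in> Cxz n"
  shows "xi_square n ^ k * p - (laplacian n Z ^^ k) p \<in> Im_Theta n"
  using assms
proof (induction k arbitrary: p)
  case 0
  then show ?case by (simp add: Im_Theta_0)
next
  case (Suc k)
  have 1: "xi_square n ^ k * p \<in> Cxz n"
    using Suc.prems Cxz_cvar(1)[of _ n] unfolding Cxz_def by (intro cpolys_mult cpolys_power cpolys_sum) auto
  have 2: "laplacian n Z p \<in> Cxz n"
    using Suc.prems unfolding Cxz_def by (rule laplacian_cpolys)
  have eq: "xi_square n ^ Suc k * p - (laplacian n Z ^^ Suc k) p =
      (xi_square n * (xi_square n ^ k * p) - laplacian n Z (xi_square n ^ k * p)) +
      (xi_square n ^ k * laplacian n Z p - (laplacian n Z ^^ k) (laplacian n Z p))"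
    by (simp only: laplacian_xi_mult funpow_Suc_right o_apply power_Suc) (simp add: mult.assoc)
  show ?case
    unfolding eq by (rule Im_Theta_add[OF xi_square_mult_cong_laplacian[OF 1] Suc.IH[OF 2]])
qed

text \<open>The functional \<open>\<xi>\<^sup>a z\<^sup>b \<mapsto> a!\<close> if \<open>a = b\<close>, and \<open>0\<close> otherwise, is the constant term of
  \<open>\<partial>\<^sup>a z\<^sup>b\<close>. In this form it visibly turns multiplication by \<open>\<xi>\<^sub>i\<close> into \<open>\<partial>\<^sub>i\<close>, and so it
  vanishes on \<open>Im \<Theta>\<close>.\<close>

definition pair_mono :: "nat \<Rightarrow> (xz \<Rightarrow>\<^sub>0 nat) \<Rightarrow> complex" where
  "pair_mono n m = (\<Prod>i<n. if lkp m (Xi i) = lkp m (Z i) then fact (lkp m (Z i)) else 0)"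

definition pairing :: "nat \<Rightarrow> xz cpoly \<Rightarrow> complex" where
  "pairing n p = (\<Sum>m\<in>Poly_Mapping.keys p. lkp p m * pair_mono n m)"

lemma pairing_add: "pairing n (p + q) = pairing n p + pairing n q"
  unfolding pairing_def
  by (rule sum_keys_add[where g = "\<lambda>m c. c * pair_mono n m"]) (auto simp: distrib_right)

lemma pairing_single: "pairing n (Poly_Mapping.single m c) = c * pair_mono n m"
  by (simp add: pairing_def)

lemma pairing_0 [simp]: "pairing n 0 = 0"
  by (simp add: pairing_def)

lemma pairing_uminus: "pairing n (- p) = - pairing n p"
  using pairing_add[of n p "- p"] by (simp add: eq_neg_iff_add_eq_0 add.commute)

lemma pairing_sum: "pairing n (sum f S) = (\<Sum>x\<in>S. pairing n (f x))"
  by (induction S rule: infinite_finite_induct) (auto simp: pairing_add)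

lemma pairing_Xi_mult:
  assumes "i < n"
  shows "pairing n (cvar (Xi i) * p) = pairing n (pdiff (Z i) p)"
proof (induction p rule: cpoly_induct)
  case (single m c)
  define f where "f k j = (if lkp k (Xi j) = lkp k (Z j) then fact (lkp k (Z j)) else (0::complex))" for k j
  have pm: "pair_mono n k = f k i * (\<Prod>j\<in>{..<n}-{i}. f k j)" for k
    unfolding pair_mono_def f_def using assms by (subst prod.remove[of _ i]) auto
  let ?k1 = "mvar (Xi i) + m" and ?k2 = "m - mvar (Z i)"
  have "(\<Prod>j\<in>{..<n}-{i}. f ?k1 j) = (\<Prod>j\<in>{..<n}-{i}. f m j)"
       "(\<Prod>j\<in>{..<n}-{i}. f ?k2 j) = (\<Prod>j\<in>{..<n}-{i}. f m j)"
    by (intro prod.cong; auto simp: f_def lookup_add lookup_minus lookup_single when_def)+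
  moreover have "f ?k1 i = of_nat (lkp m (Z i)) * f ?k2 i"
    by (cases "lkp m (Z i)")
      (auto simp: f_def lookup_add lookup_minus lookup_single when_def)
  ultimately have "pair_mono n ?k1 = of_nat (lkp m (Z i)) * pair_mono n ?k2"
    by (simp add: pm)
  then show ?case
    by (simp add: cvar_times_single pdiff_single pairing_single)
qed (simp add: pairing_add distrib_left pdiff_add)

lemma pairing_Im_Theta: "p \<in> Im_Theta n \<Longrightarrow> pairing n p = 0"
proof -
  assume "p \<in> Im_Theta n"
  then obtain h where h: "p = (\<Sum>i<n. Theta i (h i))" by (auto simp: Im_Theta_def)
  have "pairing n (Theta i q) = 0" if "i < n" for i q
    using pairing_add[of n "cvar (Xi i) * q" "- pdiff (Z i) q"] pairing_Xi_mult[OF that]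
    by (simp add: Theta_def pairing_uminus)
  then show ?thesis by (simp add: h pairing_sum)
qed

lemma Im_Theta_monomial_Xi_mult:
  assumes "p \<in> Im_Theta n"
  shows "(\<Prod>i<n. cvar (Xi i) ^ a i) * p \<in> Im_Theta n"
proof -
  have pow: "cvar (Xi j) ^ k * q \<in> Im_Theta n" if "j < n" "q \<in> Im_Theta n" for j k q
    using that(2) by (induction k) (auto simp: mult.assoc intro: Im_Theta_Xi_mult that(1))
  have "(\<Prod>i<k. cvar (Xi i) ^ a i) * p \<in> Im_Theta n" if "k \<le> n" for k
    using that
  proof (induction k)
    case (Suc k)
    then have "cvar (Xi k) ^ a k * ((\<Prod>i<k. cvar (Xi i) ^ a i) * p) \<in> Im_Theta n"
      by (intro pow) auto
    then show ?case by (simp add: ac_simps)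
  qed (use assms in simp)
  then show ?thesis by simp
qed

text \<open>\<open>Im \<Theta>\<close> is stable under multiplication by \<open>\<xi>\<^sup>a\<close>, and pairing \<open>\<xi>\<^sup>a p\<close> reads off \<open>a!\<close> times the
  coefficient of \<open>z\<^sup>a\<close> in \<open>p\<close>. So all coefficients vanish.\<close>

lemma Im_Theta_inter_Cz:
  assumes "p \<in> Im_Theta n" "p \<in> Cz n"
  shows "p = 0"
proof (rule poly_mapping_eqI)
  fix m0
  show "lkp p m0 = lkp 0 m0"
  proof (cases "m0 \<in> Poly_Mapping.keys p")
    case True
    define a where "a i = lkp m0 (Z i)" for i
    define xa where "xa = (\<Sum>i<n. Poly_Mapping.single (Xi i) (a i))"
    have xi: "(\<Prod>i<n. cvar (Xi i) ^ a i) = Poly_Mapping.single xa 1"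
    proof -
      have 1: "cvar v ^ k = Poly_Mapping.single (Poly_Mapping.single v k) (1::complex)" for v :: xz and k
        by (induction k) (auto simp: cvar_altdef mult_single single_add[symmetric])
      have "(\<Prod>i<k. cvar (Xi i) ^ a i) = Poly_Mapping.single (\<Sum>i<k. Poly_Mapping.single (Xi i) (a i)) (1::complex)" for k
        by (induction k) (auto simp: 1 mult_single)
      then show ?thesis by (simp add: xa_def)
    qed
    have lxa: "lkp xa (Xi i) = (if i < n then a i else 0)" "lkp xa (Z i) = 0" for i
      by (auto simp: xa_def lookup_sum lookup_single when_def)
    have pz: "Poly_Mapping.keys m \<subseteq> Z ` {..<n}" if "m \<in> Poly_Mapping.keys p" for m
      using assms(2) that by (auto simp: Cz_def cpolys_def)
    have pm: "pair_mono n (xa + m) = (if m = m0 then (\<Prod>i<n. fact (a i)) else 0)"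
      if "m \<in> Poly_Mapping.keys p" for m
    proof -
      have Xi0: "lkp m (Xi i) = 0" "lkp m0 (Xi i) = 0" for i
        using pz[OF that] pz[OF True] by (auto simp: not_in_keys_iff_lookup_eq_zero[symmetric])
      have Zn: "lkp m (Z i) = 0" "lkp m0 (Z i) = 0" if "\<not> i < n" for i
        using pz[OF \<open>m \<in> _\<close>] pz[OF True] that
        by (metis imageE lessThan_iff not_in_keys_iff_lookup_eq_zero subsetD xz.inject(2))+
      have "m = m0 \<longleftrightarrow> (\<forall>i<n. a i = lkp m (Z i))"
      proof
        assume *: "\<forall>i<n. a i = lkp m (Z i)"
        have "lkp m v = lkp m0 v" for v using Xi0 Zn * by (cases v) (auto simp: a_def, metis)
        then show "m = m0" by (rule poly_mapping_eqI)
      qed (simp add: a_def)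
      then show ?thesis
        by (auto simp: pair_mono_def lookup_add lxa Xi0 a_def intro!: prod.cong)
    qed
    have "0 = pairing n ((\<Prod>i<n. cvar (Xi i) ^ a i) * p)"
      using pairing_Im_Theta Im_Theta_monomial_Xi_mult assms(1) by metis
    also have "\<dots> = (\<Sum>m\<in>Poly_Mapping.keys p. pairing n (Poly_Mapping.single (xa + m) (lkp p m)))"
      unfolding xi by (subst single_sum_keys[of p, symmetric])
        (simp add: sum_distrib_left mult_single pairing_sum)
    also have "\<dots> = (\<Sum>m\<in>Poly_Mapping.keys p. if m = m0 then lkp p m * (\<Prod>i<n. fact (a i)) else 0)"
      by (intro sum.cong refl) (auto simp: pairing_single pm)
    also have "\<dots> = lkp p m0 * (\<Prod>i<n. fact (a i))" using True by simp
    finally show ?thesis by simp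
  qed (simp add: in_keys_iff)
qed

lemma xi_square_power_in_Im_Theta_iff:
  assumes "p \<in> Cz n"
  shows "xi_square n ^ k * p \<in> Im_Theta n \<longleftrightarrow> (laplacian n Z ^^ k) p = 0"
proof
  have *: "xi_square n ^ k * p - (laplacian n Z ^^ k) p \<in> Im_Theta n"
    using assms by (intro xi_square_power_cong_laplacian Cz_subset_Cxz)
  show "xi_square n ^ k * p \<in> Im_Theta n" if "(laplacian n Z ^^ k) p = 0" using * that by simp
  assume "xi_square n ^ k * p \<in> Im_Theta n"
  then have "(laplacian n Z ^^ k) p \<in> Im_Theta n"
    using Im_Theta_add[OF _ Im_Theta_uminus[OF *], of "xi_square n ^ k * p"] by simp
  moreover have "(laplacian n Z ^^ k) p \<in> Cz n"
    using assms unfolding Cz_def by (rule laplacian_pow_cpolys)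
  ultimately show "(laplacian n Z ^^ k) p = 0" by (rule Im_Theta_inter_Cz)
qed

text \<open>The Jacobian conjecture speaks of variables indexed by numbers and the image conjecture of
  the variables \<open>Z i\<close>; everything after this point is carried out in the former.\<close>

abbreviation to_Z :: "nat cpoly \<Rightarrow> xz cpoly" where
  "to_Z \<equiv> csubst (\<lambda>i. cvar (Z i))"

definition of_Z :: "xz cpoly \<Rightarrow> nat cpoly" where
  "of_Z = csubst (\<lambda>v. case v of Z i \<Rightarrow> cvar i | Xi i \<Rightarrow> 0)"

lemma of_Z_to_Z: "of_Z (to_Z p) = p"
  by (simp add: of_Z_def csubst_csubst csubst_cvar_id)

lemma to_Z_of_Z:
  assumes "P \<in> Cz n"
  shows "to_Z (of_Z P) = P"
proof -
  have "to_Z (of_Z P) = csubst cvar P"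
    unfolding of_Z_def csubst_csubst using assms
    by (intro csubst_cong) (auto simp: Cz_def)
  then show ?thesis by (simp add: csubst_cvar_id)
qed

lemma laplacian_to_Z:
  assumes "p \<in> cpolys {..<n}"
  shows "laplacian n Z (to_Z p) = to_Z (laplacian n (\<lambda>i. i) p)"
proof -
  have 1: "pdiff (Z i) (to_Z q) = to_Z (pdiff i q)" if "q \<in> cpolys {..<n}" "i < n" for i q
    using pdiff_csubst[OF _ that(1), of "Z i" "\<lambda>i. cvar (Z i)"] that(2)
    by (simp add: pdiff_cvar if_distrib cong: if_cong)
  show ?thesis unfolding laplacian_def csubst_sum
    by (intro sum.cong refl) (use assms in \<open>auto simp: 1 cpolys_pdiff\<close>)
qed

lemma laplacian_pow_to_Z:
  assumes "p \<in> cpolys {..<n}"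
  shows "(laplacian n Z ^^ k) (to_Z p) = to_Z ((laplacian n (\<lambda>i. i) ^^ k) p)"
  by (induction k) (use assms in \<open>auto simp: laplacian_to_Z laplacian_pow_cpolys\<close>)

text \<open>Zhao's vanishing conjecture asserts this for all forms of degree four.\<close>

definition vanishing_property :: "nat \<Rightarrow> nat cpoly \<Rightarrow> bool" where
  "vanishing_property n p \<longleftrightarrow> ((\<forall>m\<ge>1. (laplacian n (\<lambda>i. i) ^^ m) (p ^ m) = 0) \<longrightarrow>
     (\<exists>N. \<forall>m\<ge>N. (laplacian n (\<lambda>i. i) ^^ m) (p ^ Suc m) = 0))"

lemma image_conjecture_iff_vanishing:
  assumes "p \<in> cpolys {..<n}"
  shows "image_conjecture_for n (xi_square n * to_Z p) (to_Z p) \<longleftrightarrow> vanishing_property n p"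
proof -
  have pz: "to_Z p ^ j \<in> Cz n" for j
    using assms unfolding Cz_def by (intro cpolys_power cpolys_csubst) auto
  have 1: "xi_square n ^ k * to_Z p ^ j \<in> Im_Theta n \<longleftrightarrow> (laplacian n (\<lambda>i. i) ^^ k) (p ^ j) = 0" for k j
  proof -
    have "(laplacian n Z ^^ k) (to_Z (p ^ j)) = to_Z ((laplacian n (\<lambda>i. i) ^^ k) (p ^ j))"
      using assms by (intro laplacian_pow_to_Z) auto
    then have "xi_square n ^ k * to_Z p ^ j \<in> Im_Theta n \<longleftrightarrow> to_Z ((laplacian n (\<lambda>i. i) ^^ k) (p ^ j)) = 0"
      by (simp add: xi_square_power_in_Im_Theta_iff[OF pz] csubst_power)
    also have "\<dots> \<longleftrightarrow> (laplacian n (\<lambda>i. i) ^^ k) (p ^ j) = 0"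
      using of_Z_to_Z by (metis csubst_0)
    finally show ?thesis .
  qed
  have 2: "(xi_square n * to_Z p) ^ m = xi_square n ^ m * to_Z p ^ m"
    "xi_square n ^ m * to_Z p ^ m * to_Z p = xi_square n ^ m * to_Z p ^ Suc m" for m
    by (simp_all add: power_mult_distrib ac_simps)
  show ?thesis unfolding image_conjecture_for_def vanishing_property_def 2(1) unfolding 2(2) 1 ..
qed

section \<open>Power series with coefficientwise operators\<close>

text \<open>A power series over the polynomial ring is a family depending on a parameter \<open>t\<close>. Operators in
  the variables act on its coefficients and commute with the derivative in \<open>t\<close>.\<close>

definition coeffwise :: "('a \<Rightarrow> 'b) \<Rightarrow> 'a::zero fps \<Rightarrow> 'b::zero fps" where
  "coeffwise f F = Abs_fps (\<lambda>k. f (fps_nth F k))"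

lemma coeffwise_nth [simp]: "fps_nth (coeffwise f F) k = f (fps_nth F k)"
  by (simp add: coeffwise_def)

lemma derivation_coeffwise:
  assumes "derivation d"
  shows "derivation (coeffwise d)"
  unfolding derivation_def
proof (intro conjI allI)
  fix F G
  show "coeffwise d (F + G) = coeffwise d F + coeffwise d G"
    by (rule fps_ext) (simp add: derivation_add[OF assms])
  show "coeffwise d (F * G) = coeffwise d F * G + F * coeffwise d G"
    by (rule fps_ext) (simp add: fps_mult_nth derivation_sum[OF assms] derivation_mult[OF assms] sum.distrib)
qed

lemma derivation_of_nat_mult:
  assumes "derivation d"
  shows "d (of_nat k * x) = of_nat k * d x"
proof -
  have "d (of_nat k) = 0" by (induction k) (auto simp: derivation_0 derivation_1 derivation_add assms)
  then show ?thesis by (simp add: derivation_mult[OF assms])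
qed

lemma derivation_fps_deriv: "derivation fps_deriv"
  by (auto simp: derivation_def algebra_simps)

lemma fps_deriv_coeffwise:
  assumes "derivation d"
  shows "fps_deriv (coeffwise d F) = coeffwise d (fps_deriv F)"
  by (rule fps_ext) (simp add: derivation_of_nat_mult[OF assms, symmetric] del: of_nat_Suc of_nat_add)

text \<open>Over polynomials with complex coefficients positive integers can be cancelled; the proofs below
  divide by them in this form.\<close>

lemma of_nat_mult_fps_eq_0:
  fixes F :: "'v cpoly fps"
  assumes "of_nat k * F = 0" "k \<noteq> 0"
  shows "F = 0"
proof (rule fps_ext)
  fix j
  have "of_nat k * fps_nth F j = fps_nth (of_nat k * F) j"
    by (simp add: fps_of_nat[symmetric] del: fps_of_nat)
  then show "fps_nth F j = fps_nth 0 j" using assms of_nat_mult_cpoly_eq_0 by fastforce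
qed

lemma fps_const_sum: "fps_const (sum f S) = (\<Sum>i\<in>S. fps_const (f i))" for f :: "_ \<Rightarrow> 'a::comm_ring_1"
  by (induction S rule: infinite_finite_induct) (auto simp: fps_const_add[symmetric] simp del: fps_const_add)

lemma fps_power_nth_0: "fps_nth (F ^ k) 0 = fps_nth F 0 ^ k"
  by (induction k) auto

section \<open>The Hamilton-Jacobi equation\<close>

text \<open>The formal solution of \<open>2 \<partial>\<^sub>t Q = \<parallel>\<nabla>Q\<parallel>\<^sup>2\<close> is the potential of the formal inverse of
  \<open>id - t \<nabla>P\<close>, where \<open>P\<close> is the constant coefficient.\<close>

locale hamilton_jacobi =
  fixes n :: nat and z :: "nat \<Rightarrow> 'v" and Q :: "'v cpoly fps"
  assumes hj: "2 * fps_deriv Q = (\<Sum>i<n. coeffwise (pdiff (z i)) Q ^ 2)"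
begin

abbreviation "D i \<equiv> coeffwise (pdiff (z i))"
abbreviation "P \<equiv> fps_nth Q 0"
abbreviation "lap \<equiv> laplacian n z"

lemma derivation_D: "derivation (D i)"
  by (intro derivation_coeffwise derivation_pdiff)

lemma coeffwise_laplacian: "coeffwise lap F = (\<Sum>i<n. D i (D i F))"
  by (rule fps_ext) (simp add: laplacian_def fps_sum_nth)

text \<open>The product rule for \<open>\<Delta>\<close> produces \<open>\<Delta>Q\<close> and \<open>\<parallel>\<nabla>Q\<parallel>\<^sup>2\<close>; the equation turns the latter into a
  derivative in \<open>t\<close>.\<close>

lemma laplacian_power:
  "coeffwise lap (Q ^ Suc m) =
     of_nat (Suc m) * (Q ^ m * coeffwise lap Q) + of_nat (2 * Suc m) * fps_deriv (Q ^ m)"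
proof -
  have D2: "D i (D i (Q ^ Suc m)) = of_nat (Suc m) * (Q ^ m * D i (D i Q)) +
      of_nat (Suc m) * of_nat m * Q ^ (m - 1) * D i Q ^ 2" for i
  proof -
    have "D i (D i (Q ^ Suc m)) = of_nat (Suc m) * D i (Q ^ m * D i Q)"
      by (simp only: derivation_power[OF derivation_D] derivation_of_nat_mult[OF derivation_D] mult.assoc diff_Suc_1)
    also have "\<dots> = of_nat (Suc m) * (Q ^ m * D i (D i Q)) +
        of_nat (Suc m) * of_nat m * Q ^ (m - 1) * D i Q ^ 2"
      by (simp only: derivation_mult[OF derivation_D] derivation_power[OF derivation_D] power2_eq_square distrib_left ac_simps)
    finally show ?thesis .
  qed
  have "of_nat (Suc m) * of_nat m * Q ^ (m - 1) * (\<Sum>i<n. D i Q ^ 2) = of_nat (2 * Suc m) * fps_deriv (Q ^ m)"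
    unfolding hj[symmetric] by (simp only: derivation_power[OF derivation_fps_deriv] of_nat_mult of_nat_numeral ac_simps)
  then show ?thesis
    unfolding coeffwise_laplacian D2 by (simp only: sum.distrib sum_distrib_left)
qed

text \<open>The case \<open>m = 1\<close> gives the constants \<open>1 / (2\<^sup>k k! (k + 1)!)\<close> of Zhao's formula for the
  potential of the inverse map.\<close>

definition hj_coeff :: "nat \<Rightarrow> nat \<Rightarrow> complex" where
  "hj_coeff m j = fact m / (2 ^ j * fact j * fact (m + j))"

lemma hj_coeff_nonzero: "hj_coeff m j \<noteq> 0"
  by (simp add: hj_coeff_def)

text \<open>While \<open>\<Delta>Q\<close> vanishes, \<open>laplacian_power\<close> says \<open>\<Delta> Q\<^sup>m\<^sup>+\<^sup>1 = 2 (m + 1) \<partial>\<^sub>t Q\<^sup>m\<close>. Reading it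
  repeatedly lowers the index of the coefficient and raises the power, until only \<open>P\<close> is left. The
  bound \<open>k\<close> makes the formula available in an induction that proves \<open>\<Delta>Q = 0\<close>.\<close>

lemma power_coeff:
  assumes "\<And>j. j < k \<Longrightarrow> lap (fps_nth Q j) = 0"
  shows "j \<le> k \<Longrightarrow> fps_nth (Q ^ m) j = cconst (hj_coeff m j) * (lap ^^ j) (P ^ (m + j))"
proof (induction j arbitrary: m)
  case 0
  then show ?case by (simp add: fps_power_nth_0 hj_coeff_def)
next
  case (Suc j)
  let ?c = "of_nat (2 * Suc m * Suc j) :: complex"
  have 0: "fps_nth (Q ^ m * coeffwise lap Q) j = 0"
    unfolding fps_mult_nth using Suc.prems by (intro sum.neutral) (auto simp: assms)
  have "lap (fps_nth (Q ^ Suc m) j) = fps_nth (of_nat (Suc m) * (Q ^ m * coeffwise lap Q) + of_nat (2 * Suc m) * fps_deriv (Q ^ m)) j"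
    by (simp only: laplacian_power[symmetric] coeffwise_nth)
  also have "\<dots> = of_nat (Suc m) * fps_nth (Q ^ m * coeffwise lap Q) j +
      of_nat (2 * Suc m) * fps_nth (fps_deriv (Q ^ m)) j"
    by (simp only: fps_of_nat[symmetric] fps_add_nth fps_mult_left_const_nth)
  also have "\<dots> = cconst ?c * fps_nth (Q ^ m) (Suc j)"
  proof -
    have cc: "cconst ?c = of_nat (2 * Suc m) * of_nat (Suc j)"
      by (simp only: cconst_of_nat) (simp only: of_nat_mult)
    show ?thesis
      unfolding cc 0 mult_zero_right add_0_left fps_deriv_nth Suc_eq_plus1[symmetric]
      by (rule mult.assoc[symmetric])
  qed
  finally have 1: "cconst ?c * fps_nth (Q ^ m) (Suc j) = lap (fps_nth (Q ^ Suc m) j)" by simp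
  have "fps_nth (Q ^ m) (Suc j) = cconst (inverse ?c * ?c) * fps_nth (Q ^ m) (Suc j)"
    by (simp del: of_nat_mult of_nat_Suc)
  also have "\<dots> = cconst (inverse ?c) * lap (fps_nth (Q ^ Suc m) j)"
    unfolding cconst_mult mult.assoc[of "cconst (inverse ?c)"] 1 ..
  also have "\<dots> = cconst (inverse ?c * hj_coeff (Suc m) j) * (lap ^^ Suc j) (P ^ (m + Suc j))"
    using Suc by (simp only: Suc.IH laplacian_cconst_mult cconst_mult mult.assoc) simp
  also have "inverse ?c * hj_coeff (Suc m) j = hj_coeff m (Suc j)"
  proof -
    define a b :: complex where "a = of_nat (Suc m)" and "b = of_nat (Suc j)"
    have nz: "a \<noteq> 0" "b \<noteq> 0" by (auto simp: a_def b_def simp del: of_nat_Suc)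
    have "?c = 2 * a * b" by (simp only: a_def b_def of_nat_mult of_nat_numeral)
    moreover have "fact (Suc m) = a * fact m" "fact (Suc j) = b * fact j"
      by (simp_all only: a_def b_def fact_Suc)
    moreover have "Suc m + j = m + Suc j" by simp
    ultimately show ?thesis
      unfolding hj_coeff_def power_Suc using nz by (simp add: field_simps del: fact_Suc of_nat_Suc)
  qed
  finally show ?case .
qed

text \<open>If the coefficients of \<open>\<Delta>Q\<close> below \<open>k\<close> vanish, the \<open>k\<close>-th is a nonzero multiple of
  \<open>\<Delta>\<^sup>k\<^sup>+\<^sup>1 P\<^sup>k\<^sup>+\<^sup>1\<close>. Both directions follow, one of them by induction on \<open>k\<close>.\<close>

lemma laplacian_0_iff:
  "(\<forall>k. lap (fps_nth Q k) = 0) \<longleftrightarrow> (\<forall>m\<ge>1. (lap ^^ m) (P ^ m) = 0)"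
proof
  have step: "lap (fps_nth Q k) = cconst (hj_coeff 1 k) * (lap ^^ Suc k) (P ^ Suc k)"
    if "\<And>j. j < k \<Longrightarrow> lap (fps_nth Q j) = 0" for k
    using power_coeff[OF that, of k k 1] by (simp add: laplacian_cconst_mult)
  show "\<forall>k. lap (fps_nth Q k) = 0" if *: "\<forall>m\<ge>1. (lap ^^ m) (P ^ m) = 0"
  proof
    fix k
    show "lap (fps_nth Q k) = 0"
    proof (induction k rule: less_induct)
      case (less k)
      have "(lap ^^ Suc k) (P ^ Suc k) = 0" by (rule *[rule_format]) simp
      then have "cconst (hj_coeff 1 k) * (lap ^^ Suc k) (P ^ Suc k) = 0" by (simp only: mult_zero_right)
      with step[OF less] show ?case by (rule trans)
    qed
  qed
  assume *: "\<forall>k. lap (fps_nth Q k) = 0"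
  show "\<forall>m\<ge>1. (lap ^^ m) (P ^ m) = 0"
  proof (intro allI impI)
    fix m :: nat assume "m \<ge> 1"
    then obtain k where m: "m = Suc k" by (cases m) auto
    have "0 = cconst (inverse (hj_coeff 1 k)) * (cconst (hj_coeff 1 k) * (lap ^^ Suc k) (P ^ Suc k))"
      using step[of k] * by simp
    also have "\<dots> = cconst (inverse (hj_coeff 1 k) * hj_coeff 1 k) * (lap ^^ Suc k) (P ^ Suc k)"
      by (simp only: cconst_mult mult.assoc)
    also have "\<dots> = (lap ^^ m) (P ^ m)"
      unfolding m left_inverse[OF hj_coeff_nonzero] by (simp only: cconst_1 mult_1_left)
    finally show "(lap ^^ m) (P ^ m) = 0" by simp
  qed
qed

lemma coeff_eq_0_iff:
  assumes "\<And>k. lap (fps_nth Q k) = 0"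
  shows "fps_nth Q k = 0 \<longleftrightarrow> (lap ^^ k) (P ^ Suc k) = 0"
proof -
  have 1: "fps_nth Q k = cconst (hj_coeff 1 k) * (lap ^^ k) (P ^ Suc k)"
    using power_coeff[of k k 1] assms by simp
  have "cconst (inverse (hj_coeff 1 k)) * fps_nth Q k =
      cconst (inverse (hj_coeff 1 k) * hj_coeff 1 k) * (lap ^^ k) (P ^ Suc k)"
    by (simp only: 1 cconst_mult mult.assoc)
  also have "\<dots> = (lap ^^ k) (P ^ Suc k)"
    unfolding left_inverse[OF hj_coeff_nonzero] by (simp only: cconst_1 mult_1_left)
  finally show ?thesis using 1 by (metis mult_zero_right)
qed

end

section \<open>Traces and derivations of matrices\<close>

definition mat_trace :: "'a::comm_monoid_add mat \<Rightarrow> 'a" where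
  "mat_trace A = (\<Sum>i<dim_row A. A $$ (i, i))"

lemma mat_trace_mult:
  assumes "A \<in> carrier_mat n n" "B \<in> carrier_mat n n"
  shows "mat_trace (A * B) = (\<Sum>i<n. \<Sum>j<n. A $$ (i, j) * B $$ (j, i))"
  using assms by (auto simp: mat_trace_def scalar_prod_def atLeast0LessThan intro!: sum.cong)

lemma mat_trace_add:
  "A \<in> carrier_mat n n \<Longrightarrow> B \<in> carrier_mat n n \<Longrightarrow> mat_trace (A + B) = mat_trace A + mat_trace B"
  by (simp add: mat_trace_def sum.distrib)

lemma mat_trace_smult:
  "A \<in> carrier_mat n n \<Longrightarrow> mat_trace (c \<cdot>\<^sub>m A) = c * (mat_trace A :: 'a::comm_semiring_1)"
  by (simp add: mat_trace_def sum_distrib_left)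

lemma mat_trace_comm:
  fixes A :: "'a::comm_semiring_0 mat"
  assumes "A \<in> carrier_mat n n" "B \<in> carrier_mat n n"
  shows "mat_trace (A * B) = mat_trace (B * A)"
  unfolding mat_trace_mult[OF assms] mat_trace_mult[OF assms(2,1)]
  by (subst sum.swap) (simp add: mult.commute)

lemma map_mat_derivation_mult:
  assumes d: "derivation d" and A: "A \<in> carrier_mat n n" and B: "B \<in> carrier_mat n n"
  shows "map_mat d (A * B) = map_mat d A * B + A * map_mat d B"
  using A B
  by (intro eq_matI) (auto simp: scalar_prod_def derivation_sum[OF d] derivation_mult[OF d] sum.distrib)

text \<open>Only powers of \<open>A\<close> occur, and they commute; so the rule is the same as for a scalar solution of
  \<open>x' = x\<^sup>2\<close>.\<close>

lemma map_mat_derivation_pow: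
  assumes d: "derivation d" and A: "A \<in> carrier_mat n n" and dA: "map_mat d A = A * A"
  shows "map_mat d (A ^\<^sub>m k) = of_nat k \<cdot>\<^sub>m (A ^\<^sub>m Suc k)"
proof (induction k)
  case 0
  have "map_mat d (1\<^sub>m n) = 0\<^sub>m n n"
    by (rule eq_matI) (simp_all add: derivation_0[OF d] derivation_1[OF d])
  moreover have "A ^\<^sub>m 0 = 1\<^sub>m n"
    using A by simp
  moreover have "of_nat 0 \<cdot>\<^sub>m (A ^\<^sub>m Suc 0) = 0\<^sub>m n n"
  proof -
    have "A ^\<^sub>m Suc 0 \<in> carrier_mat n n" by (rule pow_carrier_mat[OF A])
    moreover have "0 \<cdot>\<^sub>m X = 0\<^sub>m n n" if "X \<in> carrier_mat n n" for X :: "'a mat"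
      using that by (intro eq_matI) auto
    ultimately show ?thesis unfolding of_nat_0 by blast
  qed
  ultimately show ?case by (simp only:)
next
  case (Suc k)
  have P: "A ^\<^sub>m k \<in> carrier_mat n n" "A ^\<^sub>m k * A \<in> carrier_mat n n"
    using pow_carrier_mat[OF A, of k] A by auto
  have "map_mat d (A ^\<^sub>m Suc k) = (of_nat k \<cdot>\<^sub>m (A ^\<^sub>m k * A)) * A + A ^\<^sub>m k * (A * A)"
    using map_mat_derivation_mult[OF d P(1) A] unfolding pow_mat.simps(2) Suc dA .
  also have "\<dots> = of_nat k \<cdot>\<^sub>m (A ^\<^sub>m k * A * A) + A ^\<^sub>m k * A * A"
    unfolding assoc_mult_mat[OF P(1) A A, symmetric] mult_smult_assoc_mat[OF P(2) A] ..
  also have "\<dots> = of_nat (Suc k) \<cdot>\<^sub>m (A ^\<^sub>m k * A * A)"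
  proof -
    have "of_nat k \<cdot>\<^sub>m X + X = of_nat (Suc k) \<cdot>\<^sub>m X" for X :: "'a mat"
      by (intro eq_matI) (auto simp: distrib_right add.commute)
    then show ?thesis .
  qed
  finally show ?case unfolding pow_mat.simps(2) .
qed

section \<open>The Burgers equation\<close>

text \<open>The vector field is transported by itself. The operator \<open>\<delta> = \<partial>\<^sub>t - V \<sqdot> \<nabla>\<close> below is the
  derivative along its flow.\<close>

locale burgers =
  fixes n :: nat and z :: "nat \<Rightarrow> 'v" and V :: "nat \<Rightarrow> 'v cpoly fps"
  assumes burgers: "i < n \<Longrightarrow> fps_deriv (V i) = (\<Sum>j<n. V j * coeffwise (pdiff (z j)) (V i))"
begin

abbreviation "D i \<equiv> coeffwise (pdiff (z i))"
definition "M = mat n n (\<lambda>(i, j). D j (V i))"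
definition "\<delta> F = fps_deriv F - (\<Sum>j<n. V j * D j F)"
definition "T k = mat_trace (M ^\<^sub>m k)"

lemma derivation_D: "derivation (D i)"
  by (intro derivation_coeffwise derivation_pdiff)

lemma derivation_delta: "derivation \<delta>"
  unfolding derivation_def \<delta>_def
  by (simp add: derivation_add[OF derivation_D] derivation_mult[OF derivation_D] sum.distrib
      algebra_simps sum_distrib_left sum_distrib_right)

lemma M_carrier: "M \<in> carrier_mat n n"
  by (simp add: M_def)

text \<open>Differentiating the equation in \<open>z\<^sub>j\<close> gives a transport term, which \<open>\<delta>\<close> absorbs, and the matrix
  square.\<close>

lemma delta_M: "map_mat \<delta> M = M * M"
proof (rule eq_matI)
  fix i j assume "i < dim_row (M * M)" "j < dim_col (M * M)"
  then have ij: "i < n" "j < n" by (auto simp: M_def)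
  have comm: "D j (D k F) = D k (D j F)" for k F
    by (rule fps_ext) (simp add: pdiff_commute)
  have "fps_deriv (D j (V i)) = D j (fps_deriv (V i))"
    by (rule fps_deriv_coeffwise[OF derivation_pdiff])
  also have "\<dots> = (\<Sum>k<n. D j (V k) * D k (V i)) + (\<Sum>k<n. V k * D j (D k (V i)))"
    by (simp add: burgers[OF ij(1)] derivation_sum[OF derivation_D] derivation_mult[OF derivation_D] sum.distrib)
  finally have "\<delta> (D j (V i)) = (\<Sum>k<n. D k (V i) * D j (V k))"
    by (simp add: \<delta>_def mult.commute comm)
  then show "map_mat \<delta> M $$ (i, j) = (M * M) $$ (i, j)"
    using ij by (simp add: M_def scalar_prod_def atLeast0LessThan)
qed (auto simp: M_def)

lemma delta_T: "\<delta> (T k) = of_nat k * T (Suc k)"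
proof -
  have "\<delta> (T k) = mat_trace (map_mat \<delta> (M ^\<^sub>m k))"
    by (simp add: T_def mat_trace_def derivation_sum[OF derivation_delta] M_def)
  also have "\<dots> = of_nat k * T (Suc k)"
    unfolding map_mat_derivation_pow[OF derivation_delta M_carrier delta_M] T_def mat_trace_def
    by (simp add: sum_distrib_left M_def)
  finally show ?thesis .
qed

lemma T_nth_0: "fps_nth (T k) 0 = mat_trace (mat n n (\<lambda>(i, j). pdiff (z j) (fps_nth (V i) 0)) ^\<^sub>m k)"
proof -
  interpret h: comm_ring_hom "\<lambda>F::'v cpoly fps. fps_nth F 0"
    by unfold_locales auto
  have "mat_trace (map_mat (\<lambda>F. fps_nth F 0) (M ^\<^sub>m k)) = fps_nth (T k) 0"
    by (simp add: T_def mat_trace_def fps_sum_nth M_def)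
  moreover have "map_mat (\<lambda>F. fps_nth F 0) (M ^\<^sub>m k) = map_mat (\<lambda>F. fps_nth F 0) M ^\<^sub>m k"
    by (rule h.mat_hom_pow[OF M_carrier])
  moreover have "map_mat (\<lambda>F. fps_nth F 0) M = mat n n (\<lambda>(i, j). pdiff (z j) (fps_nth (V i) 0))"
    by (intro eq_matI) (auto simp: M_def)
  ultimately show ?thesis by simp
qed

text \<open>Write \<open>T k\<close> for the trace of \<open>M\<^sup>k\<close>; then \<open>\<delta> (T k) = k T (k + 1)\<close>. If \<open>T 1\<close> vanishes, so do all
  \<open>T k\<close> one after the other. If all \<open>T k\<close> vanish at \<open>t = 0\<close>, the relation determines the
  coefficients of all \<open>T k\<close> simultaneously from lower ones, and these are zero.\<close>

lemma divergence_0_iff_traces_0: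
  "(\<forall>k. (\<Sum>i<n. pdiff (z i) (fps_nth (V i) k)) = 0) \<longleftrightarrow>
   (\<forall>m\<ge>1. mat_trace (mat n n (\<lambda>(i, j). pdiff (z j) (fps_nth (V i) 0)) ^\<^sub>m m) = 0)"
proof -
  have T1: "fps_nth (T 1) k = (\<Sum>i<n. pdiff (z i) (fps_nth (V i) k))" for k
    by (simp add: T_def M_def mat_trace_def fps_sum_nth)
  have a: "T m = 0" if "m \<ge> 1" "T 1 = 0" for m
    using that(1)
  proof (induction m rule: dec_induct)
    case (step m)
    have "of_nat m * T (Suc m) = 0"
      using delta_T[of m] step derivation_0[OF derivation_delta] by simp
    then show ?case by (rule of_nat_mult_fps_eq_0) (use step in auto)
  qed (use that in simp)
  have b: "T 1 = 0" if *: "\<forall>m\<ge>1. fps_nth (T m) 0 = 0"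
  proof -
    have "\<forall>m\<ge>1. fps_nth (T m) k = 0" for k
    proof (induction k rule: less_induct)
      case (less k)
      show ?case
      proof (cases k)
        case (Suc l)
        show ?thesis
        proof (intro allI impI)
          fix m :: nat assume m: "m \<ge> 1"
          have "fps_deriv (T m) = (\<Sum>j<n. V j * D j (T m)) + of_nat m * T (Suc m)"
            using delta_T[of m] by (simp add: \<delta>_def algebra_simps)
          then have "fps_nth (fps_deriv (T m)) l =
              (\<Sum>j<n. fps_nth (V j * D j (T m)) l) + of_nat m * fps_nth (T (Suc m)) l"
            by (simp add: fps_sum_nth fps_of_nat[symmetric] del: fps_of_nat)
          moreover have "fps_nth (V j * D j (T m)) l = 0" for j
            unfolding fps_mult_nth by (intro sum.neutral) (use less m Suc in auto)
          moreover have "fps_nth (T (Suc m)) l = 0" using less Suc by auto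
          ultimately have "of_nat (Suc l) * fps_nth (T m) k = 0" by (simp add: Suc)
          then show "fps_nth (T m) k = 0" by (rule of_nat_mult_cpoly_eq_0) simp
        qed
      qed (use * in simp)
    qed
    then show ?thesis by (intro fps_ext) auto
  qed
  have "(\<forall>k. fps_nth (T 1) k = 0) \<longleftrightarrow> T 1 = 0"
    unfolding fps_eq_iff by (simp only: fps_zero_nth)
  also have "T 1 = 0 \<longleftrightarrow> (\<forall>m\<ge>1. fps_nth (T m) 0 = 0)"
    using a b fps_zero_nth by metis
  finally show ?thesis
    unfolding T_nth_0 T1 .
qed

end

section \<open>Jacobi's formula\<close>

lemma derivation_prod:
  assumes "derivation d" "finite S"
  shows "d (prod f S) = (\<Sum>i\<in>S. d (f i) * prod f (S - {i}))"
  using assms(2)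
proof induction
  case (insert x S)
  have "(\<Sum>i\<in>S. d (f i) * prod f (insert x S - {i})) = (\<Sum>i\<in>S. f x * (d (f i) * prod f (S - {i})))"
  proof (intro sum.cong refl)
    fix i assume "i \<in> S"
    then have "insert x S - {i} = insert x (S - {i})" "x \<notin> S - {i}" using insert by auto
    then show "d (f i) * prod f (insert x S - {i}) = f x * (d (f i) * prod f (S - {i}))"
      using insert by (simp add: ac_simps)
  qed
  then show ?case
    using insert by (simp add: derivation_mult[OF assms(1)] sum_distrib_left)
qed (simp add: derivation_1[OF assms(1)])

text \<open>Differentiating the Leibniz formula row by row gives determinants in which one row has been
  differentiated; these are expanded along that row.\<close>

lemma jacobi_formula:
  fixes A :: "'a::comm_ring_1 mat"
  assumes d: "derivation d" and A: "A \<in> carrier_mat n n"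
  shows "d (det A) = mat_trace (map_mat d A * adj_mat A)"
proof -
  define B where "B i = mat n n (\<lambda>(k, j). if k = i then d (A $$ (k, j)) else A $$ (k, j))" for i
  have B: "B i \<in> carrier_mat n n" for i by (simp add: B_def)
  have sg: "d (signof p * x) = signof p * d x" for p :: "nat \<Rightarrow> nat" and x
    using derivation_uminus[OF d] by (cases "sign p = 1") (auto simp: sign_def)
  have "d (det A) = (\<Sum>p | p permutes {0..<n}. signof p * (\<Sum>i<n. d (A $$ (i, p i)) * (\<Prod>j\<in>{0..<n}-{i}. A $$ (j, p j))))"
    unfolding det_def'[OF A] derivation_sum[OF d] sg derivation_prod[OF d finite_atLeastLessThan]
    by (simp add: atLeast0LessThan)
  also have "\<dots> = (\<Sum>i<n. \<Sum>p | p permutes {0..<n}. signof p * (d (A $$ (i, p i)) * (\<Prod>j\<in>{0..<n}-{i}. A $$ (j, p j))))"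
    unfolding sum_distrib_left by (rule sum.swap)
  also have "\<dots> = (\<Sum>i<n. det (B i))"
  proof (intro sum.cong refl)
    fix i assume i: "i \<in> {..<n}"
    show "(\<Sum>p | p permutes {0..<n}. signof p * (d (A $$ (i, p i)) * (\<Prod>j\<in>{0..<n}-{i}. A $$ (j, p j)))) = det (B i)"
      unfolding det_def'[OF B]
    proof (intro sum.cong refl arg_cong2[where f = "(*)"])
      fix p assume "p \<in> {p. p permutes {0..<n}}"
      then have p: "p j < n" if "j < n" for j using that permutes_in_image[of p "{0..<n}" j] by auto
      have "(\<Prod>j\<in>{0..<n}-{i}. B i $$ (j, p j)) = (\<Prod>j\<in>{0..<n}-{i}. A $$ (j, p j))"
        by (intro prod.cong) (auto simp: B_def p)
      then show "d (A $$ (i, p i)) * (\<Prod>j\<in>{0..<n}-{i}. A $$ (j, p j)) = (\<Prod>j = 0..<n. B i $$ (j, p j))"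
        using i p by (subst prod.remove[of _ i]) (auto simp: B_def)
    qed
  qed
  also have "\<dots> = (\<Sum>i<n. \<Sum>j<n. d (A $$ (i, j)) * cofactor A i j)"
  proof (intro sum.cong refl)
    fix i assume i: "i \<in> {..<n}"
    have "mat_delete (B i) i j = mat_delete A i j" for j
      unfolding mat_delete_def using A by (intro eq_matI) (auto simp: B_def)
    then have "cofactor (B i) i j = cofactor A i j" for j by (simp add: cofactor_def)
    then show "det (B i) = (\<Sum>j<n. d (A $$ (i, j)) * cofactor A i j)"
      using i laplace_expansion_row[OF B, of i i] by (auto simp: B_def intro!: sum.cong)
  qed
  also have "\<dots> = mat_trace (map_mat d A * adj_mat A)"
    using A adj_mat(1)[OF A] by (subst mat_trace_mult[of _ n]) (auto simp: adj_mat_def)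
  finally show ?thesis .
qed

section \<open>Unipotent Jacobians and vanishing traces\<close>

lemma fps_X_power_mult_eq_0: "fps_X ^ k * F = 0 \<Longrightarrow> F = (0 :: 'a::comm_ring_1 fps)"
  by (metis add_diff_cancel_left' fps_X_power_mult_nth fps_eq_iff fps_zero_nth not_add_less1)

lemma map_mat_fps_const_pow:
  "A \<in> carrier_mat n n \<Longrightarrow> map_mat fps_const (A ^\<^sub>m k) = map_mat fps_const (A :: 'a::comm_ring_1 mat) ^\<^sub>m k"
proof -
  interpret h: comm_ring_hom "fps_const :: 'a \<Rightarrow> 'a fps"
    by unfold_locales auto
  show "A \<in> carrier_mat n n \<Longrightarrow> map_mat fps_const (A ^\<^sub>m k) = map_mat fps_const (A :: 'a::comm_ring_1 mat) ^\<^sub>m k"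
    by (rule h.mat_hom_pow)
qed

text \<open>Let \<open>A = 1 - t\<^sup>e H\<close> with adjugate \<open>X\<close>. By Jacobi's formula the derivative of \<open>det A\<close> is
  \<open>- e t\<^sup>e\<^sup>-\<^sup>1 tr (X H)\<close>, and \<open>X A = det A\<close> expands \<open>tr (X H)\<close> into the traces of the powers of
  \<open>H\<close>: with \<open>S k = tr (X H\<^sup>k)\<close> one has \<open>S k = det A \<sqdot> tr H\<^sup>k + t\<^sup>e S (k + 1)\<close>. Using the
  adjugate avoids inverting \<open>A\<close>.\<close>

lemma det_one_minus_fps_iff:
  fixes H :: "'v cpoly mat"
  assumes H: "H \<in> carrier_mat n n" and e: "e \<ge> 1"
  shows "det (1\<^sub>m n - fps_X ^ e \<cdot>\<^sub>m map_mat fps_const H) = 1 \<longleftrightarrow> (\<forall>m\<ge>1. mat_trace (H ^\<^sub>m m) = 0)"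
proof -
  define K where "K = map_mat fps_const H"
  define A where "A = 1\<^sub>m n - fps_X ^ e \<cdot>\<^sub>m K"
  define X where "X = adj_mat A"
  define S where "S k = mat_trace (X * K ^\<^sub>m k)" for k
  have K: "K \<in> carrier_mat n n" and A: "A \<in> carrier_mat n n" using H by (auto simp: K_def A_def)
  have X: "X \<in> carrier_mat n n" using adj_mat(1)[OF A] by (simp add: X_def)
  have Kp: "K ^\<^sub>m k \<in> carrier_mat n n" for k by (rule pow_carrier_mat[OF K])
  have trK: "mat_trace (K ^\<^sub>m k) = fps_const (mat_trace (H ^\<^sub>m k))" for k
    using H unfolding K_def map_mat_fps_const_pow[OF H, symmetric] mat_trace_def
    by (simp add: fps_const_sum)
  have S_rec: "S k = det A * fps_const (mat_trace (H ^\<^sub>m k)) + fps_X ^ e * S (Suc k)" for k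
  proof -
    have KK: "K * K ^\<^sub>m k = K ^\<^sub>m Suc k"
    proof (induction k)
      case (Suc k)
      then show ?case using assoc_mult_mat[OF K Kp K, of k] by simp
    qed (use K in simp)
    have "X * A = X - fps_X ^ e \<cdot>\<^sub>m (X * K)"
      unfolding A_def using mult_minus_distrib_mat[OF X one_carrier_mat, of "fps_X ^ e \<cdot>\<^sub>m K"] X K
      by (simp add: mult_smult_distrib)
    then have "X - fps_X ^ e \<cdot>\<^sub>m (X * K) = det A \<cdot>\<^sub>m 1\<^sub>m n"
      using adj_mat(3)[OF A] by (simp add: X_def)
    then have "X = det A \<cdot>\<^sub>m 1\<^sub>m n + fps_X ^ e \<cdot>\<^sub>m (X * K)"
      using X K by (intro eq_matI) (auto simp: mat_eq_iff algebra_simps)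
    then have "X * K ^\<^sub>m k = (det A \<cdot>\<^sub>m 1\<^sub>m n + fps_X ^ e \<cdot>\<^sub>m (X * K)) * K ^\<^sub>m k" by simp
    also have "\<dots> = det A \<cdot>\<^sub>m K ^\<^sub>m k + fps_X ^ e \<cdot>\<^sub>m (X * K ^\<^sub>m Suc k)"
      using X K Kp[of k]
      by (subst add_mult_distrib_mat[of _ n n _ _ n])
        (auto simp: mult_smult_assoc_mat[of _ n n _ n] assoc_mult_mat[OF X K Kp] KK simp del: pow_mat.simps)
    finally have eq: "X * K ^\<^sub>m k = det A \<cdot>\<^sub>m K ^\<^sub>m k + fps_X ^ e \<cdot>\<^sub>m (X * K ^\<^sub>m Suc k)" .
    have XK: "X * K ^\<^sub>m Suc k \<in> carrier_mat n n" using X Kp by (rule mult_carrier_mat)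
    show ?thesis
      unfolding S_def eq trK[symmetric]
      by (simp only: mat_trace_add[OF smult_carrier_mat[OF Kp] smult_carrier_mat[OF XK]]
          mat_trace_smult[OF Kp] mat_trace_smult[OF XK])
  qed
  have deriv: "fps_deriv (det A) = - (of_nat e * fps_X ^ (e - 1)) * S 1"
  proof -
    have dK: "map_mat fps_deriv A = - (of_nat e * fps_X ^ (e - 1)) \<cdot>\<^sub>m K"
      using K H by (intro eq_matI) (auto simp: A_def K_def derivation_power[OF derivation_fps_deriv])
    have "fps_deriv (det A) = mat_trace ((- (of_nat e * fps_X ^ (e - 1)) \<cdot>\<^sub>m K) * X)"
      using jacobi_formula[OF derivation_fps_deriv A] dK by (simp add: X_def)
    also have "\<dots> = - (of_nat e * fps_X ^ (e - 1)) * mat_trace (K * X)"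
      using K X by (simp add: mat_trace_def sum_distrib_left)
    also have "mat_trace (K * X) = S 1"
      using K by (simp add: S_def mat_trace_comm[OF K X])
    finally show ?thesis .
  qed
  have "det A = 1 \<longleftrightarrow> (\<forall>m\<ge>1. mat_trace (H ^\<^sub>m m) = 0)"
  proof
    assume d1: "det A = 1"
    then have "of_nat e * (fps_X ^ (e - 1) * S 1) = 0" using deriv by (simp add: ac_simps)
    then have "fps_X ^ (e - 1) * S 1 = 0" by (rule of_nat_mult_fps_eq_0) (use e in simp)
    then have S1: "S 1 = 0" by (rule fps_X_power_mult_eq_0)
    have tr: "mat_trace (H ^\<^sub>m m) = 0 \<and> S (Suc m) = 0" if "S m = 0" for m
    proof -
      have eq: "fps_const (mat_trace (H ^\<^sub>m m)) + fps_X ^ e * S (Suc m) = 0"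
        using S_rec[of m] that d1 by simp
      then have "fps_nth (fps_const (mat_trace (H ^\<^sub>m m)) + fps_X ^ e * S (Suc m)) 0 = 0" by simp
      then have "mat_trace (H ^\<^sub>m m) = 0" using e by (simp add: fps_X_power_mult_nth)
      moreover from this eq have "fps_X ^ e * S (Suc m) = 0" by simp
      then have "S (Suc m) = 0" by (rule fps_X_power_mult_eq_0)
      ultimately show ?thesis by simp
    qed
    have "S m = 0" if "m \<ge> 1" for m
      using that by (induction m rule: dec_induct) (use S1 tr in auto)
    then show "\<forall>m\<ge>1. mat_trace (H ^\<^sub>m m) = 0" using tr by auto
  next
    assume tr: "\<forall>m\<ge>1. mat_trace (H ^\<^sub>m m) = 0"
    \<comment> \<open>\<open>S 1\<close> is divisible by every power of \<open>t\<close>.\<close>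
    have "S 1 = fps_X ^ (e * k) * S (Suc k)" for k
    proof (induction k)
      case (Suc k)
      moreover have "mat_trace (H ^\<^sub>m Suc k) = 0" by (rule tr[rule_format]) simp
      ultimately show ?case using S_rec[of "Suc k"] by (simp add: power_add ac_simps del: pow_mat.simps)
    qed simp
    then have "fps_nth (S 1) k = fps_nth (fps_X ^ (e * Suc k) * S (Suc (Suc k))) k" for k by metis
    moreover have "k < e * Suc k" for k using e by (cases e) auto
    ultimately have "S 1 = 0" by (intro fps_ext) (auto simp: fps_X_power_mult_nth simp del: mult_Suc_right)
    then have d0: "fps_deriv (det A) = 0" using deriv by simp
    have "fps_nth (det A) k = fps_nth 1 k" for k
    proof (cases k)
      case 0
      interpret h: comm_ring_hom "\<lambda>F::'v cpoly fps. fps_nth F 0"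
        by unfold_locales auto
      have "map_mat (\<lambda>F. fps_nth F 0) A = 1\<^sub>m n"
        using K e by (intro eq_matI) (auto simp: A_def fps_X_power_mult_nth)
      then show ?thesis using 0 h.hom_det[of A] by simp
    next
      case (Suc l)
      have "of_nat (Suc l) * fps_nth (det A) k = fps_nth (fps_deriv (det A)) l" by (simp add: Suc)
      then have "of_nat (Suc l) * fps_nth (det A) k = 0" using d0 by simp
      then have "fps_nth (det A) k = 0" by (rule of_nat_mult_cpoly_eq_0) simp
      then show ?thesis using Suc by simp
    qed
    then show "det A = 1" by (intro fps_ext) simp
  qed
  then show ?thesis by (simp add: A_def K_def)
qed

section \<open>The grading homomorphism\<close>

text \<open>The substitution \<open>x \<mapsto> t x\<close>, which multiplies a form of degree \<open>d\<close> by \<open>t\<^sup>d\<close>. It is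
  injective, so it may be applied to an equation between determinants in order to introduce
  the parameter \<open>t\<close>.\<close>

definition grading :: "'v cpoly \<Rightarrow> 'v cpoly fps" where
  "grading p = (\<Sum>m\<in>Poly_Mapping.keys p. fps_const (Poly_Mapping.single m (lkp p m)) * fps_X ^ mdeg m)"

lemma grading_single: "grading (Poly_Mapping.single m c) = fps_const (Poly_Mapping.single m c) * fps_X ^ mdeg m"
  by (simp add: grading_def)

lemma grading_add: "grading (p + q) = grading p + grading q"
  unfolding grading_def
  by (rule sum_keys_add[where g = "\<lambda>m c. fps_const (Poly_Mapping.single m c) * fps_X ^ mdeg m"])
    (auto simp: single_add fps_const_add[symmetric] distrib_right simp del: fps_const_add)

lemma grading_mult: "grading (p * q) = grading p * grading q"
proof (induction p rule: cpoly_induct)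
  case (single m c)
  show ?case
  proof (induction q rule: cpoly_induct)
    case (single k d)
    have "fps_const (Poly_Mapping.single (m + k) (c * d)) =
        fps_const (Poly_Mapping.single m c) * fps_const (Poly_Mapping.single k d)"
      by (simp add: mult_single)
    then show ?case
      by (simp add: mult_single grading_single mdeg_add power_add ac_simps del: fps_const_mult)
  qed (simp add: distrib_left grading_add)
qed (simp add: distrib_right grading_add)

lemma comm_ring_hom_grading: "comm_ring_hom grading"
proof
  show "grading 1 = 1" using grading_single[of 0 1] by simp
  show "grading 0 = 0" by (simp add: grading_def)
qed (simp_all add: grading_add grading_mult)

lemma lookup_grading: "lkp (fps_nth (grading p) (mdeg m)) m = lkp p m"
proof (induction p rule: cpoly_induct)
  case (single k c)
  then show ?case by (auto simp: grading_single fps_X_power_iff lookup_single when_def)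
qed (simp add: grading_add lookup_add)

lemma grading_eq_iff: "grading p = grading q \<longleftrightarrow> p = q"
  by (metis lookup_grading poly_mapping_eqI)

lemma grading_homogeneous:
  assumes "homogeneous d p"
  shows "grading p = fps_const p * fps_X ^ d"
proof -
  have "grading p = (\<Sum>m\<in>Poly_Mapping.keys p. fps_const (Poly_Mapping.single m (lkp p m)) * fps_X ^ d)"
    unfolding grading_def using assms by (intro sum.cong) (auto simp: homogeneous_mdeg)
  also have "\<dots> = fps_const p * fps_X ^ d"
    by (simp add: sum_distrib_right[symmetric] fps_const_sum[symmetric] single_sum_keys)
  finally show ?thesis .
qed

lemma det_one_minus_homogeneous_iff:
  fixes H :: "'v cpoly mat"
  assumes H: "H \<in> carrier_mat n n" and e: "e \<ge> 1"
    and hom: "\<And>i j. i < n \<Longrightarrow> j < n \<Longrightarrow> homogeneous e (H $$ (i, j))"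
  shows "det (1\<^sub>m n - H) = 1 \<longleftrightarrow> (\<forall>m\<ge>1. mat_trace (H ^\<^sub>m m) = 0)"
proof -
  interpret h: comm_ring_hom "grading :: 'v cpoly \<Rightarrow> _" by (rule comm_ring_hom_grading)
  have "map_mat grading (1\<^sub>m n - H) = 1\<^sub>m n - fps_X ^ e \<cdot>\<^sub>m map_mat fps_const H"
    using H by (intro eq_matI) (auto simp: h.hom_minus grading_homogeneous[OF hom] mult.commute)
  then have "grading (det (1\<^sub>m n - H)) = det (1\<^sub>m n - fps_X ^ e \<cdot>\<^sub>m map_mat fps_const H)"
    using h.hom_det by metis
  then have "det (1\<^sub>m n - H) = 1 \<longleftrightarrow> det (1\<^sub>m n - fps_X ^ e \<cdot>\<^sub>m map_mat fps_const H) = 1"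
    using grading_eq_iff h.hom_one by metis
  then show ?thesis by (simp add: det_one_minus_fps_iff[OF H e])
qed

section \<open>Keller maps\<close>

text \<open>Maps satisfying the hypothesis of the Jacobian conjecture are commonly called Keller maps.\<close>

definition keller :: "nat \<Rightarrow> (nat \<Rightarrow> nat cpoly) \<Rightarrow> bool" where
  "keller n F \<longleftrightarrow> polynomial_map n F \<and> det (jacobian_matrix n F) = 1"

definition left_inverse_map :: "nat \<Rightarrow> (nat \<Rightarrow> nat cpoly) \<Rightarrow> (nat \<Rightarrow> nat cpoly) \<Rightarrow> bool" where
  "left_inverse_map n F G \<longleftrightarrow> polynomial_map n G \<and> (\<forall>i<n. csubst F (G i) = cvar i)"

lemma jacobian_matrix_carrier: "jacobian_matrix n F \<in> carrier_mat n n"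
  by (simp add: jacobian_matrix_def)

lemma det_1_left_kernel:
  fixes A :: "'a::comm_ring_1 mat"
  assumes A: "A \<in> carrier_mat n n" and d: "det A = 1"
    and r: "\<And>j. j < n \<Longrightarrow> (\<Sum>i<n. r i * A $$ (i, j)) = 0" and k: "k < n"
  shows "r k = 0"
proof -
  let ?B = "adj_mat A"
  have B: "?B \<in> carrier_mat n n" "A * ?B = 1\<^sub>m n" using adj_mat(1,2)[OF A] d by auto
  have AB: "(\<Sum>j<n. A $$ (i, j) * ?B $$ (j, k)) = (if i = k then 1 else 0)" if "i < n" for i
  proof -
    have "(\<Sum>j<n. A $$ (i, j) * ?B $$ (j, k)) = (A * ?B) $$ (i, k)"
      using A B(1) that k by (simp add: scalar_prod_def atLeast0LessThan)
    then show ?thesis using B(2) that k by simp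
  qed
  have "r k = (\<Sum>i<n. r i * (\<Sum>j<n. A $$ (i, j) * ?B $$ (j, k)))"
    using k by (simp add: AB if_distrib cong: if_cong)
  also have "\<dots> = (\<Sum>j<n. (\<Sum>i<n. r i * A $$ (i, j)) * ?B $$ (j, k))"
    unfolding sum_distrib_left sum_distrib_right by (subst sum.swap) (simp add: mult.assoc)
  also have "\<dots> = 0" by (simp add: r)
  finally show ?thesis .
qed

text \<open>If \<open>p (F) = 0\<close>, the chain rule and the invertible Jacobian matrix give \<open>(\<partial>\<^sub>i p) (F) = 0\<close> for all
  \<open>i\<close>. By induction on the degree the gradient of \<open>p\<close> vanishes, so \<open>p\<close> is a constant, hence
  zero.\<close>

lemma keller_csubst_eq_0:
  assumes F: "keller n F" and "p \<in> cpolys {..<n}" "csubst F p = 0"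
  shows "p = 0"
proof -
  have "p = 0" if "\<forall>m\<in>Poly_Mapping.keys p. mdeg m < d" "p \<in> cpolys {..<n}" "csubst F p = 0" for d p
    using that
  proof (induction d arbitrary: p)
    case 0
    then show ?case by (metis ex_in_conv keys_eq_empty not_less0)
  next
    case (Suc d)
    have "csubst F (pdiff i p) = 0" if "i < n" for i
    proof (rule det_1_left_kernel[OF jacobian_matrix_carrier _ _ that])
      show "det (jacobian_matrix n F) = 1" using F by (simp add: keller_def)
      fix j assume j: "j < n"
      have "(\<Sum>i<n. csubst F (pdiff i p) * jacobian_matrix n F $$ (i, j)) = pdiff j (csubst F p)"
        using j by (subst pdiff_csubst[OF _ Suc.prems(2)]) (auto simp: jacobian_matrix_def)
      then show "(\<Sum>i<n. csubst F (pdiff i p) * jacobian_matrix n F $$ (i, j)) = 0"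
        using Suc.prems(3) by simp
    qed
    moreover have "\<forall>m\<in>Poly_Mapping.keys (pdiff i p). mdeg m < d" for i
      using Suc.prems(1) keys_pdiff[of _ i p] by (fastforce simp: mdeg_add)
    ultimately have "pdiff i p = 0" if "i < n" for i
      using Suc.IH[of "pdiff i p"] that cpolys_pdiff[OF Suc.prems(2)] by auto
    then have p: "p = cconst (lkp p 0)"
      using gradient_0_imp_const[OF Suc.prems(2)] by auto
    then have "csubst F p = p" by (metis csubst_cconst)
    then show ?case using Suc.prems(3) by simp
  qed
  moreover have "\<forall>m\<in>Poly_Mapping.keys p. mdeg m < Suc (\<Sum>m\<in>Poly_Mapping.keys p. mdeg m)"
    by (auto simp: less_Suc_eq_le intro: member_le_sum)
  ultimately show ?thesis using assms by blast
qed

text \<open>From \<open>G \<circ> F = id\<close> one gets \<open>(F \<circ> G) \<circ> F = F\<close>, and \<open>F\<close> may be cancelled on the right.\<close>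

lemma keller_left_inverse_imp_automorphism:
  assumes F: "keller n F" and G: "left_inverse_map n F G"
  shows "polynomial_automorphism n F"
proof -
  have pF: "polynomial_map n F" and pG: "polynomial_map n G"
    and GF: "\<And>i. i < n \<Longrightarrow> csubst F (G i) = cvar i"
    using assms by (auto simp: keller_def left_inverse_map_def)
  have "csubst G (F i) = cvar i" if i: "i < n" for i
  proof -
    have Fi: "F i \<in> cpolys {..<n}" using pF i by (auto simp: polynomial_map_def)
    have "csubst F (csubst G (F i)) = csubst cvar (F i)"
      unfolding csubst_csubst by (rule csubst_cong[OF Fi]) (simp add: GF)
    then have "csubst F (csubst G (F i) - cvar i) = 0"
      by (simp add: csubst_diff csubst_cvar_id)
    moreover have "csubst G (F i) - cvar i \<in> cpolys {..<n}"
      using Fi pG i by (intro cpolys_diff cpolys_csubst[OF Fi]) (auto simp: polynomial_map_def)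
    ultimately have "csubst G (F i) - cvar i = 0" using keller_csubst_eq_0[OF F] by blast
    then show ?thesis by simp
  qed
  then show ?thesis
    using pF pG GF by (auto simp: polynomial_automorphism_def)
qed

text \<open>If \<open>F' \<circ> \<sigma> = \<tau> \<circ> F\<close> and \<open>\<sigma>\<close> is a section of the projection to the first \<open>n\<close> coordinates, then
  any left inverse \<open>K\<close> of \<open>F'\<close> gives the left inverse \<open>u \<mapsto> (K (\<tau> u))\<^sub>1, \<dots>, (K (\<tau> u))\<^sub>n\<close> of \<open>F\<close>.\<close>

lemma left_inverse_transfer:
  assumes K: "left_inverse_map m F' K" and nm: "n \<le> m"
    and st: "\<And>v. v < m \<Longrightarrow> csubst \<sigma> (F' v) = csubst F (\<tau> v)"
    and \<sigma>: "\<And>i. i < n \<Longrightarrow> \<sigma> i = cvar i"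
    and \<tau>: "\<And>v. v < m \<Longrightarrow> \<tau> v \<in> cpolys {..<n}"
  shows "\<exists>G. left_inverse_map n F G"
proof (intro exI)
  have Kp: "K i \<in> cpolys {..<m}" if "i < n" for i
    using K nm that by (auto simp: left_inverse_map_def polynomial_map_def)
  have "csubst F (csubst \<tau> (K i)) = cvar i" if i: "i < n" for i
  proof -
    have "csubst F (csubst \<tau> (K i)) = csubst \<sigma> (csubst F' (K i))"
      unfolding csubst_csubst by (rule csubst_cong[OF Kp[OF i]]) (simp add: st)
    then show ?thesis using K i nm by (simp add: left_inverse_map_def \<sigma>)
  qed
  then show "left_inverse_map n F (\<lambda>i. csubst \<tau> (K i))"
    using Kp \<tau> by (auto simp: left_inverse_map_def polynomial_map_def intro!: cpolys_csubst)
qed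

section \<open>Cubic homogeneous perturbations of the identity\<close>

definition euler :: "nat \<Rightarrow> nat cpoly \<Rightarrow> nat cpoly" where
  "euler n p = (\<Sum>j<n. cvar j * pdiff j p)"

lemma derivation_euler: "derivation (euler n)"
  by (auto simp: derivation_def euler_def pdiff_add pdiff_mult sum.distrib algebra_simps sum_distrib_left)

lemma euler_cconst [simp]: "euler n (cconst c) = 0"
  by (simp add: euler_def)

lemma euler_cvar: "i < n \<Longrightarrow> euler n (cvar i) = cvar i"
  by (simp add: euler_def pdiff_cvar if_distrib cong: if_cong)

text \<open>Reading coefficients, the Euler operator multiplies by the degree. This serves two purposes: Euler's
  identity for forms, and the estimate of the order of a polynomial from its image under
  \<open>euler n - 3\<close>.\<close>

lemma lookup_euler:
  assumes p: "p \<in> cpolys {..<n}"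
  shows "lkp (euler n p) m = of_nat (mdeg m) * lkp p m"
proof -
  have s: "euler n (Poly_Mapping.single m c) = Poly_Mapping.single m (of_nat (mdeg m) * c)"
    if "Poly_Mapping.keys m \<subseteq> {..<n}" for m c
  proof -
    have "cvar j * pdiff j (Poly_Mapping.single m c) = Poly_Mapping.single m (of_nat (lkp m j) * c)" for j
      by (cases "lkp m j = 0")
        (auto simp: pdiff_single cvar_times_single add.commute[of "mvar j"] minus_mvar_add)
    then have "euler n (Poly_Mapping.single m c) = (\<Sum>j<n. Poly_Mapping.single m (of_nat (lkp m j) * c))"
      by (simp add: euler_def)
    also have "\<dots> = Poly_Mapping.single m (\<Sum>j<n. of_nat (lkp m j) * c)"
      by (induction n) (auto simp: single_add)
    finally show ?thesis
      using mdeg_superset[OF _ that] by (simp add: sum_distrib_right)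
  qed
  have "euler n p = (\<Sum>m\<in>Poly_Mapping.keys p. euler n (Poly_Mapping.single m (lkp p m)))"
    by (subst (1) single_sum_keys[of p, symmetric]) (simp add: derivation_sum[OF derivation_euler])
  also have "\<dots> = (\<Sum>m\<in>Poly_Mapping.keys p. Poly_Mapping.single m (of_nat (mdeg m) * lkp p m))"
    using p by (intro sum.cong refl s) (auto simp: cpolys_def)
  finally show ?thesis
    by (auto simp: lookup_sum lookup_single when_def in_keys_iff)
qed

lemma euler_homogeneous:
  assumes "p \<in> cpolys {..<n}" "homogeneous d p"
  shows "euler n p = of_nat d * p"
proof (rule poly_mapping_eqI)
  fix m
  have "mdeg m = d \<or> lkp p m = 0" using assms(2) by (auto simp: homogeneous_mdeg in_keys_iff)
  then show "lkp (euler n p) m = lkp (of_nat d * p) m"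
    using lookup_cconst_mult[of "of_nat d" p m] by (auto simp: lookup_euler[OF assms(1)])
qed

locale cubic_map =
  fixes n :: nat and H :: "nat \<Rightarrow> nat cpoly"
  assumes H_cpolys: "i < n \<Longrightarrow> H i \<in> cpolys {..<n}"
    and H_homogeneous: "i < n \<Longrightarrow> homogeneous 3 (H i)"
begin

definition "F i = cvar i - H i"

lemma polynomial_map_F: "polynomial_map n F"
  by (auto simp: polynomial_map_def F_def H_cpolys)

lemma order_F: "i < n \<Longrightarrow> order_ge 1 (F i)"
  unfolding F_def
  by (intro order_ge_diff order_ge_mono[OF homogeneous_imp_order_ge[OF H_homogeneous]]) auto

lemma order_csubst_F: "p \<in> cpolys {..<n} \<Longrightarrow> order_ge d p \<Longrightarrow> order_ge d (csubst F p)"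
  by (rule order_ge_csubst) (auto simp: cpolys_def intro!: order_F[simplified])

lemma csubst_F_cpolys: "p \<in> cpolys {..<n} \<Longrightarrow> csubst F p \<in> cpolys {..<n}"
  using polynomial_map_F by (intro cpolys_csubst[of p "{..<n}"]) (auto simp: polynomial_map_def)

lemma jacobian_F: "jacobian_matrix n F = 1\<^sub>m n - mat n n (\<lambda>(i, j). pdiff j (H i))"
  by (intro eq_matI) (auto simp: jacobian_matrix_def F_def pdiff_diff pdiff_cvar)

lemma keller_F_iff:
  "keller n F \<longleftrightarrow> (\<forall>m\<ge>1. mat_trace (mat n n (\<lambda>(i, j). pdiff j (H i)) ^\<^sub>m m) = 0)"
proof -
  have "homogeneous 2 (pdiff j (H i))" if "i < n" for i j
    by (rule homogeneous_pdiff) (use H_homogeneous[OF that] in \<open>simp add: eval_nat_numeral\<close>)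
  then show ?thesis
    using polynomial_map_F unfolding keller_def jacobian_F
    by (subst det_one_minus_homogeneous_iff[where e = 2]) auto
qed

text \<open>Expanding \<open>p (x - H)\<close>, every term other than \<open>p\<close> itself has a variable replaced by a cubic form.\<close>

lemma csubst_F_diff:
  assumes p: "p \<in> cpolys {..<n}" and d: "order_ge d p"
  shows "order_ge (d + 2) (csubst F p - p)"
proof -
  have mon: "order_ge (mdeg m + 2) (csubst F (Poly_Mapping.single m 1) - Poly_Mapping.single m 1)"
    if "Poly_Mapping.keys m \<subseteq> {..<n}" for m
    using that
  proof (induction m rule: monomial_induct)
    case zero
    then show ?case by (simp add: csubst_single)
  next
    case (add m v)
    let ?x = "Poly_Mapping.single m 1 :: nat cpoly"
    have eq: "csubst F (Poly_Mapping.single (mvar v + m) 1) - Poly_Mapping.single (mvar v + m) 1 =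
        F v * (csubst F ?x - ?x) - H v * ?x"
      unfolding cvar_times_single[symmetric] by (simp add: csubst_mult F_def algebra_simps)
    have "order_ge (1 + (mdeg m + 2)) (F v * (csubst F ?x - ?x))"
      using add by (intro order_ge_mult order_F) auto
    moreover have "order_ge (3 + mdeg m) (H v * ?x)"
      using add homogeneous_imp_order_ge[OF H_homogeneous] by (intro order_ge_mult) (auto simp: order_ge_def)
    ultimately have "order_ge (mdeg m + 3) (F v * (csubst F ?x - ?x) - H v * ?x)"
      by (intro order_ge_diff) (simp_all add: numeral_3_eq_3 ac_simps)
    then show ?case unfolding eq mdeg_add by (simp add: eval_nat_numeral)
  qed
  have "csubst F p - p = (\<Sum>m\<in>Poly_Mapping.keys p. cconst (lkp p m) * (csubst F (Poly_Mapping.single m 1) - Poly_Mapping.single m 1))"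
  proof -
    have "cconst (lkp p m) * (csubst F (Poly_Mapping.single m 1) - Poly_Mapping.single m 1) =
        csubst F (Poly_Mapping.single m (lkp p m)) - Poly_Mapping.single m (lkp p m)" for m
      by (simp add: csubst_single right_diff_distrib cconst_times_single)
    then show ?thesis
      by (simp add: sum_subtractf csubst_sum[symmetric] single_sum_keys)
  qed
  also have "order_ge (d + 2) \<dots>"
  proof (intro order_ge_sum order_ge_cconst_mult)
    fix m assume m: "m \<in> Poly_Mapping.keys p"
    then have "Poly_Mapping.keys m \<subseteq> {..<n}" "d \<le> mdeg m" using p d by (auto simp: cpolys_def order_ge_def)
    then show "order_ge (d + 2) (csubst F (Poly_Mapping.single m 1) - Poly_Mapping.single m 1)"
      using order_ge_mono[OF mon[of m], of "d + 2"] by simp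
  qed
  finally show ?thesis .
qed

text \<open>By the preceding lemma \<open>p (F)\<close> and \<open>p\<close> have the same lowest form.\<close>

lemma order_ge_if_csubst_F:
  assumes p: "p \<in> cpolys {..<n}" and L: "order_ge L (csubst F p)"
  shows "order_ge L p"
proof -
  have "order_ge d p" if "d \<le> L" for d
    using that
  proof (induction d)
    case (Suc d)
    then have "order_ge (d + 2) (csubst F p - p)"
      by (intro csubst_F_diff[OF p]) simp
    then have "order_ge (Suc d) (csubst F p - p)" by (rule order_ge_mono) simp
    moreover have "order_ge (Suc d) (csubst F p)" by (rule order_ge_mono[OF L Suc.prems])
    ultimately have "order_ge (Suc d) (csubst F p - (csubst F p - p))" by (rule order_ge_diff[rotated])
    then show ?case by simp
  qed simp
  then show ?thesis by simp
qed

end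

text \<open>With a cubic initial value the coefficient of \<open>t\<^sup>k\<close> is a form of degree \<open>2 k + 3\<close>. The degree thus
  takes over the role of \<open>t\<close>, and the value of the series at \<open>t = 1\<close> is approximated by the
  partial sums \<open>S K\<close>, which are polynomials.\<close>

locale cubic_burgers = cubic_map n H + burgers n "\<lambda>i. i" V
  for n H V +
  assumes V_0: "i < n \<Longrightarrow> fps_nth (V i) 0 = H i"
begin

abbreviation "v k i \<equiv> fps_nth (V i) k"
definition "S K i = (\<Sum>k<K. v k i)"

lemma v_Suc:
  assumes "i < n"
  shows "of_nat (Suc k) * v (Suc k) i = (\<Sum>a\<le>k. \<Sum>j<n. v a j * pdiff j (v (k - a) i))"
proof -
  have "fps_nth (fps_deriv (V i)) k = (\<Sum>j<n. \<Sum>a=0..k. v a j * pdiff j (v (k - a) i))"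
    by (simp add: burgers[OF assms] fps_sum_nth fps_mult_nth)
  then show ?thesis by (subst sum.swap) (simp add: atLeast0AtMost)
qed

lemma v_cpolys_homogeneous:
  "i < n \<Longrightarrow> v k i \<in> cpolys {..<n} \<and> homogeneous (2 * k + 3) (v k i)"
proof (induction k arbitrary: i rule: less_induct)
  case (less k)
  show ?case
  proof (cases k)
    case 0
    then show ?thesis using less H_cpolys H_homogeneous V_0 by simp
  next
    case (Suc l)
    let ?w = "\<Sum>a\<le>l. \<Sum>j<n. v a j * pdiff j (v (l - a) i)"
    have v: "v k i = cconst (inverse (of_nat (Suc l))) * ?w"
    proof -
      have "cconst (inverse (of_nat (Suc l))) * ?w = cconst (inverse (of_nat (Suc l)) * of_nat (Suc l)) * v k i"
        unfolding v_Suc[OF less.prems, symmetric] Suc cconst_mult cconst_of_nat by (simp only: mult.assoc)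
      then show ?thesis by (simp del: of_nat_Suc)
    qed
    have "?w \<in> cpolys {..<n}" using less Suc by (intro cpolys_sum cpolys_mult cpolys_pdiff) auto
    moreover have "homogeneous (2 * k + 3) ?w"
    proof (intro homogeneous_sum)
      fix a j assume aj: "a \<in> {..l}" "j \<in> {..<n}"
      have "homogeneous (2 * (l - a) + 2) (pdiff j (v (l - a) i))"
        using less.IH[of "l - a" i] less.prems Suc by (intro homogeneous_pdiff) (simp add: eval_nat_numeral)
      then have "homogeneous ((2 * a + 3) + (2 * (l - a) + 2)) (v a j * pdiff j (v (l - a) i))"
        using less.IH[of a j] aj Suc by (intro homogeneous_mult) auto
      then show "homogeneous (2 * k + 3) (v a j * pdiff j (v (l - a) i))"
        using aj Suc by (simp add: algebra_simps)
    qed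
    ultimately show ?thesis unfolding v by (auto intro: homogeneous_cconst_mult)
  qed
qed

lemmas v_cpolys = v_cpolys_homogeneous[THEN conjunct1]
  and v_homogeneous = v_cpolys_homogeneous[THEN conjunct2]

lemma S_cpolys: "i < n \<Longrightarrow> S K i \<in> cpolys {..<n}"
  unfolding S_def by (intro cpolys_sum v_cpolys)

lemma order_S: "i < n \<Longrightarrow> order_ge 3 (S K i)"
  unfolding S_def by (intro order_ge_sum order_ge_mono[OF homogeneous_imp_order_ge[OF v_homogeneous]]) auto

text \<open>On forms of degree \<open>2 k + 3\<close> the operator \<open>euler n - 3\<close> is multiplication by \<open>2 k\<close>, so it acts on the
  series as \<open>2 t \<partial>\<^sub>t\<close>. The partial sums satisfy the resulting equation up to the products
  that their truncation cuts off.\<close>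

lemma S_burgers:
  assumes i: "i < n"
  shows "order_ge (2 * K + 3) (euler n (S K i) - 3 * S K i - 2 * (\<Sum>j<n. S K j * pdiff j (S K i)))"
proof (cases K)
  case 0
  then show ?thesis by (simp add: S_def derivation_0[OF derivation_euler])
next
  case (Suc L)
  define f where "f = (\<lambda>(a, b). \<Sum>j<n. v a j * pdiff j (v b i))"
  have hom_f: "homogeneous (2 * (a + b) + 5) (f (a, b))" for a b
  proof -
    have "homogeneous ((2 * a + 3) + (2 * b + 2)) (v a j * pdiff j (v b i))" if "j < n" for j
      using v_homogeneous[OF i, of b] by (intro homogeneous_mult v_homogeneous that homogeneous_pdiff) (simp add: eval_nat_numeral)
    then show ?thesis unfolding f_def by (auto intro!: homogeneous_sum simp: algebra_simps)
  qed
  let ?T = "{(a, b). a + b < L}"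
  have sub: "?T \<subseteq> {..<K} \<times> {..<K}" using Suc by auto
  have "euler n (S K i) - 3 * S K i = (\<Sum>k<K. of_nat (2 * k) * v k i)"
  proof -
    have "euler n (v k i) - 3 * v k i = of_nat (2 * k) * v k i" for k
      by (simp add: euler_homogeneous[OF v_cpolys[OF i] v_homogeneous[OF i]] algebra_simps)
    then show ?thesis
      by (simp add: S_def derivation_sum[OF derivation_euler] sum_subtractf[symmetric] sum_distrib_left del: of_nat_mult)
  qed
  also have "\<dots> = 2 * (\<Sum>k<L. of_nat (Suc k) * v (Suc k) i)"
    unfolding Suc sum.lessThan_Suc_shift sum_distrib_left
    by (simp only: of_nat_mult of_nat_numeral mult.assoc mult_zero_left mult_zero_right of_nat_0 add_0_left)
  also have "(\<Sum>k<L. of_nat (Suc k) * v (Suc k) i) = (\<Sum>k<L. \<Sum>a\<le>k. f (a, k - a))"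
    by (simp only: v_Suc[OF i] f_def prod.case)
  also have "\<dots> = (\<Sum>(a, b)\<in>?T. f (a, b))" by (rule sum.triangle_reindex[symmetric])
  also have "\<dots> = sum f ?T" by (simp add: split_def)
  finally have 1: "euler n (S K i) - 3 * S K i = 2 * sum f ?T" .
  have "(\<Sum>j<n. S K j * pdiff j (S K i)) = (\<Sum>j<n. \<Sum>a<K. \<Sum>b<K. v a j * pdiff j (v b i))"
    by (simp add: S_def pdiff_sum sum_product)
  also have "\<dots> = (\<Sum>a<K. \<Sum>b<K. f (a, b))"
    unfolding f_def prod.case by (rule trans[OF sum.swap sum.cong[OF refl sum.swap]])
  also have "\<dots> = sum f ({..<K} \<times> {..<K})" by (simp add: sum.cartesian_product)
  also have "\<dots> = sum f ({..<K} \<times> {..<K} - ?T) + sum f ?T"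
    by (rule sum.subset_diff[OF sub]) simp
  finally have 2: "(\<Sum>j<n. S K j * pdiff j (S K i)) = sum f ({..<K} \<times> {..<K} - ?T) + sum f ?T" .
  have eq: "euler n (S K i) - 3 * S K i - 2 * (\<Sum>j<n. S K j * pdiff j (S K i)) =
      cconst (- 2) * sum f ({..<K} \<times> {..<K} - ?T)"
    unfolding 1 2 by (simp add: cconst_uminus algebra_simps)
  show ?thesis unfolding eq
  proof (intro order_ge_cconst_mult order_ge_sum)
    fix x assume "x \<in> {..<K} \<times> {..<K} - ?T"
    then obtain a b where x: "x = (a, b)" "L \<le> a + b" by (cases x) auto
    show "order_ge (2 * K + 3) (f x)"
      unfolding x(1) by (rule order_ge_mono[OF homogeneous_imp_order_ge[OF hom_f]]) (use x Suc in simp)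
  qed
qed

text \<open>The error \<open>W = S (F) - H\<close> satisfies \<open>euler W - 3 W = 2 \<Sum> W\<^sub>j (\<partial>\<^sub>j S) (F)\<close> up to terms of high order.
  The right-hand side has higher order than \<open>W\<close>, whereas the left-hand side multiplies the form of
  degree \<open>d\<close> in \<open>W\<close> by \<open>d - 3\<close>. Hence the order of \<open>W\<close> exceeds every \<open>d\<close> for which the argument
  applies.\<close>

lemma csubst_F_S:
  assumes "i < n"
  shows "order_ge (2 * K + 3) (csubst F (S K i) - H i)"
proof (cases K)
  case 0
  then show ?thesis using homogeneous_imp_order_ge[OF H_homogeneous[OF assms]]
    by (auto simp: S_def)
next
  case (Suc L)
  define W where "W i = csubst F (S K i) - H i" for i
  have W_cpolys: "W i \<in> cpolys {..<n}" if "i < n" for i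
    using that unfolding W_def by (intro cpolys_diff csubst_F_cpolys S_cpolys H_cpolys)
  \<comment> \<open>The factor \<open>d - 3\<close> must not vanish, so the induction on \<open>d\<close> starts above degree three.\<close>
  have W5: "order_ge 5 (W i)" if i: "i < n" for i
  proof -
    have "S K i - H i = (\<Sum>k<L. v (Suc k) i)"
      unfolding S_def Suc sum.lessThan_Suc_shift by (simp add: V_0[OF i])
    moreover have "order_ge 5 \<dots>"
      using i by (intro order_ge_sum order_ge_mono[OF homogeneous_imp_order_ge[OF v_homogeneous]]) auto
    ultimately have "order_ge 5 (S K i - H i)" by simp
    moreover have "order_ge 5 (csubst F (S K i) - S K i)"
      using csubst_F_diff[OF S_cpolys order_S, OF i i] by simp
    ultimately have "order_ge 5 ((csubst F (S K i) - S K i) + (S K i - H i))" by (intro order_ge_add)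
    then show ?thesis by (simp add: W_def)
  qed
  have euler_W: "euler n (W i) - 3 * W i =
      csubst F (euler n (S K i) - 3 * S K i - 2 * (\<Sum>j<n. S K j * pdiff j (S K i))) +
      2 * (\<Sum>j<n. W j * csubst F (pdiff j (S K i)))" if i: "i < n" for i
  proof -
    let ?d = "\<lambda>j. csubst F (pdiff j (S K i))"
    have "euler n (F j) = F j - 2 * H j" if "j < n" for j
      using that by (simp add: F_def derivation_diff[OF derivation_euler] euler_cvar
          euler_homogeneous[OF H_cpolys H_homogeneous])
    then have "euler n (csubst F (S K i)) = (\<Sum>j<n. ?d j * (F j - 2 * H j))"
      using i by (subst chain_rule[OF derivation_euler euler_cconst finite_lessThan S_cpolys]) auto
    also have "\<dots> = (\<Sum>j<n. F j * ?d j) - 2 * (\<Sum>j<n. H j * ?d j)"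
      by (simp add: sum_subtractf sum_distrib_left algebra_simps)
    also have "(\<Sum>j<n. F j * ?d j) = csubst F (euler n (S K i))"
      by (simp add: euler_def csubst_sum csubst_mult)
    also have "(\<Sum>j<n. H j * ?d j) = csubst F (\<Sum>j<n. S K j * pdiff j (S K i)) - (\<Sum>j<n. W j * ?d j)"
      by (simp add: csubst_sum csubst_mult W_def sum_subtractf left_diff_distrib)
    finally have "euler n (csubst F (S K i)) = csubst F (euler n (S K i)) -
        2 * (csubst F (\<Sum>j<n. S K j * pdiff j (S K i)) - (\<Sum>j<n. W j * ?d j))" .
    then show ?thesis
      using i by (simp add: W_def derivation_diff[OF derivation_euler] csubst_diff csubst_add csubst_mult
          euler_homogeneous[OF H_cpolys H_homogeneous] algebra_simps)
  qed
  have "d \<le> 2 * K + 3 \<Longrightarrow> \<forall>i<n. order_ge d (W i)" for d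
  proof (induction d)
    case (Suc d)
    show ?case
    proof (cases "d \<ge> 5")
      case False
      then show ?thesis using order_ge_mono[OF W5, of _ "Suc d"] by simp
    next
      case d5: True
      show ?thesis
      proof (intro allI impI)
        fix i assume i: "i < n"
        have "order_ge (Suc d) (euler n (W i) - 3 * W i)"
          unfolding euler_W[OF i]
        proof (rule order_ge_add)
          have "euler n (S K i) - 3 * S K i - 2 * (\<Sum>j<n. S K j * pdiff j (S K i)) \<in> cpolys {..<n}"
            unfolding euler_def cconst_numeral[symmetric] using i
            by (intro cpolys_diff cpolys_mult cpolys_sum cpolys_pdiff S_cpolys cpolys_cconst) auto
          then show "order_ge (Suc d) (csubst F (euler n (S K i) - 3 * S K i - 2 * (\<Sum>j<n. S K j * pdiff j (S K i))))"
            by (intro order_csubst_F order_ge_mono[OF S_burgers[OF i] Suc.prems])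
          have "order_ge (d + 2) (W j * csubst F (pdiff j (S K i)))" if j: "j < n" for j
            using Suc j i order_S[OF i, of K]
            by (intro order_ge_mult order_csubst_F order_ge_pdiff cpolys_pdiff S_cpolys) (auto simp: eval_nat_numeral)
          then have "order_ge (d + 2) (cconst 2 * (\<Sum>j<n. W j * csubst F (pdiff j (S K i))))"
            by (intro order_ge_cconst_mult order_ge_sum) auto
          then show "order_ge (Suc d) (2 * (\<Sum>j<n. W j * csubst F (pdiff j (S K i))))"
            using order_ge_mono[of "d + 2" "2 * (\<Sum>j<n. W j * csubst F (pdiff j (S K i)))" "Suc d"] by simp
        qed
        then have E: "lkp (euler n (W i) - 3 * W i) m = 0" if "mdeg m = d" for m
          using that by (force simp: order_ge_def in_keys_iff)
        show "order_ge (Suc d) (W i)"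
          unfolding order_ge_def
        proof
          fix m assume m: "m \<in> Poly_Mapping.keys (W i)"
          have "mdeg m \<noteq> d"
          proof
            assume md: "mdeg m = d"
            have "(of_nat d - 3) * lkp (W i) m = 0"
              using E[OF md] lookup_cconst_mult[of 3 "W i" m] md
              by (simp add: lookup_minus lookup_euler[OF W_cpolys[OF i]] left_diff_distrib)
            then show False
              using m d5 of_nat_eq_iff[of d 3, where 'a = complex] by (simp add: in_keys_iff)
          qed
          moreover have "d \<le> mdeg m" using Suc i m by (auto simp: order_ge_def)
          ultimately show "Suc d \<le> mdeg m" by simp
        qed
      qed
    qed
  qed simp
  from this[OF order_refl] assms show ?thesis by (simp add: W_def)
qed

text \<open>A polynomial inverse \<open>id + N\<close> satisfies \<open>N (F) = H\<close>, like the series up to high order; since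
  substitution of \<open>F\<close> preserves the order, \<open>N\<close> and the partial sums agree up to that order. So
  the forms of the series of degree beyond that of \<open>N\<close> vanish.\<close>

lemma finite_if_left_inverse:
  assumes G: "left_inverse_map n F G"
  shows "\<exists>N. \<forall>k\<ge>N. \<forall>i<n. v k i = 0"
proof -
  define N where "N i = G i - cvar i" for i
  have N_cpolys: "N i \<in> cpolys {..<n}" if "i < n" for i
    using G that by (auto simp: N_def left_inverse_map_def polynomial_map_def)
  have N_F: "csubst F (N i) = H i" if "i < n" for i
    using G that by (simp add: N_def left_inverse_map_def csubst_diff F_def)
  \<comment> \<open>A crude bound for the degrees of all components of \<open>N\<close>.\<close>
  define d where "d = (\<Sum>i<n. \<Sum>m\<in>Poly_Mapping.keys (N i). mdeg m)"
  have d: "mdeg m \<le> d" if "i < n" "m \<in> Poly_Mapping.keys (N i)" for i m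
  proof -
    have "mdeg m \<le> (\<Sum>m\<in>Poly_Mapping.keys (N i). mdeg m)" using that by (intro member_le_sum) auto
    also have "\<dots> \<le> d" unfolding d_def using that by (intro member_le_sum) auto
    finally show ?thesis .
  qed
  have "v k i = 0" if k: "k \<ge> d" and i: "i < n" for k i
  proof -
    have "csubst F (N i - S (Suc k) i) = - (csubst F (S (Suc k) i) - H i)"
      using N_F[OF i] by (simp add: csubst_diff)
    then have "order_ge (2 * Suc k + 3) (csubst F (N i - S (Suc k) i))"
      using order_ge_uminus[OF csubst_F_S[OF i, of "Suc k"]] by simp
    moreover have "N i - S (Suc k) i \<in> cpolys {..<n}"
      by (intro cpolys_diff N_cpolys S_cpolys i)
    ultimately have U: "order_ge (2 * Suc k + 3) (N i - S (Suc k) i)"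
      by (rule order_ge_if_csubst_F[rotated])
    have "lkp (v k i) m = 0" for m
    proof (cases "mdeg m = 2 * k + 3")
      case True
      have "lkp (N i) m = 0" using d[OF i, of m] True k by (force simp: in_keys_iff)
      moreover have "lkp (N i - S (Suc k) i) m = 0"
        using U True by (force simp: order_ge_def in_keys_iff)
      moreover have "lkp (v l i) m = 0" if "l < k" for l
        using v_homogeneous[OF i, of l] True that by (force simp: homogeneous_mdeg in_keys_iff)
      ultimately show ?thesis by (simp add: lookup_minus S_def lookup_add lookup_sum)
    next
      case False
      then show ?thesis using v_homogeneous[OF i, of k] by (auto simp: homogeneous_mdeg in_keys_iff)
    qed
    then show ?thesis by (intro poly_mapping_eqI) simp
  qed
  then show ?thesis by blast
qed

lemma left_inverse_if_finite:
  assumes N: "\<And>k i. k \<ge> N \<Longrightarrow> i < n \<Longrightarrow> v k i = 0"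
  shows "left_inverse_map n F (\<lambda>i. cvar i + S N i)"
  unfolding left_inverse_map_def polynomial_map_def
proof (intro conjI allI impI)
  fix i assume i: "i < n"
  show "cvar i + S N i \<in> cpolys {..<n}" using i by (intro cpolys_add S_cpolys) simp_all
  have SN: "S K i = S N i" if "K \<ge> N" for K
    unfolding S_def using that N i by (intro sum.mono_neutral_right) auto
  have "order_ge (2 * K + 3) (csubst F (S N i) - H i)" if "K \<ge> N" for K
    using csubst_F_S[OF i, of K] unfolding SN[OF that] .
  then have "order_ge d (csubst F (S N i) - H i)" for d
    by (rule order_ge_mono[of "2 * max N d + 3"]) auto
  then have "csubst F (S N i) - H i = 0" by (rule order_ge_all_imp_0)
  then show "csubst F (cvar i + S N i) = cvar i"
    by (simp add: csubst_add F_def)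
qed

end

section \<open>Existence of the series solutions\<close>

fun hj_sol :: "nat \<Rightarrow> nat cpoly \<Rightarrow> nat \<Rightarrow> nat cpoly" where
  "hj_sol n P 0 = P"
| "hj_sol n P (Suc k) = cconst (inverse (of_nat (2 * Suc k))) *
     (\<Sum>a\<le>k. \<Sum>i<n. pdiff i (hj_sol n P a) * pdiff i (hj_sol n P (k - a)))"

fun burgers_sol :: "nat \<Rightarrow> (nat \<Rightarrow> nat cpoly) \<Rightarrow> nat \<Rightarrow> nat \<Rightarrow> nat cpoly" where
  "burgers_sol n H 0 i = H i"
| "burgers_sol n H (Suc k) i = cconst (inverse (of_nat (Suc k))) *
     (\<Sum>a\<le>k. \<Sum>j<n. burgers_sol n H a j * pdiff j (burgers_sol n H (k - a) i))"

lemma of_nat_times_cconst_inverse: "k \<noteq> 0 \<Longrightarrow> of_nat k * (cconst (inverse (of_nat k)) * p) = p"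
proof -
  assume "k \<noteq> 0"
  then have "cconst (of_nat k * inverse (of_nat k)) = (1 :: 'a cpoly)" by simp
  then show ?thesis by (simp only: cconst_mult cconst_of_nat mult.assoc[symmetric] mult_1_left)
qed

lemma fps_nth_2_mult: "fps_nth (2 * F) k = 2 * fps_nth F k" for F :: "'a::comm_ring_1 fps"
  by (simp add: numeral_fps_const)

lemma hamilton_jacobi_solution:
  obtains Q where "hamilton_jacobi n (\<lambda>i. i) Q" "fps_nth Q 0 = P"
proof
  let ?Q = "Abs_fps (hj_sol n P)"
  show "hamilton_jacobi n (\<lambda>i. i) ?Q"
  proof
    show "2 * fps_deriv ?Q = (\<Sum>i<n. coeffwise (pdiff i) ?Q ^ 2)"
    proof (rule fps_ext)
      fix k
      have "fps_nth (2 * fps_deriv ?Q) k = of_nat 2 * fps_nth (fps_deriv ?Q) k"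
        by (simp only: fps_nth_2_mult of_nat_numeral)
      also have "\<dots> = of_nat (2 * Suc k) * hj_sol n P (Suc k)"
        by (simp only: fps_deriv_nth fps_nth_Abs_fps Suc_eq_plus1[symmetric] of_nat_mult mult.assoc)
      also have "\<dots> = (\<Sum>a\<le>k. \<Sum>i<n. pdiff i (hj_sol n P a) * pdiff i (hj_sol n P (k - a)))"
        unfolding hj_sol.simps by (rule of_nat_times_cconst_inverse) simp
      also have "\<dots> = fps_nth (\<Sum>i<n. coeffwise (pdiff i) ?Q ^ 2) k"
        by (subst sum.swap) (simp add: fps_sum_nth power2_eq_square fps_mult_nth atLeast0AtMost)
      finally show "fps_nth (2 * fps_deriv ?Q) k = fps_nth (\<Sum>i<n. coeffwise (pdiff i) ?Q ^ 2) k" .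
    qed
  qed
qed simp

lemma burgers_solution:
  "\<exists>V. burgers n (\<lambda>i. i) V \<and> (\<forall>i. fps_nth (V i) 0 = H i)"
proof (intro exI conjI allI)
  let ?V = "\<lambda>i. Abs_fps (\<lambda>k. burgers_sol n H k i)"
  show "burgers n (\<lambda>i. i) ?V"
  proof
    fix i assume "i < n"
    show "fps_deriv (?V i) = (\<Sum>j<n. ?V j * coeffwise (pdiff j) (?V i))"
    proof (rule fps_ext)
      fix k
      have "fps_nth (fps_deriv (?V i)) k = of_nat (Suc k) * burgers_sol n H (Suc k) i"
        by (simp only: fps_deriv_nth fps_nth_Abs_fps Suc_eq_plus1[symmetric])
      also have "\<dots> = (\<Sum>a\<le>k. \<Sum>j<n. burgers_sol n H a j * pdiff j (burgers_sol n H (k - a) i))"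
        unfolding burgers_sol.simps by (rule of_nat_times_cconst_inverse) simp
      also have "\<dots> = fps_nth (\<Sum>j<n. ?V j * coeffwise (pdiff j) (?V i)) k"
        by (subst sum.swap) (simp add: fps_sum_nth fps_mult_nth atLeast0AtMost)
      finally show "fps_nth (fps_deriv (?V i)) k = fps_nth (\<Sum>j<n. ?V j * coeffwise (pdiff j) (?V i)) k" .
    qed
  qed
qed simp_all

section \<open>From the Jacobian conjecture to the vanishing property\<close>

text \<open>The Hessian matrix is symmetric.\<close>

lemma (in hamilton_jacobi) gradient_burgers: "burgers n z (\<lambda>i. D i Q)"
proof
  fix i assume "i < n"
  have comm: "D i (D j F) = D j (D i F)" for j F
    by (rule fps_ext) (simp add: pdiff_commute)
  have "of_nat 2 * fps_deriv (D i Q) = D i (of_nat 2 * fps_deriv Q)"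
    by (simp only: derivation_of_nat_mult[OF derivation_D] fps_deriv_coeffwise[OF derivation_pdiff])
  also have "\<dots> = D i (\<Sum>j<n. D j Q ^ 2)" using hj by simp
  also have "\<dots> = of_nat 2 * (\<Sum>j<n. D j Q * D j (D i Q))"
    by (simp add: derivation_sum[OF derivation_D] derivation_power[OF derivation_D] comm sum_distrib_left mult.assoc)
  finally have "of_nat 2 * (fps_deriv (D i Q) - (\<Sum>j<n. D j Q * D j (D i Q))) = 0"
    by (simp only: right_diff_distrib diff_self)
  then have "fps_deriv (D i Q) - (\<Sum>j<n. D j Q * D j (D i Q)) = 0"
    by (rule of_nat_mult_fps_eq_0) simp
  then show "fps_deriv (D i Q) = (\<Sum>j<n. D j Q * D j (D i Q))" by simp
qed

text \<open>For the gradient \<open>H\<close> of a quartic form the hypothesis \<open>\<Delta>\<^sup>m P\<^sup>m = 0\<close> says that \<open>id - H\<close> has Jacobian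
  determinant \<open>1\<close>. Its polynomial inverse makes the series \<open>V = \<nabla>Q\<close> finite, and the
  Hamilton-Jacobi equation then makes \<open>Q\<close> finite.\<close>

lemma jacobian_conjecture_imp_vanishing_property:
  assumes JC: "jacobian_conjecture n" and p: "p \<in> cpolys {..<n}" "homogeneous 4 p"
  shows "vanishing_property n p"
  unfolding vanishing_property_def
proof
  assume lap: "\<forall>m\<ge>1. (laplacian n (\<lambda>i. i) ^^ m) (p ^ m) = 0"
  obtain Q where Q: "hamilton_jacobi n (\<lambda>i. i) Q" and Q0: "fps_nth Q 0 = p"
    by (rule hamilton_jacobi_solution)
  interpret q: hamilton_jacobi n "\<lambda>i. i" Q by (rule Q)
  define V where "V = (\<lambda>i. coeffwise (pdiff i) Q)"
  interpret cubic_burgers n "\<lambda>i. pdiff i p" V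
  proof (intro cubic_burgers.intro cubic_map.intro cubic_burgers_axioms.intro)
    show "burgers n (\<lambda>i. i) V" using q.gradient_burgers by (simp add: V_def)
    show "pdiff i p \<in> cpolys {..<n}" for i by (rule cpolys_pdiff[OF p(1)])
    show "homogeneous 3 (pdiff i p)" for i
      by (rule homogeneous_pdiff) (use p(2) in \<open>simp add: eval_nat_numeral\<close>)
    show "fps_nth (V i) 0 = pdiff i p" for i by (simp add: V_def Q0)
  qed
  have lapQ: "laplacian n (\<lambda>i. i) (fps_nth Q k) = 0" for k
    using lap q.laplacian_0_iff by (simp add: Q0)
  then have "(\<Sum>i<n. pdiff i (fps_nth (V i) k)) = 0" for k
    by (simp add: V_def laplacian_def)
  then have "\<forall>m\<ge>1. mat_trace (mat n n (\<lambda>(i, j). pdiff j (fps_nth (V i) 0)) ^\<^sub>m m) = 0"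
    using divergence_0_iff_traces_0 by blast
  then have "keller n F"
    unfolding keller_F_iff by (simp add: V_def Q0)
  then have "polynomial_automorphism n F"
    using JC by (simp add: jacobian_conjecture_def keller_def)
  then obtain G where G: "left_inverse_map n F G"
    by (auto simp: polynomial_automorphism_def left_inverse_map_def)
  obtain N where N: "\<And>k i. k \<ge> N \<Longrightarrow> i < n \<Longrightarrow> pdiff i (fps_nth Q k) = 0"
    using finite_if_left_inverse[OF G] unfolding V_def coeffwise_nth by blast
  \<comment> \<open>In each product of the equation one factor has index at least \<open>N\<close>.\<close>
  have "fps_nth Q k = 0" if k: "k \<ge> 2 * N + 1" for k
  proof -
    obtain l where l: "k = Suc l" using k by (cases k) auto
    have "of_nat (2 * k) * fps_nth Q k = fps_nth (2 * fps_deriv Q) l"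
      by (simp only: l fps_nth_2_mult fps_deriv_nth of_nat_mult of_nat_numeral Suc_eq_plus1[symmetric] mult.assoc)
    also have "\<dots> = (\<Sum>i<n. \<Sum>a=0..l. pdiff i (fps_nth Q a) * pdiff i (fps_nth Q (l - a)))"
      unfolding q.hj by (simp add: fps_sum_nth power2_eq_square fps_mult_nth)
    also have "\<dots> = 0"
    proof (intro sum.neutral ballI)
      fix i a assume "i \<in> {..<n}" "a \<in> {0..l}"
      then have "pdiff i (fps_nth Q a) = 0 \<or> pdiff i (fps_nth Q (l - a)) = 0"
        using N[of a i] N[of "l - a" i] k l by (cases "a \<ge> N") auto
      then show "pdiff i (fps_nth Q a) * pdiff i (fps_nth Q (l - a)) = 0" by auto
    qed
    finally show ?thesis by (rule of_nat_mult_cpoly_eq_0) (simp add: l)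
  qed
  then show "\<exists>N. \<forall>m\<ge>N. (laplacian n (\<lambda>i. i) ^^ m) (p ^ Suc m) = 0"
    using q.coeff_eq_0_iff[OF lapQ] unfolding Q0 by blast
qed

section \<open>The potential of a cubic map\<close>

context cubic_burgers
begin

abbreviation "y i \<equiv> cvar (n + i) :: nat cpoly"
text \<open>The variables \<open>z\<^sub>j\<close> and \<open>z'\<^sub>j\<close> have the indices \<open>j\<close> and \<open>n + j\<close>. Treating them as real and
  imaginary parts, \<open>holo_subst\<close> substitutes the holomorphic coordinates \<open>z + \<i> z'\<close>.\<close>

definition "holo_subst = csubst (\<lambda>j. cvar j + cconst \<i> * y j)"
definition "antiholo j = cvar j - cconst \<i> * y j"
definition "potential w = cconst (1/2) * (\<Sum>j<n. antiholo j * holo_subst (w j))"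

lemma imaginary_unit_square_mult: "cconst \<i> * (cconst \<i> * p) = - p"
  by (simp add: mult.assoc[symmetric] cconst_mult[symmetric] cconst_uminus)

lemma holo_subst_cpolys: "p \<in> cpolys {..<n} \<Longrightarrow> holo_subst p \<in> cpolys {..<2 * n}"
  unfolding holo_subst_def by (rule cpolys_csubst) (auto intro!: cpolys_add cpolys_mult)

lemma antiholo_cpolys: "j < n \<Longrightarrow> antiholo j \<in> cpolys {..<2 * n}"
  unfolding antiholo_def by (auto intro!: cpolys_diff cpolys_mult)

lemma potential_cpolys: "(\<And>j. j < n \<Longrightarrow> w j \<in> cpolys {..<n}) \<Longrightarrow> potential w \<in> cpolys {..<2 * n}"
  unfolding potential_def by (intro cpolys_mult cpolys_sum antiholo_cpolys holo_subst_cpolys) auto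

lemma homogeneous_potential:
  assumes "\<And>j. j < n \<Longrightarrow> homogeneous d (w j)"
  shows "homogeneous (Suc d) (potential w)"
proof -
  have "homogeneous 1 (cvar j + cconst \<i> * y j)" "homogeneous 1 (antiholo j)" for j
    unfolding antiholo_def by (auto intro!: homogeneous_add homogeneous_diff homogeneous_cconst_mult)
  then have "homogeneous (1 + d) (antiholo j * holo_subst (w j))" if "j < n" for j
    using assms[OF that] unfolding holo_subst_def by (intro homogeneous_mult homogeneous_csubst) auto
  then show ?thesis
    unfolding potential_def by (intro homogeneous_cconst_mult homogeneous_sum) auto
qed

lemma pdiff_holo_subst:
  assumes p: "p \<in> cpolys {..<n}" and k: "k < n"
  shows "pdiff k (holo_subst p) = holo_subst (pdiff k p)" "pdiff (n + k) (holo_subst p) = cconst \<i> * holo_subst (pdiff k p)"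
proof -
  let ?s = "\<lambda>j. cvar j + cconst \<i> * y j"
  have "(\<Sum>v<n. csubst ?s (pdiff v p) * pdiff k (?s v)) = (\<Sum>v<n. if v = k then holo_subst (pdiff v p) else 0)"
    using k by (intro sum.cong) (auto simp: holo_subst_def pdiff_add pdiff_cconst_mult pdiff_cvar)
  then show "pdiff k (holo_subst p) = holo_subst (pdiff k p)"
    using k unfolding holo_subst_def pdiff_csubst[OF finite_lessThan p] by simp
  have "(\<Sum>v<n. csubst ?s (pdiff v p) * pdiff (n + k) (?s v)) = (\<Sum>v<n. if v = k then cconst \<i> * holo_subst (pdiff v p) else 0)"
    using k by (intro sum.cong) (auto simp: holo_subst_def pdiff_add pdiff_cconst_mult pdiff_cvar)
  then show "pdiff (n + k) (holo_subst p) = cconst \<i> * holo_subst (pdiff k p)"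
    using k unfolding holo_subst_def pdiff_csubst[OF finite_lessThan p] by simp
qed

lemma pdiff_antiholo:
  assumes "j < n" "k < n"
  shows "pdiff k (antiholo j) = (if j = k then 1 else 0)" "pdiff (n + k) (antiholo j) = (if j = k then - cconst \<i> else 0)"
  using assms by (auto simp: antiholo_def pdiff_diff pdiff_cconst_mult pdiff_cvar)

lemma pdiff_potential:
  assumes w: "\<And>j. j < n \<Longrightarrow> w j \<in> cpolys {..<n}" and k: "k < n"
  shows "pdiff k (potential w) = cconst (1/2) * (holo_subst (w k) + (\<Sum>j<n. antiholo j * holo_subst (pdiff k (w j))))"
    and "pdiff (n + k) (potential w) = cconst (1/2) * (cconst \<i> * ((\<Sum>j<n. antiholo j * holo_subst (pdiff k (w j))) - holo_subst (w k)))"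
proof -
  have "pdiff k (\<Sum>j<n. antiholo j * holo_subst (w j)) = (\<Sum>j<n. (if j = k then holo_subst (w k) else 0) + antiholo j * holo_subst (pdiff k (w j)))"
    unfolding pdiff_sum by (intro sum.cong) (auto simp: pdiff_mult pdiff_antiholo pdiff_holo_subst w k)
  then show "pdiff k (potential w) = cconst (1/2) * (holo_subst (w k) + (\<Sum>j<n. antiholo j * holo_subst (pdiff k (w j))))"
    using k by (simp add: potential_def pdiff_cconst_mult sum.distrib)
  have "pdiff (n + k) (\<Sum>j<n. antiholo j * holo_subst (w j)) =
      (\<Sum>j<n. (if j = k then - (cconst \<i> * holo_subst (w k)) else 0) + cconst \<i> * (antiholo j * holo_subst (pdiff k (w j))))"
    unfolding pdiff_sum by (intro sum.cong) (auto simp: pdiff_mult pdiff_antiholo pdiff_holo_subst w k)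
  then show "pdiff (n + k) (potential w) = cconst (1/2) * (cconst \<i> * ((\<Sum>j<n. antiholo j * holo_subst (pdiff k (w j))) - holo_subst (w k)))"
    using k by (simp add: potential_def pdiff_cconst_mult sum.distrib sum_distrib_left[symmetric] right_diff_distrib)
qed

lemma sum_double: "(\<Sum>k<2 * n. f k) = (\<Sum>k<n. f k + f (n + k))" for f :: "nat \<Rightarrow> 'b::comm_monoid_add"
proof -
  have "(\<Sum>k<2 * n. f k) = (\<Sum>k<n. f k) + (\<Sum>k=n..<n + n. f k)"
    by (simp add: mult_2 sum.atLeastLessThan_concat lessThan_atLeast0)
  also have "(\<Sum>k=n..<n + n. f k) = (\<Sum>k<n. f (n + k))"
    using sum.shift_bounds_nat_ivl[of f 0 n n] by (simp add: lessThan_atLeast0 add.commute)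
  finally show ?thesis by (simp add: sum.distrib)
qed

text \<open>\<open>\<Delta>\<close> is four times the mixed derivative in \<open>z + \<i> z'\<close> and \<open>z - \<i> z'\<close>, and the potential is linear in the
  latter.\<close>

lemma laplacian_potential:
  assumes w: "\<And>j. j < n \<Longrightarrow> w j \<in> cpolys {..<n}"
  shows "laplacian (2 * n) (\<lambda>i. i) (potential w) = 2 * holo_subst (\<Sum>k<n. pdiff k (w k))"
proof -
  have "pdiff k (pdiff k (potential w)) + pdiff (n + k) (pdiff (n + k) (potential w)) = 2 * holo_subst (pdiff k (w k))"
    if k: "k < n" for k
  proof -
    let ?c = "cconst (1/2)"
    let ?a = "holo_subst (pdiff k (w k))" and ?b = "\<Sum>j<n. antiholo j * holo_subst (pdiff k (pdiff k (w j)))"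
    have w': "pdiff k (w j) \<in> cpolys {..<n}" if "j < n" for j using w[OF that] by auto
    have 1: "pdiff k (\<Sum>j<n. antiholo j * holo_subst (pdiff k (w j))) = ?a + ?b"
    proof -
      have "pdiff k (\<Sum>j<n. antiholo j * holo_subst (pdiff k (w j))) =
          (\<Sum>j<n. (if j = k then ?a else 0) + antiholo j * holo_subst (pdiff k (pdiff k (w j))))"
        unfolding pdiff_sum by (intro sum.cong) (auto simp: pdiff_mult pdiff_antiholo pdiff_holo_subst w' k)
      then show ?thesis using k by (simp add: sum.distrib)
    qed
    have 2: "pdiff (n + k) (\<Sum>j<n. antiholo j * holo_subst (pdiff k (w j))) = cconst \<i> * (?b - ?a)"
    proof -
      have "pdiff (n + k) (\<Sum>j<n. antiholo j * holo_subst (pdiff k (w j))) =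
          (\<Sum>j<n. (if j = k then - (cconst \<i> * ?a) else 0) + cconst \<i> * (antiholo j * holo_subst (pdiff k (pdiff k (w j)))))"
        unfolding pdiff_sum by (intro sum.cong) (auto simp: pdiff_mult pdiff_antiholo pdiff_holo_subst w' k)
      then show ?thesis using k by (simp add: sum.distrib sum_distrib_left[symmetric] right_diff_distrib)
    qed
    have "pdiff k (pdiff k (potential w)) = ?c * (?a + (?a + ?b))"
      using k by (simp add: pdiff_potential w pdiff_cconst_mult pdiff_add pdiff_holo_subst 1)
    moreover have "pdiff (n + k) (pdiff (n + k) (potential w)) = ?c * (cconst \<i> * (cconst \<i> * (?b - ?a) - cconst \<i> * ?a))"
      using k by (simp add: pdiff_potential w pdiff_cconst_mult pdiff_diff pdiff_holo_subst 2)
    moreover have "cconst \<i> * (cconst \<i> * (b - a) - cconst \<i> * a) = a + a - b" for a b :: "nat cpoly"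
      by (simp only: right_diff_distrib imaginary_unit_square_mult) simp
    ultimately have "pdiff k (pdiff k (potential w)) + pdiff (n + k) (pdiff (n + k) (potential w)) =
        ?c * ((?a + (?a + ?b)) + (?a + ?a - ?b))"
      by (simp only: distrib_left)
    also have "\<dots> = ?c * (cconst 4 * ?a)" by simp
    also have "\<dots> = 2 * ?a" by (simp only: mult.assoc[symmetric] cconst_mult[symmetric]) simp
    finally show ?thesis .
  qed
  then show ?thesis
    by (simp add: laplacian_def sum_double holo_subst_def csubst_sum sum_distrib_left)
qed

lemma holo_subst_injective: "p \<in> cpolys {..<n} \<Longrightarrow> holo_subst p = 0 \<Longrightarrow> p = 0"
proof -
  assume p: "p \<in> cpolys {..<n}" and "holo_subst p = 0"
  then have "csubst (\<lambda>j. if j < n then cvar j else 0) (holo_subst p) = 0" by simp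
  moreover have "csubst (\<lambda>j. if j < n then cvar j else 0) (holo_subst p) = csubst cvar p"
    unfolding holo_subst_def csubst_csubst by (rule csubst_cong[OF p]) (auto simp: csubst_add csubst_mult)
  ultimately show "p = 0" by (simp add: csubst_cvar_id)
qed

definition "Q = Abs_fps (\<lambda>k. potential (v k))"

text \<open>With \<open>a\<^sub>k = V\<^sub>k (z + \<i> z')\<close> and \<open>b\<^sub>k = \<Sum> (z\<^sub>j - \<i> z'\<^sub>j) (\<partial>\<^sub>k V\<^sub>j) (z + \<i> z')\<close> the two
  derivatives of \<open>Q\<close> of index \<open>k\<close> are \<open>(a\<^sub>k + b\<^sub>k) / 2\<close> and \<open>\<i> (b\<^sub>k - a\<^sub>k) / 2\<close>. Their squares add up
  to \<open>a\<^sub>k b\<^sub>k\<close>, which sums to the right-hand side of the Burgers equation.\<close>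

lemma Q_hamilton_jacobi: "hamilton_jacobi (2 * n) (\<lambda>i. i) Q"
proof
  let ?holo_subst = "coeffwise holo_subst"
  let ?a = "\<lambda>k. ?holo_subst (V k)" and ?b = "\<lambda>k. \<Sum>j<n. fps_const (antiholo j) * ?holo_subst (D k (V j))"
  have vc: "v k j \<in> cpolys {..<n}" if "j < n" for k j using v_cpolys[OF that] .
  have holo_subst_mult: "?holo_subst (F * G) = ?holo_subst F * ?holo_subst G" for F G
    by (rule fps_ext) (simp add: fps_mult_nth holo_subst_def csubst_sum csubst_mult)
  have holo_subst_sum: "?holo_subst (sum F S) = (\<Sum>x\<in>S. ?holo_subst (F x))" for F :: "nat \<Rightarrow> _" and S
    by (rule fps_ext) (simp add: fps_sum_nth holo_subst_def csubst_sum)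
  have D1: "coeffwise (pdiff k) Q = fps_const (cconst (1/2)) * (?a k + ?b k)" if "k < n" for k
    by (rule fps_ext) (simp add: Q_def pdiff_potential vc that fps_sum_nth)
  have D2: "coeffwise (pdiff (n + k)) Q = fps_const (cconst (1/2)) * (fps_const (cconst \<i>) * (?b k - ?a k))" if "k < n" for k
    by (rule fps_ext) (simp add: Q_def pdiff_potential vc that fps_sum_nth)
  have sq: "coeffwise (pdiff k) Q ^ 2 + coeffwise (pdiff (n + k)) Q ^ 2 = ?a k * ?b k" if "k < n" for k
  proof -
    have ii: "fps_const (cconst \<i>) ^ 2 = (-1 :: nat cpoly fps)"
      by (simp add: power2_eq_square fps_const_mult cconst_mult[symmetric] cconst_uminus fps_const_neg[symmetric] del: fps_const_neg)
    have hh: "4 * fps_const (cconst (1/2)) ^ 2 = (1 :: nat cpoly fps)"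
    proof -
      have "4 * fps_const (cconst (1/2)) ^ 2 = fps_const (cconst 4 * (cconst (1/2) * cconst (1/2)) :: nat cpoly)"
        by (simp add: power2_eq_square numeral_fps_const)
      also have "\<dots> = 1" by (simp only: cconst_mult[symmetric]) simp
      finally show ?thesis .
    qed
    have gen: "(c * (a + b)) ^ 2 + (c * (i * (b - a))) ^ 2 = (4 * c ^ 2) * (a * b)"
      if "i ^ 2 = -1" for a b c i :: "nat cpoly fps"
      using that by (simp add: power_mult_distrib) (simp add: power2_eq_square algebra_simps)
    show ?thesis unfolding D1[OF that] D2[OF that] gen[OF ii] hh by simp
  qed
  have "(\<Sum>k<2 * n. coeffwise (pdiff k) Q ^ 2) = (\<Sum>k<n. ?a k * ?b k)"
    unfolding sum_double by (intro sum.cong refl sq) simp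
  also have "\<dots> = (\<Sum>j<n. fps_const (antiholo j) * ?holo_subst (\<Sum>k<n. V k * D k (V j)))"
    unfolding holo_subst_sum holo_subst_mult sum_distrib_left by (subst sum.swap) (simp add: ac_simps)
  also have "\<dots> = (\<Sum>j<n. fps_const (antiholo j) * ?holo_subst (fps_deriv (V j)))"
    by (intro sum.cong refl) (simp add: burgers)
  also have "\<dots> = 2 * fps_deriv Q"
  proof (rule fps_ext)
    fix k
    have h: "2 * (cconst (1/2) * p) = (p :: nat cpoly)" for p
      using of_nat_times_cconst_inverse[of 2 p] by (simp add: inverse_eq_divide)
    have "csubst s (of_nat l) = of_nat l" for s :: "nat \<Rightarrow> nat cpoly" and l
      using csubst_cconst[of s "of_nat l"] by (simp only: cconst_of_nat)
    then have holo_subst_nat: "holo_subst (of_nat l * p) = of_nat l * holo_subst p" for l p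
      by (simp add: holo_subst_def csubst_mult)
    have "fps_nth (\<Sum>j<n. fps_const (antiholo j) * ?holo_subst (fps_deriv (V j))) k =
        of_nat (Suc k) * (\<Sum>j<n. antiholo j * holo_subst (v (Suc k) j))"
      unfolding fps_sum_nth fps_mult_left_const_nth coeffwise_nth fps_deriv_nth holo_subst_nat
        sum_distrib_left Suc_eq_plus1[symmetric]
      by (simp only: mult.left_commute)
    also have "\<dots> = 2 * (of_nat (Suc k) * potential (v (Suc k)))"
      unfolding potential_def mult.left_commute[of "of_nat (Suc k)" "cconst (1/2)"] h ..
    finally show "fps_nth (\<Sum>j<n. fps_const (antiholo j) * ?holo_subst (fps_deriv (V j))) k = fps_nth (2 * fps_deriv Q) k"
      by (simp add: Q_def fps_nth_2_mult)
  qed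
  finally show "2 * fps_deriv Q = (\<Sum>k<2 * n. coeffwise (pdiff k) Q ^ 2)" by simp
qed

text \<open>The Jacobian determinant \<open>1\<close> makes \<open>V\<close> free of divergence and hence \<open>Q\<close> harmonic, which is the
  hypothesis of the vanishing property. Its conclusion makes \<open>Q\<close> finite, and \<open>V\<close> is
  recovered from the derivatives of \<open>Q\<close>.\<close>

lemma finite_if_vanishing_property:
  assumes VP: "\<And>p. p \<in> cpolys {..<2 * n} \<Longrightarrow> homogeneous 4 p \<Longrightarrow> vanishing_property (2 * n) p"
    and K: "keller n F"
  shows "\<exists>N. \<forall>k\<ge>N. \<forall>i<n. v k i = 0"
proof -
  interpret q: hamilton_jacobi "2 * n" "\<lambda>i. i" Q by (rule Q_hamilton_jacobi)
  have P: "q.P \<in> cpolys {..<2 * n}" "homogeneous 4 q.P"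
    using potential_cpolys[of "v 0"] homogeneous_potential[of 3 "v 0"] v_cpolys v_homogeneous[of _ 0]
    by (simp_all add: Q_def)
  have "mat n n (\<lambda>(i, j). pdiff j (fps_nth (V i) 0)) = mat n n (\<lambda>(i, j). pdiff j (H i))"
    by (intro eq_matI) (auto simp: V_0)
  then have div: "(\<Sum>i<n. pdiff i (v k i)) = 0" for k
    using K divergence_0_iff_traces_0 unfolding keller_F_iff by simp
  have lapQ: "q.lap (fps_nth Q k) = 0" for k
    by (simp add: Q_def laplacian_potential v_cpolys div) (simp add: holo_subst_def)
  then have "\<forall>m\<ge>1. (q.lap ^^ m) (q.P ^ m) = 0"
    using q.laplacian_0_iff by blast
  then obtain N where "\<forall>m\<ge>N. (q.lap ^^ m) (q.P ^ Suc m) = 0"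
    using VP[OF P] unfolding vanishing_property_def by blast
  then have N: "potential (v k) = 0" if "k \<ge> N" for k
    using q.coeff_eq_0_iff[OF lapQ, of k] that by (simp add: Q_def)
  have "v k i = 0" if k: "k \<ge> N" and i: "i < n" for k i
  proof -
    \<comment> \<open>The operator \<open>\<partial>/\<partial>z\<^sub>i + \<i> \<partial>/\<partial>z'\<^sub>i\<close> kills the holomorphic factors of the potential.\<close>
    let ?b = "\<Sum>j<n. antiholo j * holo_subst (pdiff i (v k j))"
    have "pdiff i (potential (v k)) + cconst \<i> * pdiff (n + i) (potential (v k)) =
        cconst (1/2) * (holo_subst (v k i) + ?b) - cconst (1/2) * (?b - holo_subst (v k i))"
      using i by (simp add: pdiff_potential v_cpolys imaginary_unit_square_mult mult.left_commute[of "cconst \<i>" "cconst (1/2)"])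
        (simp add: right_diff_distrib)
    also have "\<dots> = cconst (1/2) * (cconst 2 * holo_subst (v k i))"
      by (simp add: right_diff_distrib[symmetric])
    also have "\<dots> = holo_subst (v k i)"
      by (simp only: mult.assoc[symmetric] cconst_mult[symmetric]) simp
    finally have "holo_subst (v k i) = 0" using N[OF k] by simp
    then show ?thesis by (rule holo_subst_injective[OF v_cpolys[OF i]])
  qed
  then show ?thesis by blast
qed

end

lemma vanishing_imp_cubic_left_inverse:
  assumes VP: "\<And>p. p \<in> cpolys {..<2 * n} \<Longrightarrow> homogeneous 4 p \<Longrightarrow> vanishing_property (2 * n) p"
    and H: "cubic_map n H" and K: "keller n (cubic_map.F H)"
  shows "\<exists>G. left_inverse_map n (cubic_map.F H) G"
proof -
  obtain V where V: "burgers n (\<lambda>i. i) V" "\<And>i. fps_nth (V i) 0 = H i"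
    using burgers_solution[of n H] by blast
  interpret cubic_burgers n H V
    by (intro cubic_burgers.intro cubic_burgers_axioms.intro H V)
  obtain N where "\<forall>k\<ge>N. \<forall>i<n. v k i = 0"
    using finite_if_vanishing_property[OF VP K] by blast
  then show ?thesis using left_inverse_if_finite by blast
qed

section \<open>Determinants of extended Jacobian matrices\<close>

text \<open>The Schur complement of the identity block.\<close>

lemma det_four_block_one:
  fixes A :: "'a::idom mat"
  assumes A: "A \<in> carrier_mat n n" and X: "X \<in> carrier_mat n k" and Y: "Y \<in> carrier_mat k n"
  shows "det (four_block_mat A X Y (1\<^sub>m k)) = det (A - X * Y)"
proof -
  have XY: "X * Y \<in> carrier_mat n n" using X Y by simp
  have "four_block_mat (A - X * Y) X (0\<^sub>m k n) (1\<^sub>m k) * four_block_mat (1\<^sub>m n) (0\<^sub>m n k) Y (1\<^sub>m k) =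
      four_block_mat ((A - X * Y) * 1\<^sub>m n + X * Y) ((A - X * Y) * 0\<^sub>m n k + X * 1\<^sub>m k)
        (0\<^sub>m k n * 1\<^sub>m n + 1\<^sub>m k * Y) (0\<^sub>m k n * 0\<^sub>m n k + 1\<^sub>m k * 1\<^sub>m k)"
    using A X Y XY by (intro mult_four_block_mat[where ?n1.0 = n and ?n2.0 = k]) auto
  also have "(A - X * Y) * 1\<^sub>m n = A - X * Y"
    by (rule right_mult_one_mat[OF minus_carrier_mat[OF XY]])
  also have "A - X * Y + X * Y = A"
  proof -
    have "A - W + W = A" if "W \<in> carrier_mat n n" for W
      using A that by (intro eq_matI) auto
    then show ?thesis using XY .
  qed
  also have "(A - X * Y) * 0\<^sub>m n k + X * 1\<^sub>m k = X"
    using X right_mult_zero_mat[OF minus_carrier_mat[OF XY, of A]] by simp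
  also have "0\<^sub>m k n * 1\<^sub>m n + 1\<^sub>m k * Y = Y" using Y by simp
  also have "0\<^sub>m k n * 0\<^sub>m n k + 1\<^sub>m k * 1\<^sub>m k = (1\<^sub>m k :: 'a mat)" by simp
  finally have "four_block_mat A X Y (1\<^sub>m k) =
      four_block_mat (A - X * Y) X (0\<^sub>m k n) (1\<^sub>m k) * four_block_mat (1\<^sub>m n) (0\<^sub>m n k) Y (1\<^sub>m k)" by simp
  moreover have "det (four_block_mat (A - X * Y) X (0\<^sub>m k n) (1\<^sub>m k)) = det (A - X * Y) * det (1\<^sub>m k)"
    by (rule det_four_block_mat_lower_left_zero[OF minus_carrier_mat[OF XY] X refl one_carrier_mat])
  moreover have "det (four_block_mat (1\<^sub>m n) (0\<^sub>m n k) Y (1\<^sub>m k)) = det (1\<^sub>m n) * det (1\<^sub>m k :: 'a mat)"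
    by (rule det_four_block_mat_upper_right_zero[OF one_carrier_mat refl Y one_carrier_mat])
  moreover have "det (four_block_mat (A - X * Y) X (0\<^sub>m k n) (1\<^sub>m k) * four_block_mat (1\<^sub>m n) (0\<^sub>m n k) Y (1\<^sub>m k)) =
      det (four_block_mat (A - X * Y) X (0\<^sub>m k n) (1\<^sub>m k)) * det (four_block_mat (1\<^sub>m n) (0\<^sub>m n k) Y (1\<^sub>m k))"
    by (rule det_mult[OF four_block_carrier_mat[OF minus_carrier_mat[OF XY] one_carrier_mat]
          four_block_carrier_mat[OF one_carrier_mat one_carrier_mat]])
  ultimately show ?thesis by simp
qed

text \<open>Both reductions below append coordinates that depend on the new variables through the identity, so
  that their Jacobian determinants reduce to the original size by the Schur complement.\<close>

lemma det_jacobian_extended: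
  assumes "\<And>l l'. l < k \<Longrightarrow> l' < k \<Longrightarrow> pdiff (n + l') (F (n + l)) = (if l = l' then 1 else 0)"
  shows "det (jacobian_matrix (n + k) F) =
    det (mat n n (\<lambda>(i, j). pdiff j (F i) - (\<Sum>l<k. pdiff (n + l) (F i) * pdiff j (F (n + l)))))"
proof -
  let ?A = "mat n n (\<lambda>(i, j). pdiff j (F i))"
  let ?X = "mat n k (\<lambda>(i, l). pdiff (n + l) (F i))" and ?Y = "mat k n (\<lambda>(l, j). pdiff j (F (n + l)))"
  have "jacobian_matrix (n + k) F = four_block_mat ?A ?X ?Y (1\<^sub>m k)"
  proof (rule eq_matI)
    fix i j assume "i < dim_row (four_block_mat ?A ?X ?Y (1\<^sub>m k))" "j < dim_col (four_block_mat ?A ?X ?Y (1\<^sub>m k))"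
    then show "jacobian_matrix (n + k) F $$ (i, j) = four_block_mat ?A ?X ?Y (1\<^sub>m k) $$ (i, j)"
      using assms[of "i - n" "j - n"] eq_diff_iff[of n i j]
      by (cases "i < n"; cases "j < n") (simp_all add: jacobian_matrix_def)
  qed (auto simp: jacobian_matrix_def)
  also have "det \<dots> = det (?A - ?X * ?Y)"
    by (rule det_four_block_one) auto
  also have "?A - ?X * ?Y = mat n n (\<lambda>(i, j). pdiff j (F i) - (\<Sum>l<k. pdiff (n + l) (F i) * pdiff j (F (n + l))))"
    by (intro eq_matI) (auto simp: scalar_prod_def atLeast0LessThan)
  finally show ?thesis .
qed

section \<open>Reduction to degree three\<close>

text \<open>Chosen so that replacing one monomial of degree \<open>d \<ge> 4\<close> by two of degrees \<open>d - 1\<close> and \<open>d - 2\<close>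
  decreases the weight.\<close>

definition weight :: "nat cpoly \<Rightarrow> nat" where
  "weight p = (\<Sum>m\<in>{m \<in> Poly_Mapping.keys p. 4 \<le> mdeg m}. 2 ^ mdeg m)"

lemma weight_add: "weight (p + q) \<le> weight p + weight q"
proof -
  let ?A = "{m \<in> Poly_Mapping.keys p. 4 \<le> mdeg m}" and ?B = "{m \<in> Poly_Mapping.keys q. 4 \<le> mdeg m}"
  let ?f = "\<lambda>m. 2 ^ mdeg m :: nat"
  have "{m \<in> Poly_Mapping.keys (p + q). 4 \<le> mdeg m} \<subseteq> ?A \<union> ?B"
    using keys_add[of p q] by blast
  then have "weight (p + q) \<le> sum ?f (?A \<union> ?B)"
    unfolding weight_def by (rule sum_mono2[rotated]) simp_all
  also have "\<dots> \<le> sum ?f (?A \<union> ?B) + sum ?f (?A \<inter> ?B)" by simp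
  also have "\<dots> = weight p + weight q"
    unfolding weight_def by (rule sum.union_inter) simp_all
  finally show ?thesis .
qed

lemma weight_uminus [simp]: "weight (- p) = weight p"
  by (simp add: weight_def in_keys_iff)

lemma weight_diff: "weight (p - q) \<le> weight p + weight q"
  using weight_add[of p "- q"] by simp

lemma weight_single: "weight (Poly_Mapping.single m c) \<le> (if 4 \<le> mdeg m then 2 ^ mdeg m else 0)"
proof -
  have "weight (Poly_Mapping.single m c) \<le> (\<Sum>k\<in>(if 4 \<le> mdeg m then {m} else {}). 2 ^ mdeg k)"
    unfolding weight_def by (intro sum_mono2) auto
  then show ?thesis by (auto split: if_splits)
qed

lemma weight_remove:
  assumes "m \<in> Poly_Mapping.keys p" "4 \<le> mdeg m"
  shows "weight (p - Poly_Mapping.single m (lkp p m)) + 2 ^ mdeg m = weight p"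
proof -
  have "{k \<in> Poly_Mapping.keys (p - Poly_Mapping.single m (lkp p m)). 4 \<le> mdeg k} =
      {k \<in> Poly_Mapping.keys p. 4 \<le> mdeg k} - {m}"
    by (auto simp: in_keys_iff lookup_minus lookup_single when_def split: if_splits)
  then show ?thesis
    unfolding weight_def using assms
    by (subst (2) sum.remove[of _ m]) auto
qed

text \<open>A monomial of degree at least four in the component \<open>F\<^sub>i\<close> is a product \<open>A B\<close> with \<open>A\<close> of degree two.
  With new variables \<open>y, z\<close>, the map with components \<open>y + A\<close>, \<open>z + B\<close> and \<open>F\<^sub>i - (y + A) (z + B)\<close> has the
  same Jacobian determinant, and the monomial is replaced by \<open>- y B\<close> and \<open>B\<close>, whose degrees are
  lower by one and two, and by terms of degree at most three. The original map is recovered on \<open>y = - A\<close>, \<open>z = - B\<close>.\<close>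

lemma degree_reduction:
  assumes "keller n F"
  shows "\<exists>m F'. n \<le> m \<and> keller m F' \<and> (\<forall>i<m. \<forall>k\<in>Poly_Mapping.keys (F' i). mdeg k \<le> 3) \<and>
    ((\<exists>G. left_inverse_map m F' G) \<longrightarrow> (\<exists>G. left_inverse_map n F G))"
  using assms
proof (induction "\<Sum>i<n. weight (F i)" arbitrary: n F rule: less_induct)
  case less
  show ?case
  proof (cases "\<forall>i<n. \<forall>k\<in>Poly_Mapping.keys (F i). mdeg k \<le> 3")
    case True
    then show ?thesis using less.prems by blast
  next
    case False
    then obtain i m where i: "i < n" and m: "m \<in> Poly_Mapping.keys (F i)" "4 \<le> mdeg m"
      by (metis not_less_eq_eq numeral_3_eq_3 eval_nat_numeral(2) semiring_norm(26,27))
    have pF: "F j \<in> cpolys {..<n}" if "j < n" for j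
      using less.prems that by (auto simp: keller_def polynomial_map_def)
    then have mV: "Poly_Mapping.keys m \<subseteq> {..<n}" using m(1) i by (auto simp: cpolys_def)
    have split: "\<exists>u k. m = mvar u + k \<and> u < n \<and> Poly_Mapping.keys k \<subseteq> {..<n} \<and> mdeg k = mdeg m - 1"
      if "mdeg m > 0" "Poly_Mapping.keys m \<subseteq> {..<n}" for m :: "nat \<Rightarrow>\<^sub>0 nat"
    proof -
      have "m \<noteq> 0" using that by auto
      then obtain v where v: "lkp m v \<noteq> 0" by (metis lookup_zero poly_mapping_eqI)
      let ?k = "m - mvar v"
      have e: "m = mvar v + ?k" using minus_mvar_add[OF v] by (simp add: add.commute)
      moreover have "mdeg ?k = mdeg m - 1" using mdeg_add[of "mvar v" ?k] e by simp
      moreover have "Poly_Mapping.keys ?k \<subseteq> {..<n}" using that(2) e keys_add_nat[of "mvar v" ?k] by auto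
      moreover have "v < n" using v that(2) by (metis in_keys_iff lessThan_iff subsetD)
      ultimately show ?thesis by blast
    qed
    obtain u k1 where 1: "m = mvar u + k1" "u < n" "Poly_Mapping.keys k1 \<subseteq> {..<n}" "mdeg k1 = mdeg m - 1"
      using split[of m] m(2) mV by auto
    obtain w k where 2: "k1 = mvar w + k" "w < n" "Poly_Mapping.keys k \<subseteq> {..<n}" "mdeg k = mdeg k1 - 1"
      using split[of k1] m(2) 1 by auto
    have k: "mdeg m = mdeg k + 2" using 1 2 m(2) by simp
    define c where "c = lkp (F i) m"
    define A where "A = Poly_Mapping.single (mvar u + mvar w) (1::complex)"
    define B where "B = Poly_Mapping.single k c"
    define p where "p = F i - Poly_Mapping.single m c"
    have AB: "A * B = Poly_Mapping.single m c" by (simp add: A_def B_def 1 2 mult_single add.assoc)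
    have Fi: "F i = p + A * B" by (simp add: p_def AB)
    have cp: "A \<in> cpolys {..<n}" "B \<in> cpolys {..<n}" "p \<in> cpolys {..<n}"
    proof -
      show A: "A \<in> cpolys {..<n}" using 1 2 by (auto simp: A_def cpolys_def keys_add_nat)
      show B: "B \<in> cpolys {..<n}" using 2 by (auto simp: B_def cpolys_def)
      have "p = F i - A * B" by (simp add: Fi)
      then show "p \<in> cpolys {..<n}" using pF[OF i] A B by auto
    qed
    let ?y = "cvar n :: nat cpoly" and ?z = "cvar (n + 1) :: nat cpoly"
    define F' where "F' v = (if v = i then p - ?y * ?z - ?y * B - ?z * A else if v < n then F v
      else if v = n then ?y + A else ?z + B)" for v
    have F'_simps: "F' i = p - ?y * ?z - ?y * B - ?z * A" "F' n = ?y + A" "F' (Suc n) = ?z + B"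
      "\<And>v. v < n \<Longrightarrow> v \<noteq> i \<Longrightarrow> F' v = F v"
      using i by (auto simp: F'_def)
    have d0: "pdiff v q = 0" if "q \<in> cpolys {..<n}" "n \<le> v" for v q
      using pdiff_eq_0_notin[OF that(1)] that(2) by simp
    have poly: "polynomial_map (n + 2) F'"
      unfolding polynomial_map_def
    proof (intro allI impI)
      fix v assume "v < n + 2"
      have mono: "q \<in> cpolys {..<n + 2}" if "q \<in> cpolys {..<n}" for q
        using that by (rule cpolys_mono) auto
      show "F' v \<in> cpolys {..<n + 2}"
        unfolding F'_def using mono[OF cp(1)] mono[OF cp(2)] mono[OF cp(3)] mono[OF pF]
        by (auto intro!: cpolys_diff cpolys_add cpolys_mult)
    qed
    have "det (jacobian_matrix (n + 2) F') = det (mat n n (\<lambda>(a, j). pdiff j (F' a) -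
        (\<Sum>l<2. pdiff (n + l) (F' a) * pdiff j (F' (n + l)))))"
    proof (rule det_jacobian_extended)
      fix l l' :: nat assume "l < 2" "l' < 2"
      then show "pdiff (n + l') (F' (n + l)) = (if l = l' then 1 else 0)"
        by (auto simp: less_2_cases_iff F'_simps pdiff_add pdiff_cvar d0[OF cp(1)] d0[OF cp(2)])
    qed
    also have "mat n n (\<lambda>(a, j). pdiff j (F' a) - (\<Sum>l<2. pdiff (n + l) (F' a) * pdiff j (F' (n + l)))) = jacobian_matrix n F"
    proof (rule eq_matI)
      fix a j assume "a < dim_row (jacobian_matrix n F)" "j < dim_col (jacobian_matrix n F)"
      then have aj: "a < n" "j < n" by (auto simp: jacobian_matrix_def)
      have "pdiff j (F' a) - (pdiff n (F' a) * pdiff j (F' n) + pdiff (Suc n) (F' a) * pdiff j (F' (Suc n))) = pdiff j (F a)"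
      proof (cases "a = i")
        case True
        have eqs: "pdiff j (F' i) = pdiff j p - ?y * pdiff j B - ?z * pdiff j A"
          "pdiff n (F' i) = - ?z - B" "pdiff (Suc n) (F' i) = - ?y - A"
          "pdiff j (F' n) = pdiff j A" "pdiff j (F' (Suc n)) = pdiff j B"
          using aj by (simp_all add: F'_simps pdiff_diff pdiff_add pdiff_mult pdiff_cvar d0 cp)
        show ?thesis unfolding True eqs Fi pdiff_add pdiff_mult by (simp add: algebra_simps)
      next
        case False
        then show ?thesis using aj pF[OF aj(1)] by (simp add: F'_simps d0)
      qed
      then show "mat n n (\<lambda>(a, j). pdiff j (F' a) - (\<Sum>l<2. pdiff (n + l) (F' a) * pdiff j (F' (n + l)))) $$ (a, j) =
          jacobian_matrix n F $$ (a, j)"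
        using aj by (simp add: jacobian_matrix_def numeral_2_eq_2)
    qed (auto simp: jacobian_matrix_def)
    finally have K': "keller (n + 2) F'"
      using poly less.prems by (simp add: keller_def)
    have "(\<Sum>v<n + 2. weight (F' v)) < (\<Sum>v<n. weight (F v))"
    proof -
      have wp: "weight p + 2 ^ mdeg m = weight (F i)"
        unfolding p_def c_def by (rule weight_remove[OF m])
      have w1: "weight (?y * ?z) = 0" using weight_single[of "mvar n + mvar (n + 1)" 1]
        by (simp add: cvar_altdef mult_single mdeg_add)
      have w2: "weight (?y * B) \<le> 2 ^ (mdeg k + 1)"
        using weight_single[of "mvar n + k" c] by (simp add: B_def cvar_times_single mdeg_add split: if_splits)
      have w3: "weight (?z * A) = 0"
        using weight_single[of "mvar (n + 1) + (mvar u + mvar w)" 1] by (simp add: A_def cvar_times_single mdeg_add)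
      have "weight (F' i) \<le> weight p + weight (?y * ?z) + weight (?y * B) + weight (?z * A)"
        unfolding F'_simps using weight_diff[of "p - ?y * ?z - ?y * B" "?z * A"]
          weight_diff[of "p - ?y * ?z" "?y * B"] weight_diff[of p "?y * ?z"] by linarith
      then have wi: "weight (F' i) \<le> weight p + 2 ^ (mdeg k + 1)" using w1 w2 w3 by linarith
      have wn: "weight (F' n) = 0"
        using weight_add[of ?y A] weight_single[of "mvar n" 1] weight_single[of "mvar u + mvar w" 1]
        by (simp add: F'_simps A_def cvar_altdef mdeg_add)
      have "weight (F' (Suc n)) \<le> weight ?z + weight B" unfolding F'_simps by (rule weight_add)
      moreover have "weight ?z = 0" using weight_single[of "mvar (n + 1)" 1] by (simp add: cvar_altdef)
      moreover have "weight B \<le> 2 ^ mdeg k" using weight_single[of k c] by (simp add: B_def split: if_splits)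
      ultimately have wSn: "weight (F' (Suc n)) \<le> 2 ^ mdeg k" by simp
      have rest: "(\<Sum>v\<in>{..<n} - {i}. weight (F' v)) = (\<Sum>v\<in>{..<n} - {i}. weight (F v))"
        by (intro sum.cong) (auto simp: F'_simps)
      have "(\<Sum>v<n + 2. weight (F' v)) = weight (F' i) + (\<Sum>v\<in>{..<n} - {i}. weight (F v)) + weight (F' (Suc n))"
        using i by (simp add: wn rest[symmetric] sum.remove[of "{..<n}" i])
      moreover have "(\<Sum>v<n. weight (F v)) = weight (F i) + (\<Sum>v\<in>{..<n} - {i}. weight (F v))"
        using i by (simp add: sum.remove[of "{..<n}" i])
      moreover have "(2::nat) ^ (mdeg k + 1) + 2 ^ mdeg k < 2 ^ mdeg m" by (simp add: k)
      ultimately show ?thesis using wi wSn wp by linarith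
    qed
    from less.hyps[OF this K'] obtain m' F'' where
      R: "n + 2 \<le> m'" "keller m' F''" "\<forall>i<m'. \<forall>k\<in>Poly_Mapping.keys (F'' i). mdeg k \<le> 3"
      "(\<exists>G. left_inverse_map m' F'' G) \<longrightarrow> (\<exists>G. left_inverse_map (n + 2) F' G)" by blast
    have "\<exists>G. left_inverse_map n F G" if "left_inverse_map (n + 2) F' K" for K
    proof (rule left_inverse_transfer[OF that])
      define \<sigma> where "\<sigma> v = (if v < n then cvar v else if v = n then - A else - B)" for v
      define \<tau> :: "nat \<Rightarrow> nat cpoly" where "\<tau> v = (if v < n then cvar v else 0)" for v
      have id: "csubst \<sigma> q = q" if "q \<in> cpolys {..<n}" for q
        using csubst_cong[OF that, of \<sigma> cvar] by (simp add: \<sigma>_def csubst_cvar_id)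
      have sy: "\<sigma> n = - A" "\<sigma> (Suc n) = - B" by (auto simp: \<sigma>_def)
      show "csubst \<sigma> (F' v) = csubst F (\<tau> v)" if "v < n + 2" for v
      proof -
        consider "v = i" | "v < n" "v \<noteq> i" | "v = n" | "v = Suc n" using \<open>v < n + 2\<close> by linarith
        then show ?thesis
        proof cases
          case 1
          then show ?thesis using i
            by (simp add: F'_simps \<tau>_def csubst_diff csubst_mult sy id cp Fi)
        qed (auto simp: F'_simps \<tau>_def csubst_add sy id cp pF)
      qed
      show "\<sigma> j = cvar j" if "j < n" for j using that by (simp add: \<sigma>_def)
      show "\<tau> v \<in> cpolys {..<n}" for v by (simp add: \<tau>_def)
    qed simp
    then show ?thesis using R by (metis add_leD1)
  qed
qed

section \<open>Normalisation at the origin\<close>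

definition homogeneous_part :: "nat \<Rightarrow> 'v cpoly \<Rightarrow> 'v cpoly" where
  "homogeneous_part d p = (\<Sum>m\<in>{m \<in> Poly_Mapping.keys p. mdeg m = d}. Poly_Mapping.single m (lkp p m))"

lemma lookup_homogeneous_part: "lkp (homogeneous_part d p) m = (if mdeg m = d then lkp p m else 0)"
  by (auto simp: homogeneous_part_def lookup_sum lookup_single when_def in_keys_iff)

lemma homogeneous_homogeneous_part: "homogeneous d (homogeneous_part d p)"
  by (auto simp: homogeneous_mdeg in_keys_iff lookup_homogeneous_part split: if_splits)

lemma homogeneous_part_cpolys: "p \<in> cpolys V \<Longrightarrow> homogeneous_part d p \<in> cpolys V"
proof -
  have "Poly_Mapping.keys (homogeneous_part d p) \<subseteq> Poly_Mapping.keys p"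
    by (auto simp: in_keys_iff lookup_homogeneous_part split: if_splits)
  then show "p \<in> cpolys V \<Longrightarrow> homogeneous_part d p \<in> cpolys V" by (auto simp: cpolys_def)
qed

lemma lookup_mult_0: "lkp (p * q :: 'v cpoly) 0 = lkp p 0 * lkp q 0"
proof (induction p rule: cpoly_induct)
  case (single m c)
  show ?case
  proof (induction q rule: cpoly_induct)
    case (single k d)
    have "m + k = 0 \<longleftrightarrow> m = 0 \<and> k = 0" by (metis add_is_0 mdeg_add mdeg_eq_0_iff)
    then show ?case by (auto simp: mult_single lookup_single when_def)
  qed (simp add: distrib_left lookup_add)
qed (simp add: distrib_right lookup_add)

lemma comm_ring_hom_lookup_0: "comm_ring_hom (\<lambda>p :: 'v cpoly. lkp p 0)"
  by unfold_locales (auto simp: lookup_add lookup_mult_0)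

lemma comm_ring_hom_cconst: "comm_ring_hom (cconst :: complex \<Rightarrow> 'v cpoly)"
  by unfold_locales (auto simp: cconst_add cconst_mult)

text \<open>Compose with the affine map that moves the value at the origin to zero and the Jacobian matrix there to the
  identity. The adjugate serves as the inverse of that matrix, whose determinant is \<open>1\<close>.\<close>

lemma normalisation:
  assumes K: "keller n F" and deg: "\<And>i m. i < n \<Longrightarrow> m \<in> Poly_Mapping.keys (F i) \<Longrightarrow> mdeg m \<le> 3"
  shows "\<exists>F' A B. keller n F' \<and> (\<forall>i<n. A i \<in> cpolys {..<n} \<and> B i \<in> cpolys {..<n} \<and>
      homogeneous 2 (A i) \<and> homogeneous 3 (B i) \<and> F' i = cvar i + A i + B i) \<and>
    ((\<exists>G. left_inverse_map n F' G) \<longrightarrow> (\<exists>G. left_inverse_map n F G))"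
proof -
  interpret h0: comm_ring_hom "\<lambda>p :: nat cpoly. lkp p 0" by (rule comm_ring_hom_lookup_0)
  interpret hc: comm_ring_hom "cconst :: complex \<Rightarrow> nat cpoly" by (rule comm_ring_hom_cconst)
  have pF: "F j \<in> cpolys {..<n}" if "j < n" for j
    using K that by (auto simp: keller_def polynomial_map_def)
  define L where "L = mat n n (\<lambda>(i, j). lkp (F i) (mvar j))"
  define M where "M = adj_mat L"
  have L: "L \<in> carrier_mat n n" by (simp add: L_def)
  have M: "M \<in> carrier_mat n n" unfolding M_def by (rule adj_mat(1)[OF L])
  have "map_mat (\<lambda>p. lkp p 0) (jacobian_matrix n F) = L"
    by (intro eq_matI) (auto simp: jacobian_matrix_def L_def lookup_pdiff)
  then have dL: "det L = 1"
    using h0.hom_det[of "jacobian_matrix n F"] K by (simp add: keller_def)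
  moreover have "1 \<cdot>\<^sub>m 1\<^sub>m n = (1\<^sub>m n :: complex mat)" by (intro eq_matI) auto
  ultimately have inv_mult: "M * L = 1\<^sub>m n" using adj_mat(3)[OF L] by (simp add: M_def)
  then have dM: "det M = 1" using det_mult[OF M L] dL by simp
  have inv_entry: "(\<Sum>j<n. M $$ (i, j) * lkp (F j) (mvar l)) = (if i = l then 1 else 0)" if "i < n" "l < n" for i l
  proof -
    have "(\<Sum>j<n. M $$ (i, j) * lkp (F j) (mvar l)) = (M * L) $$ (i, l)"
      using that L M by (simp add: L_def scalar_prod_def atLeast0LessThan)
    then show ?thesis using that by (simp add: inv_mult)
  qed
  define \<tau> where "\<tau> i = (\<Sum>j<n. cconst (M $$ (i, j)) * (cvar j - cconst (lkp (F j) 0)))" for i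
  define F' where "F' i = csubst F (\<tau> i)" for i
  have F'_eq: "F' i = (\<Sum>j<n. cconst (M $$ (i, j)) * (F j - cconst (lkp (F j) 0)))" for i
    by (simp add: F'_def \<tau>_def csubst_sum csubst_mult csubst_diff)
  have lk: "lkp (F' i) m = (\<Sum>j<n. M $$ (i, j) * (lkp (F j) m - (lkp (F j) 0 when m = 0)))" for i m
    by (simp add: F'_eq lookup_sum lookup_cconst_mult lookup_minus lookup_cconst)
  have \<tau>_cp: "\<tau> i \<in> cpolys {..<n}" for i
    unfolding \<tau>_def by (intro cpolys_sum cpolys_mult cpolys_diff cpolys_cconst) simp
  have F'_cp: "F' i \<in> cpolys {..<n}" if "i < n" for i
    unfolding F'_eq using pF by (intro cpolys_sum cpolys_mult cpolys_diff cpolys_cconst) simp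
  have "jacobian_matrix n F' = map_mat cconst M * jacobian_matrix n F"
    using M by (intro eq_matI) (auto simp: jacobian_matrix_def F'_eq pdiff_sum pdiff_cconst_mult pdiff_diff
        scalar_prod_def atLeast0LessThan)
  then have "det (jacobian_matrix n F') = 1"
    using K M det_mult[of "map_mat cconst M" n "jacobian_matrix n F"] jacobian_matrix_carrier[of n F]
    by (simp add: keller_def dM)
  then have K': "keller n F'" using F'_cp by (simp add: keller_def polynomial_map_def)
  have eq: "F' i = cvar i + homogeneous_part 2 (F' i) + homogeneous_part 3 (F' i)" if i: "i < n" for i
  proof (rule poly_mapping_eqI)
    fix m
    have "mdeg m \<le> 3 \<or> lkp (F' i) m = 0"
    proof (cases "mdeg m \<le> 3")
      case False
      then have "lkp (F j) m = 0" if "j < n" for j using deg[OF that, of m] by (auto simp: in_keys_iff)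
      moreover have "m \<noteq> 0" using False by auto
      ultimately show ?thesis by (simp add: lk)
    qed simp
    then consider "m = 0" | "mdeg m = 1" | "mdeg m = 2" | "mdeg m = 3" | "mdeg m > 3" "lkp (F' i) m = 0"
      by (metis (no_types, lifting) One_nat_def Suc_1 le_Suc_eq le_zero_eq linorder_not_less mdeg_eq_0_iff numeral_3_eq_3)
    then show "lkp (F' i) m = lkp (cvar i + homogeneous_part 2 (F' i) + homogeneous_part 3 (F' i)) m"
    proof cases
      case 1
      have "mvar i \<noteq> (0 :: nat \<Rightarrow>\<^sub>0 nat)" using mdeg_mvar[of i] mdeg_0 by (metis zero_neq_one)
      then show ?thesis using 1
        by (simp add: lk lookup_add lookup_homogeneous_part cvar_altdef lookup_single when_def)
    next
      case 2
      then obtain l where l: "m = mvar l" using mdeg_1_imp_mvar by blast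
      have l0: "mvar l \<noteq> (0 :: nat \<Rightarrow>\<^sub>0 nat)" using mdeg_mvar[of l] mdeg_0 by (metis zero_neq_one)
      have lk_cvar: "lkp (cvar i :: nat cpoly) (mvar l) = (if i = l then 1 else 0)"
      proof -
        have "Poly_Mapping.keys (mvar i) = {i}" "Poly_Mapping.keys (mvar l) = {l}" by simp_all
        then have "mvar i = mvar l \<longleftrightarrow> i = l" by (metis singleton_inject)
        then show ?thesis by (simp add: cvar_altdef lookup_single when_def)
      qed
      show ?thesis
      proof (cases "l < n")
        case True
        then show ?thesis using l l0 inv_entry[OF i True]
          by (simp add: lk lookup_add lookup_homogeneous_part lk_cvar)
      next
        case False
        then have "mvar l \<notin> Poly_Mapping.keys (F' i)" using F'_cp[OF i] by (auto simp: cpolys_def)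
        then show ?thesis using l False i by (simp add: in_keys_iff lookup_add lookup_homogeneous_part lk_cvar)
      qed
    qed (auto simp: lookup_add lookup_homogeneous_part cvar_altdef lookup_single when_def)
  qed
  have "\<exists>G. left_inverse_map n F G" if "left_inverse_map n F' G" for G
    by (rule left_inverse_transfer[OF that, of n cvar F \<tau>])
      (auto simp: csubst_cvar_id F'_def \<tau>_cp)
  then have inv: "(\<exists>G. left_inverse_map n F' G) \<longrightarrow> (\<exists>G. left_inverse_map n F G)" by blast
  have parts: "\<forall>i<n. homogeneous_part 2 (F' i) \<in> cpolys {..<n} \<and> homogeneous_part 3 (F' i) \<in> cpolys {..<n} \<and>
      homogeneous 2 (homogeneous_part 2 (F' i)) \<and> homogeneous 3 (homogeneous_part 3 (F' i)) \<and>
      F' i = cvar i + homogeneous_part 2 (F' i) + homogeneous_part 3 (F' i)"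
    using eq F'_cp homogeneous_homogeneous_part homogeneous_part_cpolys by blast
  show ?thesis
    by (rule exI[of _ F'], rule exI[of _ "\<lambda>i. homogeneous_part 2 (F' i)"], rule exI[of _ "\<lambda>i. homogeneous_part 3 (F' i)"])
      (intro conjI K' parts inv)
qed

section \<open>Reduction to homogeneous cubic perturbations\<close>

lemma csubst_scale_homogeneous:
  assumes "homogeneous d p"
  shows "csubst (\<lambda>j. t * cvar j) p = t ^ d * p"
proof -
  have ms: "msubst (\<lambda>j. t * cvar j) m = t ^ mdeg m * msubst cvar m" for m
    by (simp add: msubst_def mdeg_def power_mult_distrib prod.distrib power_sum)
  have sgl: "cconst c * msubst cvar m = Poly_Mapping.single m c" for m and c
    using csubst_cvar_id[of "Poly_Mapping.single m c"] by (simp add: csubst_single)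
  have "csubst (\<lambda>j. t * cvar j) (Poly_Mapping.single m c) = t ^ mdeg m * Poly_Mapping.single m c" for m c
    unfolding csubst_single ms mult.left_commute[of "cconst c"] sgl ..
  then have "csubst (\<lambda>j. t * cvar j) (\<Sum>m\<in>Poly_Mapping.keys p. Poly_Mapping.single m (lkp p m)) =
      (\<Sum>m\<in>Poly_Mapping.keys p. t ^ d * Poly_Mapping.single m (lkp p m))"
    unfolding csubst_sum using assms by (intro sum.cong) (auto simp: homogeneous_mdeg)
  then show ?thesis by (simp add: sum_distrib_left[symmetric] single_sum_keys)
qed

text \<open>The map \<open>x + t A (x) + t\<^sup>2 B (x)\<close> has Jacobian determinant \<open>1\<close> for all \<open>t\<close>, being a rescaling of the given
  map. The factor \<open>t\<^sup>2 B\<close> has degree five; it is removed by new variables \<open>y\<close>: the map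
  \<open>(x + t A (x) - t\<^sup>2 y, y + B (x), t)\<close> is the composition of \<open>(x + t A (x) + t\<^sup>2 B (x), y + B (x), t)\<close> with
  \<open>(x - t\<^sup>2 y, y, t)\<close> and is cubic. The original map is recovered on \<open>t = 1\<close>, \<open>y = - B (x)\<close>.\<close>

lemma homogenisation:
  assumes K: "keller n F"
    and AB: "\<And>i. i < n \<Longrightarrow> A i \<in> cpolys {..<n} \<and> B i \<in> cpolys {..<n} \<and>
      homogeneous 2 (A i) \<and> homogeneous 3 (B i) \<and> F i = cvar i + A i + B i"
  shows "\<exists>m H. n \<le> m \<and> cubic_map m H \<and> keller m (cubic_map.F H) \<and>
    ((\<exists>G. left_inverse_map m (cubic_map.F H) G) \<longrightarrow> (\<exists>G. left_inverse_map n F G))"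
proof -
  (* x has the indices below n, y the next n ones, and t the index n + n *)
  let ?m = "n + Suc n"
  let ?t = "cvar (n + n) :: nat cpoly"
  have A: "A i \<in> cpolys {..<n}" "homogeneous 2 (A i)" and B: "B i \<in> cpolys {..<n}" "homogeneous 3 (B i)"
    and F: "F i = cvar i + A i + B i" if "i < n" for i
    using AB[OF that] by auto
  define H where "H v = (if v < n then ?t ^ 2 * cvar (n + v) - ?t * A v
    else if v < n + n then - B (v - n) else 0)" for v
  have mono: "q \<in> cpolys {..<?m}" if "q \<in> cpolys {..<n}" for q
    using that by (rule cpolys_mono) auto
  interpret cubic_map ?m H
  proof
    fix v assume v: "v < ?m"
    show "H v \<in> cpolys {..<?m}"
      unfolding H_def using v mono[OF A(1)] mono[OF B(1)]
      by (auto intro!: cpolys_diff cpolys_mult cpolys_power cpolys_uminus)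
    have "homogeneous (1 + 1 + 1) (?t * ?t * cvar (n + v))" "homogeneous (1 + 2) (?t * A v)" if "v < n"
      using A(2)[OF that] by (intro homogeneous_mult; simp)+
    then show "homogeneous 3 (H v)"
      unfolding H_def using v B(2)[of "v - n"]
      by (auto simp: power2_eq_square eval_nat_numeral intro!: homogeneous_diff homogeneous_uminus)
  qed
  have F_simps: "cubic_map.F H v = cvar v + ?t * A v - ?t ^ 2 * cvar (n + v)" "cubic_map.F H (n + v) = cvar (n + v) + B v" if "v < n" for v
    using that by (auto simp: F_def H_def)
  have F_t: "cubic_map.F H (n + n) = ?t" by (simp add: F_def H_def)
  have d0: "pdiff v q = 0" if "q \<in> cpolys {..<n}" "n \<le> v" for v q
    using pdiff_eq_0_notin[OF that(1)] that(2) by simp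
  interpret hs: comm_ring_hom "csubst (\<lambda>j. ?t * cvar j)" by (rule comm_ring_hom_csubst)
  have "det (jacobian_matrix ?m (cubic_map.F H)) = det (mat n n (\<lambda>(i, j). pdiff j (cubic_map.F H i) -
      (\<Sum>l<Suc n. pdiff (n + l) (cubic_map.F H i) * pdiff j (cubic_map.F H (n + l)))))"
  proof (rule det_jacobian_extended)
    fix l l' assume l: "l < Suc n" "l' < Suc n"
    show "pdiff (n + l') (cubic_map.F H (n + l)) = (if l = l' then 1 else 0)"
    proof (cases "l = n")
      case True
      then show ?thesis by (auto simp: F_t pdiff_cvar)
    next
      case False
      then have "l < n" using l by simp
      then show ?thesis using B(1)[of l] by (auto simp: F_simps pdiff_add pdiff_cvar d0)
    qed
  qed
  also have "mat n n (\<lambda>(i, j). pdiff j (cubic_map.F H i) -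
      (\<Sum>l<Suc n. pdiff (n + l) (cubic_map.F H i) * pdiff j (cubic_map.F H (n + l)))) =
      map_mat (csubst (\<lambda>j. ?t * cvar j)) (jacobian_matrix n F)"
  proof (rule eq_matI)
    fix i j assume "i < dim_row (map_mat (csubst (\<lambda>j. ?t * cvar j)) (jacobian_matrix n F))"
      "j < dim_col (map_mat (csubst (\<lambda>j. ?t * cvar j)) (jacobian_matrix n F))"
    then have ij: "i < n" "j < n" by (auto simp: jacobian_matrix_def)
    have hA: "homogeneous 1 (pdiff j (A i))" and hB: "homogeneous 2 (pdiff j (B i))"
      using A(2)[OF ij(1)] B(2)[OF ij(1)] by (auto intro!: homogeneous_pdiff simp: eval_nat_numeral)
    have t: "pdiff j ?t = 0" using ij by (simp add: pdiff_cvar)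
    have "(\<Sum>l<n. pdiff (n + l) (cubic_map.F H i) * pdiff j (cubic_map.F H (n + l))) =
        (\<Sum>l<n. if l = i then - (?t ^ 2) * pdiff j (B i) else 0)"
    proof (intro sum.cong refl)
      fix l assume "l \<in> {..<n}"
      then have l: "l < n" by simp
      have "pdiff (n + l) (cubic_map.F H i) = (if l = i then - (?t ^ 2) else 0)"
        using ij l A(1)[OF ij(1)]
        by (auto simp: F_simps pdiff_diff pdiff_add pdiff_mult pdiff_power pdiff_cvar d0)
      moreover have "pdiff j (cubic_map.F H (n + l)) = pdiff j (B l)"
        using l ij by (simp add: F_simps pdiff_add pdiff_cvar)
      ultimately show "pdiff (n + l) (cubic_map.F H i) * pdiff j (cubic_map.F H (n + l)) =
          (if l = i then - (?t ^ 2) * pdiff j (B i) else 0)" by simp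
    qed
    also have "\<dots> = - (?t ^ 2) * pdiff j (B i)" using ij by simp
    finally have s: "(\<Sum>l<Suc n. pdiff (n + l) (cubic_map.F H i) * pdiff j (cubic_map.F H (n + l))) = - (?t ^ 2) * pdiff j (B i)"
      by (simp add: F_t t)
    have "pdiff j (cubic_map.F H i) = pdiff j (cvar i) + ?t * pdiff j (A i)"
      using ij by (simp add: F_simps pdiff_diff pdiff_add pdiff_mult pdiff_power pdiff_cvar)
    moreover have "csubst (\<lambda>j. ?t * cvar j) (pdiff j (F i)) = pdiff j (cvar i) + ?t * pdiff j (A i) + ?t ^ 2 * pdiff j (B i)"
      unfolding F[OF ij(1)] pdiff_add csubst_add csubst_scale_homogeneous[OF hA] csubst_scale_homogeneous[OF hB]
      by (simp add: pdiff_cvar)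
    ultimately show "mat n n (\<lambda>(i, j). pdiff j (cubic_map.F H i) -
        (\<Sum>l<Suc n. pdiff (n + l) (cubic_map.F H i) * pdiff j (cubic_map.F H (n + l)))) $$ (i, j) =
        map_mat (csubst (\<lambda>j. ?t * cvar j)) (jacobian_matrix n F) $$ (i, j)"
      using ij s by (simp add: jacobian_matrix_def del: sum.lessThan_Suc)
  qed (auto simp: jacobian_matrix_def)
  finally have K': "keller ?m (cubic_map.F H)"
    using K polynomial_map_F by (simp add: keller_def)
  have "\<exists>G. left_inverse_map n F G" if "left_inverse_map ?m (cubic_map.F H) G" for G
  proof (rule left_inverse_transfer[OF that])
    define \<sigma> where "\<sigma> v = (if v < n then cvar v else if v < n + n then - B (v - n) else 1)" for v
    define \<tau> :: "nat \<Rightarrow> nat cpoly" where "\<tau> v = (if v < n then cvar v else if v < n + n then 0 else 1)" for v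
    have id: "csubst \<sigma> q = q" if "q \<in> cpolys {..<n}" for q
      using csubst_cong[OF that, of \<sigma> cvar] by (simp add: \<sigma>_def csubst_cvar_id)
    have sy: "\<And>v. v < n \<Longrightarrow> \<sigma> v = cvar v" "\<And>v. v < n \<Longrightarrow> \<sigma> (n + v) = - B v" "\<sigma> (n + n) = 1"
      by (auto simp: \<sigma>_def)
    show "csubst \<sigma> (cubic_map.F H v) = csubst F (\<tau> v)" if "v < ?m" for v
    proof -
      have "v < n \<or> (\<exists>w<n. v = n + w) \<or> v = n + n"
        using that by presburger
      then consider "v < n" | w where "v = n + w" "w < n" | "v = n + n" by blast
      then show ?thesis
      proof cases
        case 1
        then show ?thesis
          by (simp add: F_simps F \<tau>_def csubst_diff csubst_add csubst_mult csubst_power sy id A)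
      next
        case 2
        then show ?thesis
          by (simp add: F_simps \<tau>_def csubst_add sy id B)
      qed (simp add: F_t \<tau>_def sy)
    qed
    show "\<sigma> j = cvar j" if "j < n" for j using that by (simp add: \<sigma>_def)
    show "\<tau> v \<in> cpolys {..<n}" for v by (simp add: \<tau>_def)
  qed simp
  then show ?thesis using K' cubic_map_axioms by (intro exI[of _ ?m] exI[of _ H]) auto
qed

section \<open>The equivalence of the two conjectures\<close>

theorem theorem3p6:
  shows "(\<forall>n\<ge>1. jacobian_conjecture n) \<longleftrightarrow>
    (\<forall>n\<ge>1. \<forall>P. P \<in> Cz n \<and> homogeneous 4 P \<longrightarrow>
       image_conjecture_for n ((\<Sum>i<n. cvar (Xi i) ^ 2) * P) P)"
proof
  assume JC: "\<forall>n\<ge>1. jacobian_conjecture n"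
  show "\<forall>n\<ge>1. \<forall>P. P \<in> Cz n \<and> homogeneous 4 P \<longrightarrow>
       image_conjecture_for n ((\<Sum>i<n. cvar (Xi i) ^ 2) * P) P"
  proof (intro allI impI)
    fix n :: nat and P assume n: "n \<ge> 1" and P: "P \<in> Cz n \<and> homogeneous 4 P"
    have "of_Z P = csubst (\<lambda>v. case v of Z i \<Rightarrow> cvar i | Xi i \<Rightarrow> cvar i) P"
      unfolding of_Z_def using P by (intro csubst_cong[of P "Z ` {..<n}"]) (auto simp: Cz_def)
    then have "homogeneous 4 (of_Z P)"
      using P by (auto intro!: homogeneous_csubst split: xz.split)
    moreover have p: "of_Z P \<in> cpolys {..<n}"
      using P unfolding of_Z_def Cz_def by (intro cpolys_csubst[of P "Z ` {..<n}"]) auto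
    ultimately have "vanishing_property n (of_Z P)"
      using JC n by (intro jacobian_conjecture_imp_vanishing_property) auto
    then show "image_conjecture_for n ((\<Sum>i<n. cvar (Xi i) ^ 2) * P) P"
      using image_conjecture_iff_vanishing[OF p] to_Z_of_Z[of P n] P by simp
  qed
next
  assume IC: "\<forall>n\<ge>1. \<forall>P. P \<in> Cz n \<and> homogeneous 4 P \<longrightarrow>
       image_conjecture_for n ((\<Sum>i<n. cvar (Xi i) ^ 2) * P) P"
  have VP: "vanishing_property n p" if n: "n \<ge> 1" and p: "p \<in> cpolys {..<n}" "homogeneous 4 p" for n p
  proof -
    have "to_Z p \<in> Cz n" using p(1) unfolding Cz_def by (intro cpolys_csubst[OF p(1)]) auto
    moreover have "homogeneous 4 (to_Z p)" using p(2) by (intro homogeneous_csubst) auto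
    ultimately show ?thesis using IC n image_conjecture_iff_vanishing[OF p(1)] by blast
  qed
  show "\<forall>n\<ge>1. jacobian_conjecture n"
    unfolding jacobian_conjecture_def
  proof (intro allI impI)
    fix n :: nat and F assume n: "n \<ge> 1" and "polynomial_map n F \<and> det (jacobian_matrix n F) = 1"
    then have F: "keller n F" by (simp add: keller_def)
    obtain m F1 where 1: "n \<le> m" "keller m F1" "\<forall>i<m. \<forall>k\<in>Poly_Mapping.keys (F1 i). mdeg k \<le> 3"
      "(\<exists>G. left_inverse_map m F1 G) \<longrightarrow> (\<exists>G. left_inverse_map n F G)"
      using degree_reduction[OF F] by blast
    obtain F2 A B where 2: "keller m F2" "\<forall>i<m. A i \<in> cpolys {..<m} \<and> B i \<in> cpolys {..<m} \<and>
        homogeneous 2 (A i) \<and> homogeneous 3 (B i) \<and> F2 i = cvar i + A i + B i"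
      "(\<exists>G. left_inverse_map m F2 G) \<longrightarrow> (\<exists>G. left_inverse_map m F1 G)"
      using normalisation[OF 1(2)] 1(3) by blast
    obtain l H where 3: "m \<le> l" "cubic_map l H" "keller l (cubic_map.F H)"
      "(\<exists>G. left_inverse_map l (cubic_map.F H) G) \<longrightarrow> (\<exists>G. left_inverse_map m F2 G)"
      using homogenisation[OF 2(1), of A B] 2(2) by blast
    have "\<exists>G. left_inverse_map l (cubic_map.F H) G"
      using n 1(1) 3(1) by (intro vanishing_imp_cubic_left_inverse[OF VP 3(2,3)]) auto
    then obtain G where "left_inverse_map n F G" using 1(4) 2(3) 3(4) by blast
    then show "polynomial_automorphism n F" by (rule keller_left_inverse_imp_automorphism[OF F])
  qed
qed

end
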